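(* Let $\mathbf{H}$ be a pseudovariety of groups and let $\mathbf{V}$ be a local pseudovariety of monoids. Then the pseudovariety of monoids $\mathbf{LH}\,ⓜ\,\mathbf{V}$ (the Mal'cev product of $\mathbf{LH}$ with $\mathbf{V}$) is local under either of the following circumstances: (1) $\mathbf{H}$ is a Fitting pseudovariety of groups and $\mathbf{V}$ contains the 6-element Brandt monoid $B_2^1$; (2) $\mathbf{H}$ is non-trivial and closed under extension.
   Context: All semigroups, monoids, groups and categories are finite. A pseudovariety of semigroups (respectively monoids, groups) is a class of finite semigroups (resp. monoids, groups) closed under finite direct products, subsemigroups (resp. submonoids, subgroups) and homomorphic images. A pseudovariety of groups $\mathbf{H}$ is Fitting if whenever $G$ is a finite group and $K_1,K_2\lhd G$ are normal subgroups belonging to $\mathbf{H}$, then $K_1K_2\in\mathbf{H}$. It is closed under extension if $N\lhd G$ with $N, G/N\in\mathbf{H}$ implies $G\in\mathbf{H}$. It is non-trivial if it contains a non-trivial group. $\mathbf{LH}$ is the pseudovariety of all semigroups $S$ such that $eSe\in\mathbf{H}$ for every idempotent $e\in S$. For a pseudovariety of monoids $\mathbf{V}$, the Mal'cev product $\mathbf{LH}\,ⓜ\,\mathbf{V}$ is the pseudovariety of monoids generated by all monoids $M$ admitting a homomorphism $\varphi:M\to N$ with $N\in\mathbf{V}$ such that $\varphi^{-1}(e)\in\mathbf{LH}$ for each idempotent $e\in N$ (empty preimages are allowed); it consists precisely of all homomorphic images of such monoids $M$. For a category $C$ and an object $c$, the local monoid at $c$ is $C_c=C(c,c)$. A category $C$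 divides a category $D$ if there is a function $\theta$ from objects of $C$ to objects of $D$ and, for each arrow $m:c\to c'$ of $C$, a nonempty set $m\theta\subseteq D(c\theta,c'\theta)$, such that $1_{c\theta}\in 1_c\theta$, $(m\theta)(n\theta)\subseteq (mn)\theta$ whenever $mn$ is defined, and $m\theta\cap m'\theta=\emptyset$ for distinct coterminal arrows $m\neq m'$. For a pseudovariety of monoids $\mathbf{V}$, $\mathbf{gV}$ is the pseudovariety of categories generated by the members of $\mathbf{V}$ viewed as one-object categories; equivalently, the class of categories dividing some member of $\mathbf{V}$. $\ell\mathbf{V}$ is the class of all categories all of whose local monoids belong to $\mathbf{V}$. $\mathbf{V}$ is local if $\mathbf{gV}=\ell\mathbf{V}$. The Brandt monoid $B_2^1$ is the multiplicative monoid $\{I,0,E_{11},E_{12},E_{21},E_{22}\}$, where the $E_{ij}$ are the $2\times 2$ matrix units, $0$ is the zero matrix and $I$ is the identity matrix. *)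

theory Defs
  imports "HOL-Algebra.Product_Groups" "HOL-Analysis.Finite_Cartesian_Product"
begin

text \<open>
  A class of finite structures is represented by the set of its members whose underlying set(s)
  consist of natural numbers. Every finite structure is isomorphic to such a member, and the classes
  considered here are closed under isomorphism. A structure over another type is in the
  class when it has an isomorphic copy there.
\<close>

definition belongs_to :: "('a, 'b) monoid_scheme \<Rightarrow> nat monoid set \<Rightarrow> bool" where
  "belongs_to M V \<longleftrightarrow> monoid M \<and> (\<exists>N\<in>V. M \<cong> N)"


subsection \<open>Pseudovarieties of monoids and of groups\<close>

text \<open>
  The product of the empty family is the one-element monoid, so pseudovarieties are nonempty.
  In the clauses on products and on homomorphic images the assumption that \<open>P\<close> is a monoid
  matters, as \<^const>\<open>hom\<close> and \<^const>\<open>iso\<close> do not constrain the field \<^const>\<open>one\<close>; between monoids, a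
  surjective multiplicative map preserves the identity.
\<close>

definition monoid_pseudovariety :: "nat monoid set \<Rightarrow> bool" where
  "monoid_pseudovariety V \<longleftrightarrow>
     (\<forall>M\<in>V. monoid M \<and> finite (carrier M)) \<and>
     (\<forall>(I :: nat set) F P. finite I \<and> (\<forall>i\<in>I. F i \<in> V) \<and> monoid P \<and> P \<cong> product_group I F
        \<longrightarrow> P \<in> V) \<and>
     (\<forall>M\<in>V. \<forall>A. submonoid A M \<longrightarrow> M\<lparr>carrier := A\<rparr> \<in> V) \<and>
     (\<forall>M\<in>V. \<forall>P \<phi>. monoid P \<and> \<phi> \<in> epi M P \<longrightarrow> P \<in> V)"

definition group_pseudovariety :: "nat monoid set \<Rightarrow> bool" where
  "group_pseudovariety H \<longleftrightarrow>
     (\<forall>G\<in>H. group G \<and> finite (carrier G)) \<and>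
     (\<forall>(I :: nat set) F P. finite I \<and> (\<forall>i\<in>I. F i \<in> H) \<and> group P \<and> P \<cong> product_group I F
        \<longrightarrow> P \<in> H) \<and>
     (\<forall>G\<in>H. \<forall>A. subgroup A G \<longrightarrow> G\<lparr>carrier := A\<rparr> \<in> H) \<and>
     (\<forall>G\<in>H. \<forall>P \<phi>. group P \<and> \<phi> \<in> epi G P \<longrightarrow> P \<in> H)"

definition Fitting :: "nat monoid set \<Rightarrow> bool" where
  "Fitting H \<longleftrightarrow>
     (\<forall>G K\<^sub>1 K\<^sub>2. group G \<and> finite (carrier G) \<and> K\<^sub>1 \<lhd> G \<and> K\<^sub>2 \<lhd> G \<and>
        G\<lparr>carrier := K\<^sub>1\<rparr> \<in> H \<and> G\<lparr>carrier := K\<^sub>2\<rparr> \<in> H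
        \<longrightarrow> G\<lparr>carrier := K\<^sub>1 <#>\<^bsub>G\<^esub> K\<^sub>2\<rparr> \<in> H)"

definition closed_under_extension :: "nat monoid set \<Rightarrow> bool" where
  "closed_under_extension H \<longleftrightarrow>
     (\<forall>G N. group G \<and> finite (carrier G) \<and> N \<lhd> G \<and>
        G\<lparr>carrier := N\<rparr> \<in> H \<and> belongs_to (G Mod N) H
        \<longrightarrow> G \<in> H)"

definition nontrivial :: "nat monoid set \<Rightarrow> bool" where
  "nontrivial H \<longleftrightarrow> (\<exists>G\<in>H. carrier G \<noteq> {\<one>\<^bsub>G\<^esub>})"


subsection \<open>Semigroups and the class LH\<close>

record 'a semigrp = "'a partial_object" +
  sprod :: "'a \<Rightarrow> 'a \<Rightarrow> 'a"

text \<open>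
  The empty semigroup is allowed, and lies vacuously in \<open>LH\<close>; this is how empty preimages are
  admitted in the Mal'cev product.
\<close>

definition is_semigrp :: "'a semigrp \<Rightarrow> bool" where
  "is_semigrp S \<longleftrightarrow>
     (\<forall>x\<in>carrier S. \<forall>y\<in>carrier S. sprod S x y \<in> carrier S) \<and>
     (\<forall>x\<in>carrier S. \<forall>y\<in>carrier S. \<forall>z\<in>carrier S.
        sprod S (sprod S x y) z = sprod S x (sprod S y z))"

text \<open>The monoid \<open>eSe\<close> with identity \<open>e\<close>.\<close>

definition corner :: "'a semigrp \<Rightarrow> 'a \<Rightarrow> 'a monoid" where
  "corner S e =
     \<lparr>carrier = {sprod S (sprod S e s) e | s. s \<in> carrier S}, monoid.mult = sprod S, one = e\<rparr>"

definition LH :: "nat monoid set \<Rightarrow> nat semigrp set" where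
  "LH H = {S. is_semigrp S \<and> finite (carrier S) \<and>
              (\<forall>e\<in>carrier S. sprod S e e = e \<longrightarrow> corner S e \<in> H)}"


subsection \<open>The Mal'cev product\<close>

definition monoid_hom :: "('a, 'c) monoid_scheme \<Rightarrow> ('b, 'd) monoid_scheme \<Rightarrow> ('a \<Rightarrow> 'b) set" where
  "monoid_hom M N = {\<phi> \<in> hom M N. \<phi> \<one>\<^bsub>M\<^esub> = \<one>\<^bsub>N\<^esub>}"

definition preimage_semigrp :: "('a, 'c) monoid_scheme \<Rightarrow> ('a \<Rightarrow> 'b) \<Rightarrow> 'b \<Rightarrow> 'a semigrp" where
  "preimage_semigrp M \<phi> e = \<lparr>carrier = {m \<in> carrier M. \<phi> m = e}, sprod = monoid.mult M\<rparr>"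

definition Malcev_generators :: "nat semigrp set \<Rightarrow> nat monoid set \<Rightarrow> nat monoid set" where
  "Malcev_generators W V =
     {M. monoid M \<and> finite (carrier M) \<and>
         (\<exists>N\<in>V. \<exists>\<phi>\<in>monoid_hom M N.
            \<forall>e\<in>carrier N. e \<otimes>\<^bsub>N\<^esub> e = e \<longrightarrow> preimage_semigrp M \<phi> e \<in> W)}"

definition Malcev :: "nat semigrp set \<Rightarrow> nat monoid set \<Rightarrow> nat monoid set" where
  "Malcev W V = monoid_pseudovariety hull (Malcev_generators W V)"

lemma monoid_pseudovariety_all: "monoid_pseudovariety {M. monoid M \<and> finite (carrier M)}"
  unfolding monoid_pseudovariety_def
proof (intro conjI allI impI ballI, goal_cases)
  case (3 I F P)
  then have "finite (carrier (product_group I F))"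
    by (auto intro: finite_PiE)
  then show ?case
    using 3 by (auto simp: is_iso_def iso_def bij_betw_finite)
next
  case (4 M A)
  then show ?case
    by (auto simp: submonoid.submonoid_is_monoid intro: finite_subset[OF submonoid.subset])
next
  case (5 M P \<phi>)
  then show ?case
    by (auto simp: epi_def dest: sym)
qed auto

lemma monoid_pseudovariety_Inter:
  assumes "\<V> \<noteq> {}" "\<And>V. V \<in> \<V> \<Longrightarrow> monoid_pseudovariety V"
  shows "monoid_pseudovariety (\<Inter>\<V>)"
proof -
  obtain V\<^sub>0 where "V\<^sub>0 \<in> \<V>" using assms(1) by blast
  with assms(2) have *: "\<forall>M\<in>\<Inter>\<V>. monoid M \<and> finite (carrier M)"
    unfolding monoid_pseudovariety_def by blast
  show ?thesis
    unfolding monoid_pseudovariety_def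
  proof (intro conjI)
    show "\<forall>(I :: nat set) F P. finite I \<and> (\<forall>i\<in>I. F i \<in> \<Inter>\<V>) \<and> monoid P \<and> P \<cong> product_group I F
      \<longrightarrow> P \<in> \<Inter>\<V>"
    proof (intro allI impI InterI)
      fix I :: "nat set" and F and P :: "nat monoid" and V
      assume "finite I \<and> (\<forall>i\<in>I. F i \<in> \<Inter>\<V>) \<and> monoid P \<and> P \<cong> product_group I F" "V \<in> \<V>"
      moreover from this have "\<forall>i\<in>I. F i \<in> V" by blast
      ultimately show "P \<in> V"
        using assms(2)[of V] unfolding monoid_pseudovariety_def by meson
    qed
    show "\<forall>M\<in>\<Inter>\<V>. \<forall>A. submonoid A M \<longrightarrow> M\<lparr>carrier := A\<rparr> \<in> \<Inter>\<V>"
      using assms(2) unfolding monoid_pseudovariety_def by (meson InterD InterI)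
    show "\<forall>M\<in>\<Inter>\<V>. \<forall>P \<phi>. monoid P \<and> \<phi> \<in> epi M P \<longrightarrow> P \<in> \<Inter>\<V>"
      using assms(2) unfolding monoid_pseudovariety_def by (meson InterD InterI)
  qed (fact *)
qed

text \<open>The hull is a genuine pseudovariety, and not an intersection over no pseudovariety at all.\<close>

lemma monoid_pseudovariety_Malcev: "monoid_pseudovariety (Malcev W V)"
  unfolding Malcev_def hull_def
  by (rule monoid_pseudovariety_Inter)
     (use monoid_pseudovariety_all in \<open>auto simp: Malcev_generators_def\<close>)


subsection \<open>Categories, division and locality\<close>

text \<open>Composition \<open>ccomp C m n\<close> is in diagrammatic order: it is \<open>mn\<close> for \<open>m : a \<rightarrow> b\<close> and \<open>n : b \<rightarrow> c\<close>.\<close>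

record ('o, 'm) cat =
  obj :: "'o set"
  arr :: "'m set"
  src :: "'m \<Rightarrow> 'o"
  tgt :: "'m \<Rightarrow> 'o"
  ident :: "'o \<Rightarrow> 'm"
  ccomp :: "'m \<Rightarrow> 'm \<Rightarrow> 'm"

definition hom_set :: "('o, 'm) cat \<Rightarrow> 'o \<Rightarrow> 'o \<Rightarrow> 'm set" where
  "hom_set C a b = {m \<in> arr C. src C m = a \<and> tgt C m = b}"

definition is_category :: "('o, 'm) cat \<Rightarrow> bool" where
  "is_category C \<longleftrightarrow>
     (\<forall>m\<in>arr C. src C m \<in> obj C \<and> tgt C m \<in> obj C) \<and>
     (\<forall>a\<in>obj C. ident C a \<in> hom_set C a a) \<and>
     (\<forall>m\<in>arr C. \<forall>n\<in>arr C. tgt C m = src C n \<longrightarrow>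
        ccomp C m n \<in> hom_set C (src C m) (tgt C n)) \<and>
     (\<forall>m\<in>arr C. ccomp C (ident C (src C m)) m = m \<and> ccomp C m (ident C (tgt C m)) = m) \<and>
     (\<forall>m\<in>arr C. \<forall>n\<in>arr C. \<forall>p\<in>arr C. tgt C m = src C n \<and> tgt C n = src C p \<longrightarrow>
        ccomp C (ccomp C m n) p = ccomp C m (ccomp C n p))"

definition finite_category :: "('o, 'm) cat \<Rightarrow> bool" where
  "finite_category C \<longleftrightarrow> is_category C \<and> finite (obj C) \<and> finite (arr C)"

definition local_monoid :: "('o, 'm) cat \<Rightarrow> 'o \<Rightarrow> 'm monoid" where
  "local_monoid C c = \<lparr>carrier = hom_set C c c, monoid.mult = ccomp C, one = ident C c\<rparr>"

definition one_object_cat :: "('a, 'b) monoid_scheme \<Rightarrow> (unit, 'a) cat" where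
  "one_object_cat M =
     \<lparr>obj = UNIV, arr = carrier M, src = (\<lambda>_. ()), tgt = (\<lambda>_. ()),
      ident = (\<lambda>_. \<one>\<^bsub>M\<^esub>), ccomp = monoid.mult M\<rparr>"

text \<open>Below, \<open>f\<close> is the object part of the division \<open>\<theta>\<close> and \<open>t\<close> its arrow part.\<close>

definition cat_divides :: "('o, 'm) cat \<Rightarrow> ('p, 'n) cat \<Rightarrow> bool" where
  "cat_divides C D \<longleftrightarrow>
     (\<exists>(f :: 'o \<Rightarrow> 'p) (t :: 'm \<Rightarrow> 'n set).
        (\<forall>c\<in>obj C. f c \<in> obj D) \<and>
        (\<forall>m\<in>arr C. t m \<noteq> {} \<and> t m \<subseteq> hom_set D (f (src C m)) (f (tgt C m))) \<and>
        (\<forall>c\<in>obj C. ident D (f c) \<in> t (ident C c)) \<and>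
        (\<forall>m\<in>arr C. \<forall>n\<in>arr C. tgt C m = src C n \<longrightarrow>
           (\<forall>x\<in>t m. \<forall>y\<in>t n. ccomp D x y \<in> t (ccomp C m n))) \<and>
        (\<forall>m\<in>arr C. \<forall>m'\<in>arr C. src C m = src C m' \<and> tgt C m = tgt C m' \<and> m \<noteq> m' \<longrightarrow>
           t m \<inter> t m' = {}))"

definition gV :: "nat monoid set \<Rightarrow> (nat, nat) cat set" where
  "gV V = {C. finite_category C \<and> (\<exists>M\<in>V. cat_divides C (one_object_cat M))}"

definition lV :: "nat monoid set \<Rightarrow> (nat, nat) cat set" where
  "lV V = {C. finite_category C \<and> (\<forall>c\<in>obj C. local_monoid C c \<in> V)}"

definition is_local :: "nat monoid set \<Rightarrow> bool" where
  "is_local V \<longleftrightarrow> gV V = lV V"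


subsection \<open>The Brandt monoid\<close>

definition matrix_unit :: "2 \<Rightarrow> 2 \<Rightarrow> int^2^2" where
  "matrix_unit i j = (\<chi> r c. if r = i \<and> c = j then 1 else 0)"

definition Brandt_monoid :: "(int^2^2) monoid" where
  "Brandt_monoid =
     \<lparr>carrier = {mat 1, 0, matrix_unit 1 1, matrix_unit 1 2, matrix_unit 2 1, matrix_unit 2 2},
      monoid.mult = (**), one = mat 1\<rparr>"

end

theory Submission
  imports Defs "HOL-Algebra.SndIsomorphismGrp" "HOL-Analysis.Cartesian_Space"
begin

text \<open>
  Call a homomorphism \<open>\<phi> : M \<rightarrow> N\<close> an LH-homomorphism if for every idempotent \<open>f\<close> of \<open>M\<close> the
  elements \<open>x = fx = xf\<close> with \<open>\<phi> x = \<phi> f\<close> form a group in \<open>H\<close>, and define LH-congruences on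
  a category in the same way, with the class of an idempotent loop \<open>f\<close> instead of the fibre. The members
  of the Mal'cev product are the images of monoids with an LH-homomorphism into a member of
  \<open>V\<close> (\<open>Malcev_eq_images\<close>). That a divisor of a member is locally in the product is formal
  (\<open>gV_subset_lV\<close>). For the converse let \<open>C\<close> be a category that is locally in the product; a
  monoid with an LH-homomorphism into a member of \<open>V\<close> has to be found that \<open>C\<close> divides.

  The first step finds an LH-congruence of \<open>C\<close> with quotient locally in \<open>V\<close>. In both cases
  \<open>H\<close> is a Fitting pseudovariety, so for each idempotent \<open>e\<close> the group of units \<open>U\<^sub>e\<close> of
  \<open>eCe\<close> has a largest normal subgroup \<open>K\<^sub>e\<close> in \<open>H\<close>. Coterminal arrows \<open>x\<close> and \<open>y\<close> are
  congruent if for all \<open>u = eu\<close> and \<open>v = ve\<close> the loops \<open>uxv\<close> and \<open>uyv\<close> are either both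
  outside \<open>U\<^sub>e\<close> or in the same coset of \<open>K\<^sub>e\<close>. If \<open>\<psi>\<close> maps \<open>M\<close> onto a local monoid of \<open>C\<close>
  and \<open>\<phi>\<close> is an LH-homomorphism on \<open>M\<close>, then a group in \<open>M\<close> lies over \<open>U\<^sub>e\<close>, the kernel of
  \<open>\<phi>\<close> on it has a normal image that lies in \<open>H\<close>, and so \<open>\<phi> m = \<phi> m'\<close> implies that \<open>\<psi> m\<close> and
  \<open>\<psi> m'\<close> are congruent (\<open>radical_cong_of_LH_image\<close>). Hence the quotient is locally in \<open>V\<close>,
  and as \<open>V\<close> is local it divides some \<open>N\<close> in \<open>V\<close>: there is a relational morphism from \<open>C\<close> to
  \<open>N\<close> that confuses only congruent arrows (\<open>ex_LH_congruence\<close>).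

  If \<open>V\<close> contains the Brandt monoid, let the arrows of \<open>C\<close> together with a zero for
  undefined products act as a monoid, and attach to every element a label, consisting of an
  element of \<open>N\<close> and of matrix units that describe the end points of the arrow. The labels
  separate the zero from the arrows, so that the fibre over an idempotent label of an arrow is
  contained in one congruence class of loops, and the projection to the labels is an LH-homomorphism
  (\<open>LH_over_divisor_Brandt\<close>).

  If \<open>H\<close> is non-trivial and closed under extension, a zero need not be available in \<open>V\<close>, but
  LH-homomorphisms compose (\<open>LH_hom_comp\<close>), so the congruence can be resolved in steps. By
  induction on the number of arrows it suffices to pass from a relational morphism \<open>C \<rightarrow> N\<close>
  that confuses arrows within the classes of a minimal non-trivial LH-congruence \<open>R\<close> to one
  that confuses nothing. The kernel category of \<open>R\<close> has the arrows \<open>(l, m, r)\<close> that insert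
  \<open>m\<close> between the classes of \<open>l\<close> and \<open>r\<close>. Minimality of \<open>R\<close> implies that its local monoids,
  modulo equality of action, are groups in \<open>H\<close> (\<open>local_group_KC\<close>). A category with local
  groups in a non-trivial \<open>H\<close> divides a group \<open>K\<close> that is a product of these groups and
  copies of one non-trivial group (\<open>rel_morph_KK\<close>): within a strongly connected component a
  path is measured by the group at a base point, and an arrow between different components,
  which can occur only once on a path, by a non-trivial element. Reading a path of \<open>C\<close>
  letter by letter in the kernel category is what the block product of \<open>N\<close> with \<open>K\<close> does,
  and its projection to \<open>N\<close> is an LH-homomorphism (\<open>lift_rel_morph\<close>).
\<close>

section \<open>Idempotents in finite semigroups\<close>

fun spower :: "('a \<Rightarrow> 'a \<Rightarrow> 'a) \<Rightarrow> 'a \<Rightarrow> nat \<Rightarrow> 'a" where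
  "spower f x 0 = x"
| "spower f x (Suc n) = f x (spower f x n)"

locale finite_semigroup_on =
  fixes B :: "'a set" and f :: "'a \<Rightarrow> 'a \<Rightarrow> 'a"
  assumes fin: "finite B"
    and closed: "\<And>x y. x \<in> B \<Longrightarrow> y \<in> B \<Longrightarrow> f x y \<in> B"
    and assoc: "\<And>x y z. x \<in> B \<Longrightarrow> y \<in> B \<Longrightarrow> z \<in> B \<Longrightarrow> f (f x y) z = f x (f y z)"
begin

lemma spower_in: "x \<in> B \<Longrightarrow> spower f x n \<in> B"
  by (induction n) (auto simp: closed)

lemma spower_add: "x \<in> B \<Longrightarrow> f (spower f x m) (spower f x n) = spower f x (Suc (m + n))"
  by (induction m) (auto simp: assoc spower_in)

lemma idempotent_spower:
  assumes x: "x \<in> B"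
  obtains n where "f (spower f x n) (spower f x n) = spower f x n"
proof -
  have "\<not> inj_on (spower f x) UNIV"
    using finite_imageD[of "spower f x" UNIV] finite_subset[OF _ fin, of "range (spower f x)"]
      spower_in[OF x] by auto
  then obtain i d where id: "spower f x i = spower f x (i + Suc d)"
  proof -
    obtain a b where "spower f x a = spower f x b" "a < b"
      using \<open>\<not> inj_on _ _\<close> unfolding inj_on_def by (metis linorder_neqE_nat)
    then show thesis using that less_imp_Suc_add[of a b] by auto
  qed
  have shift: "spower f x n = spower f x (n + Suc d)" if "n \<ge> i" for n
  proof (cases "n = i")
    case False
    then obtain k where k: "n = Suc (k + i)" using \<open>n \<ge> i\<close>
      using less_imp_Suc_add[of i n] by (auto simp: add.commute)
    show ?thesis
      using spower_add[OF x, of k i] spower_add[OF x, of k "i + Suc d"] id k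
      by (simp add: add.assoc)
  qed (use id in simp)
  have period: "spower f x n = spower f x (n + j * Suc d)" if "n \<ge> i" for n j
  proof (induction j)
    case (Suc j)
    then show ?case using shift[of "n + j * Suc d"] that by (simp add: algebra_simps)
  qed simp
  \<comment> \<open>Squaring replaces the exponent \<open>Suc n\<close> by its double. So \<open>Suc n\<close> has to be a multiple of the
    period \<open>Suc d\<close>, and large enough to be beyond the preperiod.\<close>
  define n where "n = Suc d * Suc i - 1"
  have n: "n \<ge> i" "Suc n = Suc i * Suc d" unfolding n_def by auto
  have "f (spower f x n) (spower f x n) = spower f x (n + Suc n)"
    by (simp add: spower_add x)
  also have "\<dots> = spower f x n" using period[OF n(1), of "Suc i"] n(2) by metis
  finally show thesis by (rule that)
qed

text \<open>If the idempotent \<open>f x y\<close> is known to be an identity, then \<open>y\<close> is an inverse of \<open>x\<close>.\<close>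

lemma idempotent_multiple:
  assumes x: "x \<in> B"
  obtains y where "y \<in> B" "f (f x y) (f x y) = f x y" "f y x = f x y"
proof -
  obtain n where n: "f (spower f x n) (spower f x n) = spower f x n"
    using idempotent_spower[OF x] .
  let ?y = "spower f x (n + n)"
  have "f x ?y = spower f x n" using n spower_add[OF x, of n n] by simp
  moreover have "f ?y x = spower f x n"
    using n spower_add[OF x, of n n] spower_add[OF x, of "n + n" 0] by simp
  ultimately show thesis using that[of ?y] n spower_in[OF x] by simp
qed

lemma ex_idempotent:
  assumes "B \<noteq> {}"
  obtains i where "i \<in> B" "f i i = i"
proof -
  obtain x where x: "x \<in> B" using assms by blast
  show thesis using idempotent_multiple[OF x] closed[OF x] that by blast
qed

end

lemma finite_monoid_unique_idempotent_group:
  assumes "monoid M" "finite (carrier M)"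
    and uniq: "\<And>i. i \<in> carrier M \<Longrightarrow> i \<otimes>\<^bsub>M\<^esub> i = i \<Longrightarrow> i = \<one>\<^bsub>M\<^esub>"
  shows "group M"
proof -
  interpret monoid M by fact
  interpret S: finite_semigroup_on "carrier M" "(\<otimes>\<^bsub>M\<^esub>)"
    by standard (auto simp: assms m_assoc)
  show ?thesis
  proof (rule monoid.group_l_invI[OF assms(1)])
    fix x assume x: "x \<in> carrier M"
    obtain y where "y \<in> carrier M" "(x \<otimes>\<^bsub>M\<^esub> y) \<otimes>\<^bsub>M\<^esub> (x \<otimes>\<^bsub>M\<^esub> y) = x \<otimes>\<^bsub>M\<^esub> y" "y \<otimes>\<^bsub>M\<^esub> x = x \<otimes>\<^bsub>M\<^esub> y"
      using S.idempotent_multiple[OF x] .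
    moreover from this have "x \<otimes>\<^bsub>M\<^esub> y = \<one>\<^bsub>M\<^esub>" using x by (intro uniq) auto
    ultimately show "\<exists>y\<in>carrier M. y \<otimes>\<^bsub>M\<^esub> x = \<one>\<^bsub>M\<^esub>" by auto
  qed
qed

section \<open>Membership up to isomorphism\<close>

lemma epi_hom: "h \<in> epi M P \<Longrightarrow> h \<in> hom M P"
  and epi_image: "h \<in> epi M P \<Longrightarrow> h ` carrier M = carrier P"
  by (simp_all add: epi_def)

lemma epi_obtain:
  assumes "h \<in> epi M P" "y \<in> carrier P"
  obtains x where "x \<in> carrier M" "h x = y"
  using assms(2) unfolding epi_image[OF assms(1), symmetric] by (metis imageE)

lemma epiI: "h \<in> hom M P \<Longrightarrow> (\<And>y. y \<in> carrier P \<Longrightarrow> \<exists>x\<in>carrier M. h x = y) \<Longrightarrow> h \<in> epi M P"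
  unfolding epi_def hom_def by blast

lemma epi_one:
  assumes "monoid M" "monoid P" "h \<in> epi M P"
  shows "h \<one>\<^bsub>M\<^esub> = \<one>\<^bsub>P\<^esub>"
proof -
  interpret M: monoid M by fact
  interpret P: monoid P by fact
  have hh: "h \<in> hom M P" by (rule epi_hom[OF assms(3)])
  obtain x where x: "x \<in> carrier M" "h x = \<one>\<^bsub>P\<^esub>" by (rule epi_obtain[OF assms(3) P.one_closed])
  have h1: "h \<one>\<^bsub>M\<^esub> \<in> carrier P" by (rule hom_in_carrier[OF hh M.one_closed])
  have "h (\<one>\<^bsub>M\<^esub> \<otimes>\<^bsub>M\<^esub> x) = h \<one>\<^bsub>M\<^esub> \<otimes>\<^bsub>P\<^esub> h x"
    by (rule hom_mult[OF hh M.one_closed x(1)])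
  then show ?thesis using P.r_one[OF h1] M.l_one[OF x(1)] x(2) by metis
qed

lemma iso_imp_epi: "h \<in> iso M P \<Longrightarrow> h \<in> epi M P"
  unfolding iso_iff_mon_epi by blast

lemma monoid_iso_sym:
  assumes "monoid M" "h \<in> iso M P"
  shows "inv_into (carrier M) h \<in> iso P M"
proof -
  interpret monoid M by fact
  have b: "bij_betw h (carrier M) (carrier P)" and hh: "h \<in> hom M P"
    using assms(2) by (auto simp: iso_def)
  let ?g = "inv_into (carrier M) h"
  have gb: "bij_betw ?g (carrier P) (carrier M)" by (rule bij_betw_inv_into[OF b])
  have "?g (x \<otimes>\<^bsub>P\<^esub> y) = ?g x \<otimes>\<^bsub>M\<^esub> ?g y" if "x \<in> carrier P" "y \<in> carrier P" for x y
  proof -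
    have gx: "?g x \<in> carrier M" "?g y \<in> carrier M" using bij_betwE[OF gb] that by blast+
    have "h (?g x \<otimes>\<^bsub>M\<^esub> ?g y) = x \<otimes>\<^bsub>P\<^esub> y"
      using gx hh that b by (simp add: hom_mult bij_betw_inv_into_right)
    then show ?thesis using gx b by (metis bij_betw_inv_into_left m_closed)
  qed
  then have "?g \<in> hom P M" using bij_betwE[OF gb] by (auto intro: homI)
  then show ?thesis using gb by (rule isoI)
qed

lemma monoid_is_iso_sym: "monoid M \<Longrightarrow> M \<cong> P \<Longrightarrow> P \<cong> M"
  using monoid_iso_sym unfolding is_iso_def by blast

lemma finite_monoid_nat_copy:
  fixes M :: "('a, 'b) monoid_scheme"
  assumes "monoid M" "finite (carrier M)"
  obtains P :: "nat monoid" and h where "monoid P" "finite (carrier P)" "h \<in> iso M P" "h \<one>\<^bsub>M\<^esub> = \<one>\<^bsub>P\<^esub>"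
proof -
  interpret monoid M by fact
  obtain h :: "'a \<Rightarrow> nat" and n where h: "bij_betw h (carrier M) {..<n}"
    using ex_bij_betw_finite_nat[OF assms(2)] by (metis atLeast0LessThan)
  let ?g = "inv_into (carrier M) h"
  define P where "P = \<lparr>carrier = {..<n}, monoid.mult = (\<lambda>x y. h (?g x \<otimes>\<^bsub>M\<^esub> ?g y)), one = h \<one>\<^bsub>M\<^esub>\<rparr>"
  have hg: "h (?g x) = x" "?g x \<in> carrier M" if "x < n" for x
    using that bij_betw_inv_into_right[OF h] bij_betwE[OF bij_betw_inv_into[OF h]] by auto
  have gh: "?g (h x) = x" "h x < n" if "x \<in> carrier M" for x
    using that bij_betw_inv_into_left[OF h] bij_betwE[OF h] by auto
  have "monoid P"
    by (rule monoidI) (auto simp: P_def hg gh m_assoc)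
  moreover have "h \<in> iso M P"
    using h by (auto simp: iso_def hom_def P_def gh bij_betw_def)
  ultimately show thesis by (intro that[of P h]) (auto simp: P_def)
qed

lemma product_monoid:
  assumes "\<And>i. i \<in> I \<Longrightarrow> monoid (G i)"
  shows "monoid (product_group I G)"
proof (rule monoidI, goal_cases)
  case (1 x y)
  then show ?case using assms by (auto simp: PiE_iff intro: monoid.m_closed)
next
  case 2
  then show ?case using assms by (auto simp: PiE_iff intro: monoid.one_closed)
next
  case (3 x y z)
  then show ?case using assms by (auto simp: PiE_iff monoid.m_assoc intro!: restrict_ext)
next
  case (4 x)
  then show ?case using assms by (auto simp: PiE_iff monoid.l_one extensional_def restrict_def fun_eq_iff)
next
  case (5 x)
  then show ?case using assms by (auto simp: PiE_iff monoid.r_one extensional_def restrict_def fun_eq_iff)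
qed

text \<open>Both kinds of pseudovarieties are closed only under products over sets of natural numbers
  of structures on natural numbers; this reduces other finite products to these.\<close>

lemma product_group_nat_index:
  fixes F :: "'i \<Rightarrow> ('a, 'b) monoid_scheme"
  assumes "finite I" and F: "\<And>i. i \<in> I \<Longrightarrow> belongs_to (F i) X"
  obtains J :: "nat set" and F' :: "nat \<Rightarrow> nat monoid"
  where "finite J" "\<forall>j\<in>J. F' j \<in> X" "product_group I F \<cong> product_group J F'"
proof -
  obtain f :: "'i \<Rightarrow> nat" where f: "inj_on f I"
    using finite_imp_inj_to_nat_seg[OF assms(1)] by blast
  have "\<forall>i\<in>I. \<exists>N h. N \<in> X \<and> h \<in> iso (F i) N"
    using F unfolding belongs_to_def is_iso_def by blast
  then obtain N h where N: "\<And>i. i \<in> I \<Longrightarrow> N i \<in> X" and h: "\<And>i. i \<in> I \<Longrightarrow> h i \<in> iso (F i) (N i)"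
    by metis
  let ?g = "inv_into I f"
  have gf: "?g (f i) = i" if "i \<in> I" for i using f that by simp
  have gI: "?g j \<in> I" "f (?g j) = j" if "j \<in> f ` I" for j
    using that by (auto simp: inv_into_into f_inv_into_f)
  let ?P = "product_group I F" and ?Q = "product_group (f ` I) (N \<circ> ?g)"
  let ?m = "\<lambda>x. \<lambda>j\<in>f ` I. h (?g j) (x (?g j))"
  have hb: "h i \<in> hom (F i) (N i)" "bij_betw (h i) (carrier (F i)) (carrier (N i))" if "i \<in> I" for i
    using h[OF that] by (auto simp: iso_def)
  have mon: "monoid (F i)" if "i \<in> I" for i using F[OF that] by (simp add: belongs_to_def)
  have mQ: "?m x \<in> carrier ?Q" if "x \<in> carrier ?P" for x
  proof -
    have "h (?g j) (x (?g j)) \<in> carrier ((N \<circ> ?g) j)" if "j \<in> f ` I" for j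
      using \<open>x \<in> carrier ?P\<close> hom_in_carrier[OF hb(1)[OF gI(1)[OF that]]] gI(1)[OF that]
      by (simp add: PiE_iff)
    then show ?thesis by simp
  qed
  have "?m \<in> iso ?P ?Q"
    unfolding iso_iff
  proof (intro conjI)
    show "?m \<in> hom ?P ?Q"
    proof (rule homI)
      fix x y assume xy: "x \<in> carrier ?P" "y \<in> carrier ?P"
      have "h (?g j) (x (?g j) \<otimes>\<^bsub>F (?g j)\<^esub> y (?g j)) = h (?g j) (x (?g j)) \<otimes>\<^bsub>N (?g j)\<^esub> h (?g j) (y (?g j))"
        if "j \<in> f ` I" for j
        using xy hom_mult[OF hb(1)[OF gI(1)[OF that]]] gI(1)[OF that] by (simp add: PiE_iff)
      then show "?m (x \<otimes>\<^bsub>?P\<^esub> y) = ?m x \<otimes>\<^bsub>?Q\<^esub> ?m y"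
        using gI(1) by (simp cong: restrict_cong)
    qed (rule mQ)
    show "inj_on ?m (carrier ?P)"
    proof (rule inj_onI)
      fix x y assume xy: "x \<in> carrier ?P" "y \<in> carrier ?P" "?m x = ?m y"
      show "x = y"
      proof (rule PiE_ext)
        fix i assume i: "i \<in> I"
        have "h i (x i) = h i (y i)" using fun_cong[OF xy(3), of "f i"] i by (simp add: gf)
        moreover have "x i \<in> carrier (F i)" "y i \<in> carrier (F i)" using xy(1,2) i by (simp_all add: PiE_iff)
        ultimately show "x i = y i" using bij_betw_imp_inj_on[OF hb(2)[OF i]] by (rule inj_onD[rotated])
      qed (use xy in auto)
    qed
    show "?m ` carrier ?P = carrier ?Q"
    proof (intro equalityI subsetI)
      fix y assume y: "y \<in> carrier ?Q"
      define x where "x = (\<lambda>i\<in>I. inv_into (carrier (F i)) (h i) (y (f i)))"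
      have yi: "y (f i) \<in> h i ` carrier (F i)" if "i \<in> I" for i
      proof -
        have "f i \<in> f ` I" using that by blast
        then have "y (f i) \<in> carrier ((N \<circ> ?g) (f i))"
          using y unfolding carrier_product_group by (rule PiE_mem[rotated])
        then show ?thesis
          using gf[OF that] by (simp add: bij_betw_imp_surj_on[OF hb(2)[OF that]])
      qed
      have x: "x \<in> carrier ?P" using inv_into_into[OF yi] by (simp add: x_def)
      have "?m x = y"
      proof
        fix j show "?m x j = y j"
        proof (cases "j \<in> f ` I")
          case True
          then show ?thesis using f_inv_into_f[OF yi[OF gI(1)[OF True]]] gI[OF True]
            by (simp add: x_def)
        next
          case False
          then show ?thesis using y by (simp add: PiE_iff extensional_def)
        qed
      qed
      then show "y \<in> ?m ` carrier ?P" using x by blast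
    next
      fix y assume "y \<in> ?m ` carrier ?P"
      then obtain x where "x \<in> carrier ?P" "y = ?m x" by (rule imageE)
      then show "y \<in> carrier ?Q" using mQ by metis
    qed
  qed
  then have "?P \<cong> ?Q" by (auto simp: is_iso_def)
  moreover have "\<forall>j\<in>f ` I. (N \<circ> ?g) j \<in> X" using N by (simp add: gI)
  ultimately show thesis using that[of "f ` I" "N \<circ> ?g"] assms(1) by blast
qed

lemma finite_product:
  "finite I \<Longrightarrow> (\<And>i. i \<in> I \<Longrightarrow> finite (carrier (F i))) \<Longrightarrow> finite (carrier (product_group I F))"
  by (simp add: finite_PiE)

locale group_pv =
  fixes H :: "nat monoid set"
  assumes H: "group_pseudovariety H"
begin

lemma gpv_basic: "\<forall>G\<in>H. group G \<and> finite (carrier G)"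
  by (rule H[unfolded group_pseudovariety_def, THEN conjunct1])

lemma gpv_group: "G \<in> H \<Longrightarrow> group G" and gpv_finite: "G \<in> H \<Longrightarrow> finite (carrier G)"
  using gpv_basic by simp_all

lemma gpv_product:
  "finite (I :: nat set) \<Longrightarrow> \<forall>i\<in>I. F i \<in> H \<Longrightarrow> group P \<Longrightarrow> P \<cong> product_group I F \<Longrightarrow> P \<in> H"
  by (rule H[unfolded group_pseudovariety_def, THEN conjunct2, THEN conjunct1, rule_format]) simp

lemma gpv_subgroup: "G \<in> H \<Longrightarrow> subgroup A G \<Longrightarrow> G\<lparr>carrier := A\<rparr> \<in> H"
  by (rule H[unfolded group_pseudovariety_def, THEN conjunct2, THEN conjunct2, THEN conjunct1, rule_format])

lemma gpv_image: "G \<in> H \<Longrightarrow> group P \<Longrightarrow> \<phi> \<in> epi G P \<Longrightarrow> P \<in> H"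
  by (rule H[unfolded group_pseudovariety_def, THEN conjunct2, THEN conjunct2, THEN conjunct2, rule_format, OF _ conjI])

lemma belongs_group:
  assumes "belongs_to G H"
  shows "group G" "finite (carrier G)"
proof -
  obtain N where N: "N \<in> H" "G \<cong> N" and G: "monoid G" using assms unfolding belongs_to_def by blast
  have "N \<cong> G" using monoid_is_iso_sym[OF G N(2)] .
  then show "group G" using group.iso_imp_group[OF gpv_group[OF N(1)]] G by blast
  show "finite (carrier G)" using iso_finite[OF N(2)] gpv_finite[OF N(1)] by simp
qed

lemma belongs_nat: "belongs_to (G :: nat monoid) H \<longleftrightarrow> G \<in> H"
proof
  assume G: "belongs_to G H"
  then obtain N where N: "N \<in> H" "G \<cong> N" by (auto simp: belongs_to_def)
  have "N \<cong> G" using monoid_is_iso_sym N(2) G by (metis belongs_to_def)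
  then obtain h where "h \<in> iso N G" unfolding is_iso_def by blast
  then have "h \<in> epi N G" by (rule iso_imp_epi)
  then show "G \<in> H" by (rule gpv_image[OF N(1) belongs_group(1)[OF G]])
next
  assume "G \<in> H"
  then show "belongs_to G H"
    unfolding belongs_to_def using gpv_group group.is_monoid iso_refl by blast
qed

lemma belongs_image:
  assumes "belongs_to L H" "monoid P" "h \<in> epi L P"
  shows "belongs_to P H"
proof -
  interpret L: group L by (rule belongs_group[OF assms(1)])
  obtain N k where N: "N \<in> H" "k \<in> iso L N" using assms(1) unfolding belongs_to_def is_iso_def by blast
  have fin: "finite (carrier P)"
    using belongs_group(2)[OF assms(1)] epi_image[OF assms(3)] by (metis finite_imageI)
  obtain Q :: "nat monoid" and q where Q: "monoid Q" "q \<in> iso P Q"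
    using finite_monoid_nat_copy[OF assms(2) fin] by metis
  have e1: "q \<circ> h \<circ> inv_into (carrier L) k \<in> epi N Q"
  proof -
    have k': "inv_into (carrier L) k \<in> iso N L" by (rule monoid_iso_sym[OF L.is_monoid N(2)])
    note e = iso_imp_epi[OF k'] assms(3) iso_imp_epi[OF Q(2)]
    have "q \<circ> h \<circ> inv_into (carrier L) k \<in> hom N Q"
      by (rule hom_compose[OF epi_hom[OF e(1)] hom_compose[OF epi_hom[OF e(2)] epi_hom[OF e(3)]]])
    then show ?thesis
      by (simp only: epi_def image_comp[symmetric] epi_image[OF e(1)] epi_image[OF e(2)]
          epi_image[OF e(3)] mem_Collect_eq simp_thms)
  qed
  have "group Q"
  proof -
    interpret N: group N by (rule gpv_group[OF N(1)])
    interpret Q: monoid Q by fact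
    let ?e = "q \<circ> h \<circ> inv_into (carrier L) k"
    have one: "?e \<one>\<^bsub>N\<^esub> = \<one>\<^bsub>Q\<^esub>" by (rule epi_one[OF N.is_monoid Q(1) e1])
    show ?thesis
    proof (rule Q.group_l_invI)
      fix x assume "x \<in> carrier Q"
      then obtain y where y: "y \<in> carrier N" "x = ?e y" using epi_obtain[OF e1] by metis
      have "?e (inv\<^bsub>N\<^esub> y) \<otimes>\<^bsub>Q\<^esub> ?e y = ?e (inv\<^bsub>N\<^esub> y \<otimes>\<^bsub>N\<^esub> y)"
        by (rule hom_mult[OF epi_hom[OF e1] N.inv_closed[OF y(1)] y(1), symmetric])
      then have "?e (inv\<^bsub>N\<^esub> y) \<otimes>\<^bsub>Q\<^esub> x = \<one>\<^bsub>Q\<^esub>"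
        using y(2) one N.l_inv[OF y(1)] by simp
      moreover have "?e (inv\<^bsub>N\<^esub> y) \<in> carrier Q"
        by (rule hom_in_carrier[OF epi_hom[OF e1] N.inv_closed[OF y(1)]])
      ultimately show "\<exists>y\<in>carrier Q. y \<otimes>\<^bsub>Q\<^esub> x = \<one>\<^bsub>Q\<^esub>" by blast
    qed
  qed
  then have "Q \<in> H" using e1 by (intro gpv_image[OF N(1)])
  then show ?thesis using assms(2) Q unfolding belongs_to_def is_iso_def by blast
qed

lemma belongs_embed:
  assumes "belongs_to P H" "monoid L" "h \<in> hom L P" "inj_on h (carrier L)"
  shows "belongs_to L H"
proof -
  interpret P: group P by (rule belongs_group[OF assms(1)])
  interpret L: monoid L by fact
  obtain N k where N: "N \<in> H" "k \<in> iso P N" using assms(1) unfolding belongs_to_def is_iso_def by blast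
  interpret N: group N by (rule gpv_group[OF N(1)])
  let ?e = "k \<circ> h"
  have eh: "?e \<in> hom L N" using N(2) by (intro hom_compose[OF assms(3)]) (simp add: iso_def)
  have kb: "inj_on k (carrier P)" using N(2) by (simp add: iso_iff)
  have hP: "h ` carrier L \<subseteq> carrier P" using hom_in_carrier[OF assms(3)] by blast
  have inj: "inj_on ?e (carrier L)"
    by (rule comp_inj_on[OF assms(4) inj_on_subset[OF kb hP]])
  have sub: "?e ` carrier L \<subseteq> carrier N" using hom_in_carrier[OF eh] by blast
  have fin: "finite (?e ` carrier L)" using finite_subset[OF sub gpv_finite[OF N(1)]] .
  have finL: "finite (carrier L)" using fin inj finite_imageD by blast
  have one: "?e \<one>\<^bsub>L\<^esub> = \<one>\<^bsub>N\<^esub>"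
  proof -
    have "?e \<one>\<^bsub>L\<^esub> \<otimes>\<^bsub>N\<^esub> ?e \<one>\<^bsub>L\<^esub> = ?e \<one>\<^bsub>L\<^esub>"
      using hom_mult[OF eh L.one_closed L.one_closed] by simp
    moreover have "?e \<one>\<^bsub>L\<^esub> \<in> carrier N" using sub by blast
    ultimately show ?thesis using N.l_cancel_one by blast
  qed
  have "group L"
  proof (rule finite_monoid_unique_idempotent_group[OF assms(2) finL])
    fix i assume i: "i \<in> carrier L" "i \<otimes>\<^bsub>L\<^esub> i = i"
    have "?e i \<otimes>\<^bsub>N\<^esub> ?e i = ?e i" using hom_mult[OF eh i(1) i(1)] i by simp
    moreover have "?e i \<in> carrier N" using sub i by blast
    ultimately have "?e i = ?e \<one>\<^bsub>L\<^esub>" using one N.l_cancel_one by metis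
    then show "i = \<one>\<^bsub>L\<^esub>" using inj_onD[OF inj] i(1) L.one_closed by blast
  qed
  then interpret L: group L .
  have gh: "group_hom L N ?e" using eh by (simp add: group_hom_def group_hom_axioms_def N.group_axioms L.group_axioms)
  have "subgroup (?e ` carrier L) N" by (rule group_hom.img_is_subgroup[OF gh])
  then have "N\<lparr>carrier := ?e ` carrier L\<rparr> \<in> H" by (rule gpv_subgroup[OF N(1)])
  moreover have "?e \<in> iso L (N\<lparr>carrier := ?e ` carrier L\<rparr>)"
  proof (intro isoI homI)
    show "bij_betw ?e (carrier L) (carrier (N\<lparr>carrier := ?e ` carrier L\<rparr>))"
      using inj_on_imp_bij_betw[OF inj] by simp
  qed (use hom_mult[OF eh] in auto)
  ultimately show ?thesis using assms(2) unfolding belongs_to_def is_iso_def by blast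
qed

lemma belongs_product:
  assumes "finite (I :: 'i set)" "\<And>i. i \<in> I \<Longrightarrow> belongs_to (F i) H"
  shows "belongs_to (product_group I F) H"
proof -
  obtain J F' where J: "finite J" "\<forall>j\<in>J. F' j \<in> H" "product_group I F \<cong> product_group (J :: nat set) F'"
    using product_group_nat_index[OF assms] .
  have grp: "group (product_group I F)" by (intro product_group belongs_group(1) assms(2))
  have fin: "finite (carrier (product_group I F))"
    using assms belongs_group(2) by (intro finite_product) auto
  obtain Q :: "nat monoid" and q where Q: "monoid Q" "q \<in> iso (product_group I F) Q"
    using finite_monoid_nat_copy[OF group.is_monoid[OF grp] fin] by metis
  have gQ: "group Q" using group.iso_imp_group[OF grp] Q by (auto simp: is_iso_def)
  have "Q \<cong> product_group I F" using group.iso_sym[OF grp] Q by (auto simp: is_iso_def)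
  then have "Q \<cong> product_group J F'" using J(3) iso_trans by blast
  then have "Q \<in> H" by (rule gpv_product[OF J(1,2) gQ])
  then show ?thesis using Q group.is_monoid[OF grp] unfolding belongs_to_def is_iso_def by blast
qed

lemma belongs_trivial:
  assumes "monoid L" "carrier L = {\<one>\<^bsub>L\<^esub>}"
  shows "belongs_to L H"
proof (rule belongs_embed[OF belongs_product[of "{} :: nat set"] assms(1)])
  show "(\<lambda>_. \<one>\<^bsub>product_group {} (undefined :: nat \<Rightarrow> nat monoid)\<^esub>) \<in> hom L (product_group {} undefined)"
    by (auto simp: hom_def)
qed (use assms in auto)

end

locale monoid_pv =
  fixes V :: "nat monoid set"
  assumes V: "monoid_pseudovariety V"
begin

lemma mpv_basic: "\<forall>M\<in>V. monoid M \<and> finite (carrier M)"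
  by (rule V[unfolded monoid_pseudovariety_def, THEN conjunct1])

lemma mpv_monoid: "M \<in> V \<Longrightarrow> monoid M" and mpv_finite: "M \<in> V \<Longrightarrow> finite (carrier M)"
  using mpv_basic by simp_all

lemma mpv_product:
  "finite (I :: nat set) \<Longrightarrow> \<forall>i\<in>I. F i \<in> V \<Longrightarrow> monoid P \<Longrightarrow> P \<cong> product_group I F \<Longrightarrow> P \<in> V"
  by (rule V[unfolded monoid_pseudovariety_def, THEN conjunct2, THEN conjunct1, rule_format]) simp

lemma mpv_submonoid: "M \<in> V \<Longrightarrow> submonoid A M \<Longrightarrow> M\<lparr>carrier := A\<rparr> \<in> V"
  by (rule V[unfolded monoid_pseudovariety_def, THEN conjunct2, THEN conjunct2, THEN conjunct1, rule_format])

lemma mpv_image: "M \<in> V \<Longrightarrow> monoid P \<Longrightarrow> \<phi> \<in> epi M P \<Longrightarrow> P \<in> V"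
  by (rule V[unfolded monoid_pseudovariety_def, THEN conjunct2, THEN conjunct2, THEN conjunct2, rule_format, OF _ conjI])

lemma belongs_product_monoid:
  assumes "finite I" "\<And>i. i \<in> I \<Longrightarrow> belongs_to (F i) V"
  shows "belongs_to (product_group I F) V"
proof -
  obtain J F' where J: "finite J" "\<forall>j\<in>J. F' j \<in> V" "product_group I F \<cong> product_group (J :: nat set) F'"
    using product_group_nat_index[OF assms] .
  have mon: "monoid (product_group I F)" by (rule product_monoid) (use assms(2) in \<open>simp add: belongs_to_def\<close>)
  have "finite (carrier (F i))" if i: "i \<in> I" for i
  proof -
    obtain N where "N \<in> V" "F i \<cong> N" using assms(2)[OF i] unfolding belongs_to_def by blast
    moreover from this have "finite (carrier N)" by (intro mpv_finite)
    ultimately show ?thesis by (simp add: iso_finite)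
  qed
  then have fin: "finite (carrier (product_group I F))" by (intro finite_product assms(1))
  obtain Q :: "nat monoid" and q where Q: "monoid Q" "q \<in> iso (product_group I F) Q"
    using finite_monoid_nat_copy[OF mon fin] by metis
  have "Q \<cong> product_group I F" using monoid_is_iso_sym[OF mon] Q by (auto simp: is_iso_def)
  then have "Q \<cong> product_group J F'" using J(3) iso_trans by blast
  then have "Q \<in> V" by (rule mpv_product[OF J(1,2) Q(1)])
  then show ?thesis using Q mon unfolding belongs_to_def is_iso_def by blast
qed

lemma belongs_nat_monoid: "belongs_to (M :: nat monoid) V \<longleftrightarrow> M \<in> V"
proof
  assume M: "belongs_to M V"
  then obtain N where N: "N \<in> V" "M \<cong> N" and mon: "monoid M" unfolding belongs_to_def by blast
  obtain h where "h \<in> iso N M" using monoid_is_iso_sym[OF mon N(2)] unfolding is_iso_def by blast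
  then show "M \<in> V" by (intro mpv_image[OF N(1) mon] iso_imp_epi)
next
  assume "M \<in> V"
  then show "belongs_to M V" unfolding belongs_to_def using mpv_monoid iso_refl by blast
qed

end

section \<open>Monoids with an LH-homomorphism into V\<close>

definition ker_monoid :: "('a, 'c) monoid_scheme \<Rightarrow> ('a \<Rightarrow> 'b) \<Rightarrow> 'a \<Rightarrow> 'a monoid" where
  "ker_monoid M \<phi> f =
     \<lparr>carrier = {x \<in> carrier M. f \<otimes>\<^bsub>M\<^esub> x = x \<and> x \<otimes>\<^bsub>M\<^esub> f = x \<and> \<phi> x = \<phi> f},
      monoid.mult = monoid.mult M, one = f\<rparr>"

lemma ker_monoid_simps [simp]:
  "x \<in> carrier (ker_monoid M \<phi> f) \<longleftrightarrow> x \<in> carrier M \<and> f \<otimes>\<^bsub>M\<^esub> x = x \<and> x \<otimes>\<^bsub>M\<^esub> f = x \<and> \<phi> x = \<phi> f"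
  "monoid.mult (ker_monoid M \<phi> f) = monoid.mult M" "\<one>\<^bsub>ker_monoid M \<phi> f\<^esub> = f"
  by (simp_all add: ker_monoid_def)

definition LH_hom :: "nat monoid set \<Rightarrow> ('a, 'c) monoid_scheme \<Rightarrow> ('a \<Rightarrow> 'b) \<Rightarrow> bool" where
  "LH_hom H M \<phi> \<longleftrightarrow> (\<forall>f\<in>carrier M. f \<otimes>\<^bsub>M\<^esub> f = f \<longrightarrow> belongs_to (ker_monoid M \<phi> f) H)"

text \<open>Up to isomorphism these are the generators of the Mal'cev product, see \<open>LH_over_nat\<close>.\<close>

definition LH_over :: "nat monoid set \<Rightarrow> nat monoid set \<Rightarrow> ('a, 'c) monoid_scheme \<Rightarrow> bool" where
  "LH_over H V M \<longleftrightarrow> monoid M \<and> finite (carrier M) \<and> (\<exists>N\<in>V. \<exists>\<phi>\<in>monoid_hom M N. LH_hom H M \<phi>)"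

lemma monoid_homD:
  assumes "\<phi> \<in> monoid_hom M N"
  shows "\<phi> \<in> hom M N" "\<phi> \<one>\<^bsub>M\<^esub> = \<one>\<^bsub>N\<^esub>"
    "x \<in> carrier M \<Longrightarrow> \<phi> x \<in> carrier N"
    "x \<in> carrier M \<Longrightarrow> y \<in> carrier M \<Longrightarrow> \<phi> (x \<otimes>\<^bsub>M\<^esub> y) = \<phi> x \<otimes>\<^bsub>N\<^esub> \<phi> y"
  using assms unfolding monoid_hom_def by (auto simp: hom_mult intro: hom_in_carrier)

lemma monoid_ker_monoid:
  assumes "monoid M" "\<phi> \<in> hom M N" "f \<in> carrier M" "f \<otimes>\<^bsub>M\<^esub> f = f"
  shows "monoid (ker_monoid M \<phi> f)"
proof -
  interpret monoid M by fact
  show ?thesis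
  proof (rule monoidI, goal_cases)
    case (1 x y)
    then have "\<phi> (x \<otimes>\<^bsub>M\<^esub> y) = \<phi> (f \<otimes>\<^bsub>M\<^esub> f)"
      using hom_mult[OF assms(2), of x y] hom_mult[OF assms(2), of f f] assms(3) by simp
    moreover have "x \<otimes>\<^bsub>M\<^esub> y \<otimes>\<^bsub>M\<^esub> f = x \<otimes>\<^bsub>M\<^esub> y" using 1 assms m_assoc[of x y f] by simp
    moreover have "f \<otimes>\<^bsub>M\<^esub> (x \<otimes>\<^bsub>M\<^esub> y) = x \<otimes>\<^bsub>M\<^esub> y" using 1 assms m_assoc[of f x y] by simp
    ultimately show ?case using 1 assms by simp
  next
    case (3 x y z)
    then show ?case by (simp add: m_assoc)
  qed (use assms in auto)
qed

text \<open>In the fibre of \<open>\<phi> f\<close>, an element has the form \<open>f s f\<close> exactly if \<open>f\<close> fixes it on both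
  sides. The latter description does not refer to the codomain of \<open>\<phi>\<close> and is more convenient
  for homomorphisms between local groups.\<close>

lemma corner_preimage_semigrp:
  assumes "monoid M" "\<phi> \<in> hom M N" "f \<in> carrier M" "f \<otimes>\<^bsub>M\<^esub> f = f"
  shows "corner (preimage_semigrp M \<phi> (\<phi> f)) f = ker_monoid M \<phi> f"
proof -
  interpret monoid M by fact
  have idem: "\<phi> f \<otimes>\<^bsub>N\<^esub> \<phi> f = \<phi> f" using hom_mult[OF assms(2,3,3)] assms(4) by simp
  have "{f \<otimes>\<^bsub>M\<^esub> s \<otimes>\<^bsub>M\<^esub> f |s. s \<in> carrier M \<and> \<phi> s = \<phi> f} =
      {x \<in> carrier M. f \<otimes>\<^bsub>M\<^esub> x = x \<and> x \<otimes>\<^bsub>M\<^esub> f = x \<and> \<phi> x = \<phi> f}" (is "?A = ?B")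
  proof (intro equalityI subsetI)
    fix x assume "x \<in> ?A"
    then obtain s where s: "s \<in> carrier M" "\<phi> s = \<phi> f" "x = f \<otimes>\<^bsub>M\<^esub> s \<otimes>\<^bsub>M\<^esub> f" by blast
    have "\<phi> x = \<phi> f" using s assms idem by (simp add: hom_mult)
    moreover have "f \<otimes>\<^bsub>M\<^esub> x = x" using s assms m_assoc[of f f "s \<otimes>\<^bsub>M\<^esub> f"] m_assoc[of f s f] by simp
    moreover have "x \<otimes>\<^bsub>M\<^esub> f = x" using s assms m_assoc[of "f \<otimes>\<^bsub>M\<^esub> s" f f] by simp
    ultimately show "x \<in> ?B" using s assms by simp
  next
    fix x assume "x \<in> ?B"
    then show "x \<in> ?A" by (intro CollectI exI[of _ x]) simp
  qed
  then show ?thesis by (simp add: corner_def preimage_semigrp_def ker_monoid_def)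
qed

locale LH_Malcev = group_pv H + monoid_pv V for H V :: "nat monoid set"
begin

lemma LH_overI:
  assumes "monoid M" "finite (carrier M)" "belongs_to N V" "\<phi> \<in> monoid_hom M N" "LH_hom H M \<phi>"
  shows "LH_over H V M"
proof -
  interpret monoid M by fact
  obtain N' k where N': "N' \<in> V" "k \<in> iso N N'" "monoid N"
    using assms(3) unfolding belongs_to_def is_iso_def by blast
  have "k \<circ> \<phi> \<in> hom M N'"
    using N' by (intro hom_compose[OF monoid_homD(1)[OF assms(4)]]) (simp add: iso_def)
  moreover have "(k \<circ> \<phi>) \<one>\<^bsub>M\<^esub> = \<one>\<^bsub>N'\<^esub>"
    using epi_one[OF N'(3) mpv_monoid[OF N'(1)] iso_imp_epi[OF N'(2)]] monoid_homD(2)[OF assms(4)] by simp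
  ultimately have 1: "k \<circ> \<phi> \<in> monoid_hom M N'" by (simp add: monoid_hom_def)
  have inj: "inj_on k (carrier N)" using N'(2) by (simp add: iso_iff)
  have "k (\<phi> x) = k (\<phi> f) \<longleftrightarrow> \<phi> x = \<phi> f" if "x \<in> carrier M" "f \<in> carrier M" for x f
    using inj_on_eq_iff[OF inj monoid_homD(3)[OF assms(4) that(1)] monoid_homD(3)[OF assms(4) that(2)]] .
  then have "ker_monoid M (k \<circ> \<phi>) f = ker_monoid M \<phi> f" if "f \<in> carrier M" for f
    unfolding ker_monoid_def using that by (simp cong: conj_cong)
  then have "LH_hom H M (k \<circ> \<phi>)" using assms(5) by (simp add: LH_hom_def)
  then show ?thesis unfolding LH_over_def using assms(1,2) N'(1) 1 by blast
qed

lemma LH_hom_inj: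
  assumes "monoid M" "\<phi> \<in> hom M N" "inj_on \<phi> (carrier M)"
  shows "LH_hom H M \<phi>"
  unfolding LH_hom_def
proof (intro ballI impI)
  fix f assume f: "f \<in> carrier M" "f \<otimes>\<^bsub>M\<^esub> f = f"
  have "carrier (ker_monoid M \<phi> f) = {f}" using f assms(3) by (auto dest: inj_onD)
  then show "belongs_to (ker_monoid M \<phi> f) H"
    by (intro belongs_trivial monoid_ker_monoid[OF assms(1,2) f]) simp
qed

lemma LH_over_member:
  assumes "M \<in> V"
  shows "LH_over H V M"
proof -
  have M: "monoid M" "finite (carrier M)" using assms mpv_monoid mpv_finite by simp_all
  have id: "id \<in> hom M M" by (rule homI) auto
  then have "LH_hom H M id" by (rule LH_hom_inj[OF M(1)]) simp
  moreover have "id \<in> monoid_hom M M" using id by (simp add: monoid_hom_def)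
  ultimately show ?thesis unfolding LH_over_def using assms M by blast
qed

lemma LH_over_embed:
  assumes M: "LH_over H V M" and P: "monoid P" and h: "h \<in> monoid_hom P M" "inj_on h (carrier P)"
  shows "LH_over H V P"
proof -
  obtain N \<phi> where N: "N \<in> V" "\<phi> \<in> monoid_hom M N" "LH_hom H M \<phi>"
    and mon: "monoid M" "finite (carrier M)"
    using M unfolding LH_over_def by blast
  have "h ` carrier P \<subseteq> carrier M" using monoid_homD(3)[OF h(1)] by blast
  then have fin: "finite (carrier P)" by (rule inj_on_finite[OF h(2) _ mon(2)])
  have 1: "\<phi> \<circ> h \<in> monoid_hom P N"
    using hom_compose[OF monoid_homD(1)[OF h(1)] monoid_homD(1)[OF N(2)]]
      monoid_homD(2)[OF h(1)] monoid_homD(2)[OF N(2)] by (simp add: monoid_hom_def)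
  have "LH_hom H P (\<phi> \<circ> h)" unfolding LH_hom_def
  proof (intro ballI impI)
    fix f assume f: "f \<in> carrier P" "f \<otimes>\<^bsub>P\<^esub> f = f"
    note hf = monoid_homD(3)[OF h(1) f(1)]
    have hh: "h f \<otimes>\<^bsub>M\<^esub> h f = h f" using monoid_homD(4)[OF h(1) f(1) f(1)] f(2) by simp
    show "belongs_to (ker_monoid P (\<phi> \<circ> h) f) H"
    proof (rule belongs_embed[where h = h])
      show "belongs_to (ker_monoid M \<phi> (h f)) H" using N(3) hf hh unfolding LH_hom_def by blast
      show "monoid (ker_monoid P (\<phi> \<circ> h) f)"
        by (rule monoid_ker_monoid[OF P monoid_homD(1)[OF 1] f])
      show "inj_on h (carrier (ker_monoid P (\<phi> \<circ> h) f))"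
        by (rule inj_on_subset[OF h(2)]) auto
      show "h \<in> hom (ker_monoid P (\<phi> \<circ> h) f) (ker_monoid M \<phi> (h f))"
      proof (rule homI)
        fix x assume x: "x \<in> carrier (ker_monoid P (\<phi> \<circ> h) f)"
        show "h x \<in> carrier (ker_monoid M \<phi> (h f))"
          using x f monoid_homD(3)[OF h(1), of x] monoid_homD(4)[OF h(1), of f x]
            monoid_homD(4)[OF h(1), of x f] by simp
      qed (use monoid_homD(4)[OF h(1)] in simp)
    qed
  qed
  then show ?thesis unfolding LH_over_def using P fin N(1) 1 by blast
qed

lemma LH_over_nat_copy:
  assumes M: "LH_over H V M"
  obtains P :: "nat monoid" and h where "LH_over H V P" "h \<in> iso M P" "h \<one>\<^bsub>M\<^esub> = \<one>\<^bsub>P\<^esub>"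
proof -
  have mon: "monoid M" "finite (carrier M)" using M unfolding LH_over_def by blast+
  obtain P :: "nat monoid" and h where P: "monoid P" "h \<in> iso M P" "h \<one>\<^bsub>M\<^esub> = \<one>\<^bsub>P\<^esub>"
    using finite_monoid_nat_copy[OF mon] by metis
  let ?g = "inv_into (carrier M) h"
  have g: "?g \<in> iso P M" by (rule monoid_iso_sym[OF mon(1) P(2)])
  then have "?g \<in> monoid_hom P M"
    using epi_one[OF P(1) mon(1) iso_imp_epi[OF g]] by (simp add: monoid_hom_def iso_def)
  moreover have "inj_on ?g (carrier P)" using g unfolding iso_iff by blast
  ultimately have "LH_over H V P" by (rule LH_over_embed[OF M P(1)])
  then show thesis using P by (intro that)
qed

lemma LH_over_product:
  assumes I: "finite I" and F: "\<And>i. i \<in> I \<Longrightarrow> LH_over H V (F i)"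
  shows "LH_over H V (product_group I F)"
proof -
  have "\<exists>N \<phi>. N \<in> V \<and> \<phi> \<in> monoid_hom (F i) N \<and> LH_hom H (F i) \<phi>" if "i \<in> I" for i
    using F[OF that] unfolding LH_over_def by blast
  then obtain N \<phi> where N: "\<And>i. i \<in> I \<Longrightarrow> N i \<in> V" and \<phi>: "\<And>i. i \<in> I \<Longrightarrow> \<phi> i \<in> monoid_hom (F i) (N i)"
    and LH: "\<And>i. i \<in> I \<Longrightarrow> LH_hom H (F i) (\<phi> i)" by metis
  have mon: "\<And>i. i \<in> I \<Longrightarrow> monoid (F i)" "\<And>i. i \<in> I \<Longrightarrow> finite (carrier (F i))"
    using F by (simp_all add: LH_over_def)
  let ?M = "product_group I F" and ?N = "product_group I N" and ?\<phi> = "\<lambda>x. \<lambda>i\<in>I. \<phi> i (x i)"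
  have M: "monoid ?M" "finite (carrier ?M)"
    using product_monoid[of I F, OF mon(1)] finite_product[OF I, of F, OF mon(2)] by simp_all
  have "?\<phi> \<in> hom ?M ?N"
  proof (rule homI)
    fix x assume "x \<in> carrier ?M"
    then show "?\<phi> x \<in> carrier ?N" using monoid_homD(3)[OF \<phi>] by (simp add: PiE_iff)
  next
    fix x y assume "x \<in> carrier ?M" "y \<in> carrier ?M"
    then show "?\<phi> (x \<otimes>\<^bsub>?M\<^esub> y) = ?\<phi> x \<otimes>\<^bsub>?N\<^esub> ?\<phi> y"
      using monoid_homD(4)[OF \<phi>] by (simp add: PiE_iff cong: restrict_cong)
  qed
  moreover have "?\<phi> \<one>\<^bsub>?M\<^esub> = \<one>\<^bsub>?N\<^esub>" using monoid_homD(2)[OF \<phi>] by (simp cong: restrict_cong)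
  ultimately have 1: "?\<phi> \<in> monoid_hom ?M ?N" by (simp add: monoid_hom_def)
  have "LH_hom H ?M ?\<phi>" unfolding LH_hom_def
  proof (intro ballI impI)
    fix f assume f: "f \<in> carrier ?M" "f \<otimes>\<^bsub>?M\<^esub> f = f"
    have fi: "f i \<in> carrier (F i)" "f i \<otimes>\<^bsub>F i\<^esub> f i = f i" if "i \<in> I" for i
      using f(1) fun_cong[OF f(2), of i] that by (auto simp: PiE_iff)
    show "belongs_to (ker_monoid ?M ?\<phi> f) H"
    proof (rule belongs_embed[where h = id])
      show "belongs_to (product_group I (\<lambda>i. ker_monoid (F i) (\<phi> i) (f i))) H"
        by (rule belongs_product[OF I]) (rule LH[unfolded LH_hom_def, rule_format, OF _ fi])
      show "monoid (ker_monoid ?M ?\<phi> f)"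
        by (rule monoid_ker_monoid[OF M(1) monoid_homD(1)[OF 1] f])
      have ker: "x i \<in> carrier (ker_monoid (F i) (\<phi> i) (f i))"
        if x: "x \<in> carrier (ker_monoid ?M ?\<phi> f)" and i: "i \<in> I" for x i
      proof -
        have e: "x \<in> carrier ?M" "f \<otimes>\<^bsub>?M\<^esub> x = x" "x \<otimes>\<^bsub>?M\<^esub> f = x" "?\<phi> x = ?\<phi> f"
          using x unfolding ker_monoid_simps(1) by blast+
        have "x i \<in> carrier (F i)" using e(1) i unfolding carrier_product_group by (rule PiE_mem)
        moreover have "f i \<otimes>\<^bsub>F i\<^esub> x i = x i" using fun_cong[OF e(2), of i] i by simp
        moreover have "x i \<otimes>\<^bsub>F i\<^esub> f i = x i" using fun_cong[OF e(3), of i] i by simp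
        moreover have "\<phi> i (x i) = \<phi> i (f i)" using fun_cong[OF e(4), of i] i by simp
        ultimately show ?thesis by simp
      qed
      show "id \<in> hom (ker_monoid ?M ?\<phi> f) (product_group I (\<lambda>i. ker_monoid (F i) (\<phi> i) (f i)))"
      proof (rule homI)
        fix x assume x: "x \<in> carrier (ker_monoid ?M ?\<phi> f)"
        then have "x \<in> extensional I" unfolding ker_monoid_simps(1) carrier_product_group PiE_iff by blast
        then show "id x \<in> carrier (product_group I (\<lambda>i. ker_monoid (F i) (\<phi> i) (f i)))"
          unfolding carrier_product_group PiE_iff id_apply using ker[OF x] by blast
      next
        fix x y
        show "id (x \<otimes>\<^bsub>ker_monoid ?M ?\<phi> f\<^esub> y) = id x \<otimes>\<^bsub>product_group I (\<lambda>i. ker_monoid (F i) (\<phi> i) (f i))\<^esub> id y"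
          by simp
      qed
      show "inj_on id (carrier (ker_monoid ?M ?\<phi> f))" by (rule inj_on_id)
    qed
  qed
  moreover have "belongs_to ?N V"
    using N mpv_monoid by (intro belongs_product_monoid[OF I]) (simp add: belongs_nat_monoid)
  ultimately show ?thesis by (intro LH_overI[OF M _ 1])
qed

lemma LH_over_nat: "LH_over H V M \<longleftrightarrow> M \<in> Malcev_generators (LH H) V"
proof -
  have "LH_hom H M \<phi> \<longleftrightarrow> (\<forall>e\<in>carrier N. e \<otimes>\<^bsub>N\<^esub> e = e \<longrightarrow> preimage_semigrp M \<phi> e \<in> LH H)"
    if M: "monoid M" "finite (carrier M)" and \<phi>: "\<phi> \<in> monoid_hom M N" for N :: "nat monoid" and \<phi>
  proof -
    interpret monoid M by fact
    note corner = corner_preimage_semigrp[OF M(1) monoid_homD(1)[OF \<phi>]]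
    show ?thesis
    proof (intro iffI ballI impI)
      fix e assume L: "LH_hom H M \<phi>" and e: "e \<in> carrier N" "e \<otimes>\<^bsub>N\<^esub> e = e"
      have "is_semigrp (preimage_semigrp M \<phi> e)"
        unfolding is_semigrp_def preimage_semigrp_def
        using monoid_homD(4)[OF \<phi>] e(2) by (simp add: m_assoc)
      moreover have "corner (preimage_semigrp M \<phi> e) f \<in> H"
        if "f \<in> carrier (preimage_semigrp M \<phi> e)" "sprod (preimage_semigrp M \<phi> e) f f = f" for f
      proof -
        have f: "f \<in> carrier M" "\<phi> f = e" "f \<otimes>\<^bsub>M\<^esub> f = f"
          using that by (simp_all add: preimage_semigrp_def)
        then show ?thesis
          using L corner[OF f(1,3)] unfolding LH_hom_def by (simp add: belongs_nat)
      qed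
      ultimately show "preimage_semigrp M \<phi> e \<in> LH H"
        using M(2) by (simp add: LH_def preimage_semigrp_def)
    next
      assume P: "\<forall>e\<in>carrier N. e \<otimes>\<^bsub>N\<^esub> e = e \<longrightarrow> preimage_semigrp M \<phi> e \<in> LH H"
      show "LH_hom H M \<phi>" unfolding LH_hom_def
      proof (intro ballI impI)
        fix f assume f: "f \<in> carrier M" "f \<otimes>\<^bsub>M\<^esub> f = f"
        have "\<phi> f \<otimes>\<^bsub>N\<^esub> \<phi> f = \<phi> f" using monoid_homD(4)[OF \<phi> f(1) f(1)] f(2) by simp
        then have "preimage_semigrp M \<phi> (\<phi> f) \<in> LH H" using P monoid_homD(3)[OF \<phi> f(1)] by blast
        then have "corner (preimage_semigrp M \<phi> (\<phi> f)) f \<in> H"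
          using f unfolding LH_def by (simp add: preimage_semigrp_def)
        then show "belongs_to (ker_monoid M \<phi> f) H" using corner[OF f] by (simp add: belongs_nat)
      qed
    qed
  qed
  then show ?thesis unfolding LH_over_def Malcev_generators_def by blast
qed

text \<open>The generators are closed under products and submonoids, hence their images form a
  pseudovariety already.\<close>

lemma Malcev_eq_images:
  "Malcev (LH H) V = {P. monoid P \<and> (\<exists>(M :: nat monoid) \<psi>. LH_over H V M \<and> \<psi> \<in> epi M P)}" (is "_ = ?Img")
proof (intro equalityI subsetI)
  fix P assume "P \<in> ?Img"
  then obtain M :: "nat monoid" and \<psi> where P: "monoid P" "LH_over H V M" "\<psi> \<in> epi M P" by blast
  have "M \<in> Malcev (LH H) V"
    using P(2) hull_subset[of "Malcev_generators (LH H) V" monoid_pseudovariety]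
    unfolding LH_over_nat Malcev_def by blast
  moreover have "monoid_pv (Malcev (LH H) V)"
    by (simp add: monoid_pv_def monoid_pseudovariety_Malcev)
  ultimately show "P \<in> Malcev (LH H) V" using monoid_pv.mpv_image P(1,3) by blast
next
  have gen: "Malcev_generators (LH H) V \<subseteq> ?Img"
  proof
    fix M assume "M \<in> Malcev_generators (LH H) V"
    then have M: "LH_over H V M" by (simp add: LH_over_nat)
    moreover have "id \<in> epi M M" by (intro epiI homI) auto
    ultimately show "M \<in> ?Img" unfolding LH_over_def by blast
  qed
  have "monoid_pseudovariety ?Img"
    unfolding monoid_pseudovariety_def
  proof (intro conjI ballI allI impI)
    fix P assume "P \<in> ?Img"
    then obtain M :: "nat monoid" and \<psi> where P: "monoid P" "LH_over H V M" "\<psi> \<in> epi M P" by blast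
    then show "monoid P" "finite (carrier P)"
      using epi_image[OF P(3)] finite_imageI[of "carrier M" \<psi>] unfolding LH_over_def by simp_all
    { fix A assume A: "submonoid A P"
      let ?B = "{m \<in> carrier M. \<psi> m \<in> A}" and ?A = "P\<lparr>carrier := A\<rparr>"
      have M: "monoid M" using P(2) unfolding LH_over_def by blast
      note \<psi> = epi_hom[OF P(3)] and \<psi>1 = epi_one[OF M P(1) P(3)]
      have "submonoid ?B M"
        using A hom_mult[OF \<psi>] \<psi>1 monoid.one_closed[OF M] monoid.m_closed[OF M]
        by (intro submonoid.intro) (auto simp: submonoid.m_closed submonoid.one_closed)
      then have B: "monoid (M\<lparr>carrier := ?B\<rparr>)" using M by (rule submonoid.submonoid_is_monoid)
      have "id \<in> monoid_hom (M\<lparr>carrier := ?B\<rparr>) M" by (auto simp: monoid_hom_def intro!: homI)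
      then have "LH_over H V (M\<lparr>carrier := ?B\<rparr>)" by (intro LH_over_embed[OF P(2) B]) auto
      moreover have "\<psi> \<in> epi (M\<lparr>carrier := ?B\<rparr>) ?A"
      proof (rule epiI)
        show "\<psi> \<in> hom (M\<lparr>carrier := ?B\<rparr>) ?A" using hom_mult[OF \<psi>] by (intro homI) auto
        fix y assume y: "y \<in> carrier ?A"
        then have "y \<in> carrier P" using submonoid.subset[OF A] by auto
        then obtain x where "x \<in> carrier M" "\<psi> x = y" by (rule epi_obtain[OF P(3)])
        then show "\<exists>x\<in>carrier (M\<lparr>carrier := ?B\<rparr>). \<psi> x = y" using y by auto
      qed
      moreover have "monoid ?A" using A P(1) by (rule submonoid.submonoid_is_monoid)
      ultimately show "?A \<in> ?Img" by blast
    }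
    { fix Q :: "nat monoid" and \<phi> assume Q: "monoid Q \<and> \<phi> \<in> epi P Q"
      then have \<phi>: "\<phi> \<in> epi P Q" by blast
      have "\<phi> \<circ> \<psi> \<in> epi M Q"
        using hom_compose[OF epi_hom[OF P(3)] epi_hom[OF \<phi>]]
        by (simp only: epi_def image_comp[symmetric] epi_image[OF P(3)] epi_image[OF \<phi>] mem_Collect_eq simp_thms)
      then show "Q \<in> ?Img" using Q P(2) by blast
    }
  next
    fix I :: "nat set" and F and P :: "nat monoid"
    assume A: "finite I \<and> (\<forall>i\<in>I. F i \<in> ?Img) \<and> monoid P \<and> P \<cong> product_group I F"
    then have "\<forall>i\<in>I. \<exists>(M :: nat monoid) \<psi>. LH_over H V M \<and> \<psi> \<in> epi M (F i)" by blast
    then obtain M :: "nat \<Rightarrow> nat monoid" and \<psi> where M: "\<And>i. i \<in> I \<Longrightarrow> LH_over H V (M i)"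
      and \<psi>: "\<And>i. i \<in> I \<Longrightarrow> \<psi> i \<in> epi (M i) (F i)" by metis
    have I: "finite I" and P: "monoid P" using A by blast+
    obtain k where k: "k \<in> iso P (product_group I F)" using A unfolding is_iso_def by blast
    have k': "inv_into (carrier P) k \<in> iso (product_group I F) P" by (rule monoid_iso_sym[OF P k])
    have "LH_over H V (product_group I M)" by (rule LH_over_product[OF I M])
    then obtain Q :: "nat monoid" and h where Q: "LH_over H V Q" "h \<in> iso (product_group I M) Q"
      using LH_over_nat_copy by blast
    have mon: "monoid (product_group I M)"
      using M by (intro product_monoid) (simp add: LH_over_def)
    have h': "inv_into (carrier (product_group I M)) h \<in> iso Q (product_group I M)"
      by (rule monoid_iso_sym[OF mon Q(2)])
    let ?\<psi> = "\<lambda>x. \<lambda>i\<in>I. \<psi> i (x i)"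
    have p: "?\<psi> \<in> epi (product_group I M) (product_group I F)"
    proof (intro epiI homI)
      fix x assume "x \<in> carrier (product_group I M)"
      then show "?\<psi> x \<in> carrier (product_group I F)"
        using hom_in_carrier[OF epi_hom[OF \<psi>]] by (simp add: PiE_iff)
    next
      fix x y assume "x \<in> carrier (product_group I M)" "y \<in> carrier (product_group I M)"
      then show "?\<psi> (x \<otimes>\<^bsub>product_group I M\<^esub> y) = ?\<psi> x \<otimes>\<^bsub>product_group I F\<^esub> ?\<psi> y"
        using hom_mult[OF epi_hom[OF \<psi>]] by (simp add: PiE_iff cong: restrict_cong)
    next
      fix y assume y: "y \<in> carrier (product_group I F)"
      then have "\<forall>i\<in>I. \<exists>x\<in>carrier (M i). \<psi> i x = y i" using epi_obtain[OF \<psi>] by (metis PiE_mem carrier_product_group)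
      then obtain x where x: "\<And>i. i \<in> I \<Longrightarrow> x i \<in> carrier (M i) \<and> \<psi> i (x i) = y i" by metis
      have "?\<psi> (restrict x I) = y" using x y by (intro PiE_ext[of _ I "\<lambda>i. carrier (F i)"]) (auto simp: PiE_iff)
      moreover have "restrict x I \<in> carrier (product_group I M)" using x by simp
      ultimately show "\<exists>x\<in>carrier (product_group I M). ?\<psi> x = y" by blast
    qed
    note e = iso_imp_epi[OF h'] p iso_imp_epi[OF k']
    have "inv_into (carrier P) k \<circ> ?\<psi> \<circ> inv_into (carrier (product_group I M)) h \<in> hom Q P"
      by (rule hom_compose[OF epi_hom[OF e(1)] hom_compose[OF epi_hom[OF e(2)] epi_hom[OF e(3)]]])
    then have "inv_into (carrier P) k \<circ> ?\<psi> \<circ> inv_into (carrier (product_group I M)) h \<in> epi Q P"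
      by (simp only: epi_def image_comp[symmetric] epi_image[OF e(1)] epi_image[OF e(2)]
          epi_image[OF e(3)] mem_Collect_eq simp_thms)
    then show "P \<in> ?Img" using P Q(1) by blast
  qed
  then have "Malcev (LH H) V \<subseteq> ?Img" unfolding Malcev_def by (rule hull_minimal[OF gen])
  then show "P \<in> ?Img" if "P \<in> Malcev (LH H) V" for P using that by blast
qed

end

section \<open>Finite categories, congruences and relational morphisms\<close>

definition cat_congruence :: "('o, 'm) cat \<Rightarrow> ('m \<Rightarrow> 'm \<Rightarrow> bool) \<Rightarrow> bool" where
  "cat_congruence C R \<longleftrightarrow>
     (\<forall>x y. R x y \<longrightarrow> x \<in> arr C \<and> y \<in> arr C \<and> src C x = src C y \<and> tgt C x = tgt C y) \<and>
     (\<forall>x\<in>arr C. R x x) \<and> (\<forall>x y. R x y \<longrightarrow> R y x) \<and> (\<forall>x y z. R x y \<longrightarrow> R y z \<longrightarrow> R x z) \<and>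
     (\<forall>x y u. R x y \<longrightarrow> u \<in> arr C \<longrightarrow> tgt C u = src C x \<longrightarrow> R (ccomp C u x) (ccomp C u y)) \<and>
     (\<forall>x y u. R x y \<longrightarrow> u \<in> arr C \<longrightarrow> src C u = tgt C x \<longrightarrow> R (ccomp C x u) (ccomp C y u))"

definition ker_cat :: "('o, 'm) cat \<Rightarrow> ('m \<Rightarrow> 'm \<Rightarrow> bool) \<Rightarrow> 'm \<Rightarrow> 'm monoid" where
  "ker_cat C R g =
     \<lparr>carrier = {x. R x g \<and> ccomp C g x = x \<and> ccomp C x g = x}, monoid.mult = ccomp C, one = g\<rparr>"

definition LH_congruence :: "nat monoid set \<Rightarrow> ('o, 'm) cat \<Rightarrow> ('m \<Rightarrow> 'm \<Rightarrow> bool) \<Rightarrow> bool" where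
  "LH_congruence H C R \<longleftrightarrow> cat_congruence C R \<and>
     (\<forall>g\<in>arr C. src C g = tgt C g \<and> ccomp C g g = g \<longrightarrow> belongs_to (ker_cat C R g) H)"

text \<open>The values of \<open>t\<close> may overlap for coterminal arrows, but only within classes of \<open>R\<close>: this
  is a division of the quotient by \<open>R\<close>, and a division of the category itself if \<open>R\<close> is
  equality.\<close>

definition rel_morph :: "('o, 'm) cat \<Rightarrow> ('a, 'b) monoid_scheme \<Rightarrow> ('m \<Rightarrow> 'a set) \<Rightarrow> ('m \<Rightarrow> 'm \<Rightarrow> bool) \<Rightarrow> bool" where
  "rel_morph C N t R \<longleftrightarrow>
     (\<forall>m\<in>arr C. t m \<noteq> {} \<and> t m \<subseteq> carrier N) \<and> (\<forall>c\<in>obj C. \<one>\<^bsub>N\<^esub> \<in> t (ident C c)) \<and>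
     (\<forall>m\<in>arr C. \<forall>n\<in>arr C. tgt C m = src C n \<longrightarrow> (\<forall>x\<in>t m. \<forall>y\<in>t n. x \<otimes>\<^bsub>N\<^esub> y \<in> t (ccomp C m n))) \<and>
     (\<forall>m\<in>arr C. \<forall>m'\<in>arr C. src C m = src C m' \<longrightarrow> tgt C m = tgt C m' \<longrightarrow> t m \<inter> t m' \<noteq> {} \<longrightarrow> R m m')"

lemma rel_morphD:
  assumes "rel_morph C N t R"
  shows "m \<in> arr C \<Longrightarrow> t m \<noteq> {}" "m \<in> arr C \<Longrightarrow> x \<in> t m \<Longrightarrow> x \<in> carrier N"
    "c \<in> obj C \<Longrightarrow> \<one>\<^bsub>N\<^esub> \<in> t (ident C c)"
    "m \<in> arr C \<Longrightarrow> n \<in> arr C \<Longrightarrow> tgt C m = src C n \<Longrightarrow> x \<in> t m \<Longrightarrow> y \<in> t n \<Longrightarrow> x \<otimes>\<^bsub>N\<^esub> y \<in> t (ccomp C m n)"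
    "m \<in> arr C \<Longrightarrow> m' \<in> arr C \<Longrightarrow> src C m = src C m' \<Longrightarrow> tgt C m = tgt C m' \<Longrightarrow> x \<in> t m \<Longrightarrow> x \<in> t m' \<Longrightarrow> R m m'"
  using assms unfolding rel_morph_def by blast+

lemma cat_divides_one_object_iff: "cat_divides C (one_object_cat M) \<longleftrightarrow> (\<exists>t. rel_morph C M t (=))"
proof
  assume "\<exists>t. rel_morph C M t (=)"
  then obtain t where t: "rel_morph C M t (=)" by blast
  show "cat_divides C (one_object_cat M)"
    unfolding cat_divides_def
    using rel_morphD[OF t]
    by (intro exI[of _ "\<lambda>_. ()"] exI[of _ t]) (auto simp: one_object_cat_def hom_set_def)
next
  assume "cat_divides C (one_object_cat M)"
  then obtain f t where
    ft: "\<forall>m\<in>arr C. t m \<noteq> {} \<and> t m \<subseteq> hom_set (one_object_cat M) (f (src C m)) (f (tgt C m))"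
      "\<forall>c\<in>obj C. ident (one_object_cat M) (f c) \<in> t (ident C c)"
      "\<forall>m\<in>arr C. \<forall>n\<in>arr C. tgt C m = src C n \<longrightarrow>
         (\<forall>x\<in>t m. \<forall>y\<in>t n. ccomp (one_object_cat M) x y \<in> t (ccomp C m n))"
      "\<forall>m\<in>arr C. \<forall>m'\<in>arr C. src C m = src C m' \<and> tgt C m = tgt C m' \<and> m \<noteq> m' \<longrightarrow> t m \<inter> t m' = {}"
    unfolding cat_divides_def by (elim exE conjE) rule
  have "rel_morph C M t (=)"
    unfolding rel_morph_def
  proof (intro conjI ballI impI)
    fix m assume "m \<in> arr C"
    then show "t m \<noteq> {}" "t m \<subseteq> carrier M" using ft(1) by (auto simp: one_object_cat_def hom_set_def)
  next
    fix c assume "c \<in> obj C"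
    then show "\<one>\<^bsub>M\<^esub> \<in> t (ident C c)" using ft(2) by (simp add: one_object_cat_def)
  next
    fix m n x y assume "m \<in> arr C" "n \<in> arr C" "tgt C m = src C n" "x \<in> t m" "y \<in> t n"
    then show "x \<otimes>\<^bsub>M\<^esub> y \<in> t (ccomp C m n)" using ft(3) by (simp add: one_object_cat_def)
  next
    fix m m' assume "m \<in> arr C" "m' \<in> arr C" "src C m = src C m'" "tgt C m = tgt C m'" "t m \<inter> t m' \<noteq> {}"
    then show "m = m'" using ft(4) by blast
  qed
  then show "\<exists>t. rel_morph C M t (=)" by blast
qed

lemma rel_morph_embed:
  assumes t: "rel_morph C N t R" and h: "h \<in> hom N N'" "h \<one>\<^bsub>N\<^esub> = \<one>\<^bsub>N'\<^esub>" "inj_on h (carrier N)"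
  shows "rel_morph C N' (\<lambda>m. h ` t m) R"
  unfolding rel_morph_def
proof (intro conjI ballI impI)
  fix m n x y assume mn: "m \<in> arr C" "n \<in> arr C" "tgt C m = src C n" "x \<in> h ` t m" "y \<in> h ` t n"
  then obtain x' y' where xy: "x = h x'" "x' \<in> t m" "y = h y'" "y' \<in> t n" by blast
  then have "x \<otimes>\<^bsub>N'\<^esub> y = h (x' \<otimes>\<^bsub>N\<^esub> y')"
    using rel_morphD(2)[OF t] mn hom_mult[OF h(1)] by simp
  then show "x \<otimes>\<^bsub>N'\<^esub> y \<in> h ` t (ccomp C m n)" using rel_morphD(4)[OF t mn(1-3) xy(2,4)] by blast
next
  fix m n assume mn: "m \<in> arr C" "n \<in> arr C" "src C m = src C n" "tgt C m = tgt C n" "h ` t m \<inter> h ` t n \<noteq> {}"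
  then obtain x y where "x \<in> t m" "y \<in> t n" "h x = h y" by blast
  moreover from this have "x = y" using rel_morphD(2)[OF t] mn inj_onD[OF h(3)] by blast
  ultimately show "R m n" using rel_morphD(5)[OF t mn(1-4)] by blast
next
  fix c assume "c \<in> obj C"
  then show "\<one>\<^bsub>N'\<^esub> \<in> h ` t (ident C c)" using rel_morphD(3)[OF t] h(2) by (metis imageI)
qed (use rel_morphD(1,2)[OF t] hom_in_carrier[OF h(1)] in blast)+

locale fin_cat =
  fixes C :: "('o, 'm) cat"
  assumes fc: "finite_category C"
begin

abbreviation comp (infixl \<open>\<cdot>\<close> 70) where "x \<cdot> y \<equiv> ccomp C x y"

lemma is_cat: "is_category C" and fin_obj: "finite (obj C)" and fin_arr: "finite (arr C)"
  using fc by (simp_all add: finite_category_def)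

lemma ends [simp]: "m \<in> arr C \<Longrightarrow> src C m \<in> obj C" "m \<in> arr C \<Longrightarrow> tgt C m \<in> obj C"
  using is_cat by (simp_all add: is_category_def)

lemma ident_arr [simp]:
  "a \<in> obj C \<Longrightarrow> ident C a \<in> arr C" "a \<in> obj C \<Longrightarrow> src C (ident C a) = a" "a \<in> obj C \<Longrightarrow> tgt C (ident C a) = a"
  using is_cat by (simp_all add: is_category_def hom_set_def)

lemma comp_arr [simp]:
  assumes "m \<in> arr C" "n \<in> arr C" "tgt C m = src C n"
  shows "m \<cdot> n \<in> arr C" "src C (m \<cdot> n) = src C m" "tgt C (m \<cdot> n) = tgt C n"
  using is_cat assms by (simp_all add: is_category_def hom_set_def)

lemma ident_comp [simp]:
  "m \<in> arr C \<Longrightarrow> src C m = a \<Longrightarrow> ident C a \<cdot> m = m" "m \<in> arr C \<Longrightarrow> tgt C m = a \<Longrightarrow> m \<cdot> ident C a = m"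
  using is_cat by (auto simp: is_category_def)

lemma comp_assoc:
  "m \<in> arr C \<Longrightarrow> n \<in> arr C \<Longrightarrow> p \<in> arr C \<Longrightarrow> tgt C m = src C n \<Longrightarrow> tgt C n = src C p \<Longrightarrow>
    m \<cdot> n \<cdot> p = m \<cdot> (n \<cdot> p)"
  using is_cat by (simp add: is_category_def)

lemma carrier_local_monoid [simp]: "x \<in> carrier (local_monoid C c) \<longleftrightarrow> x \<in> arr C \<and> src C x = c \<and> tgt C x = c"
  and mult_local_monoid [simp]: "monoid.mult (local_monoid C c) = ccomp C"
  and one_local_monoid [simp]: "\<one>\<^bsub>local_monoid C c\<^esub> = ident C c"
  by (auto simp: local_monoid_def hom_set_def)

lemma local_monoid: "c \<in> obj C \<Longrightarrow> monoid (local_monoid C c)"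
  by (rule monoidI) (auto simp: comp_assoc)

lemma finite_local_monoid: "finite (carrier (local_monoid C c))"
  by (rule finite_subset[OF _ fin_arr]) auto

end

text \<open>Division restricts to local monoids: the union of the values of \<open>t\<close> on the loops at \<open>c\<close> is
  a submonoid, and disjointness makes it map onto the local monoid.\<close>

lemma (in monoid_pv) gV_subset_lV: "gV V \<subseteq> lV V"
proof
  fix C assume "C \<in> gV V"
  then obtain M where fc: "finite_category C" and M: "M \<in> V" and div: "cat_divides C (one_object_cat M)"
    unfolding gV_def by blast
  interpret fin_cat C by standard (rule fc)
  interpret M: monoid M by (rule mpv_monoid[OF M])
  obtain t where "rel_morph C M t (=)" using div unfolding cat_divides_one_object_iff by blast
  note t = rel_morphD[OF this]
  have "local_monoid C c \<in> V" if c: "c \<in> obj C" for c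
  proof -
    let ?L = "local_monoid C c"
    define T where "T = (\<Union>m\<in>carrier ?L. t m)"
    define \<psi> where "\<psi> x = (THE m. m \<in> carrier ?L \<and> x \<in> t m)" for x
    have \<psi>: "\<psi> x = m" if "m \<in> carrier ?L" "x \<in> t m" for x m
      unfolding \<psi>_def
    proof (rule the_equality)
      fix m' assume "m' \<in> carrier ?L \<and> x \<in> t m'"
      then show "m' = m" using t(5)[of m' m x] that by simp
    qed (use that in blast)
    have sub: "submonoid T M"
    proof (rule submonoid.intro)
      show "T \<subseteq> carrier M" unfolding T_def by (auto intro: t(2))
      show "\<one>\<^bsub>M\<^esub> \<in> T" unfolding T_def using t(3)[OF c] c by (intro UN_I[of "ident C c"]) auto
      fix x y assume "x \<in> T" "y \<in> T"
      then obtain m n where "m \<in> carrier ?L" "x \<in> t m" "n \<in> carrier ?L" "y \<in> t n" unfolding T_def by blast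
      then show "x \<otimes>\<^bsub>M\<^esub> y \<in> T"
        unfolding T_def using t(4)[of m n x y] by (intro UN_I[of "ccomp C m n"]) simp_all
    qed
    have "\<psi> \<in> epi (M\<lparr>carrier := T\<rparr>) ?L"
    proof (intro epiI homI)
      fix x assume "x \<in> carrier (M\<lparr>carrier := T\<rparr>)"
      then obtain m where "m \<in> carrier ?L" "x \<in> t m" unfolding T_def by auto
      then show "\<psi> x \<in> carrier ?L" using \<psi>[of m x] by simp
    next
      fix x y assume "x \<in> carrier (M\<lparr>carrier := T\<rparr>)" "y \<in> carrier (M\<lparr>carrier := T\<rparr>)"
      then obtain m n where mn: "m \<in> carrier ?L" "x \<in> t m" "n \<in> carrier ?L" "y \<in> t n" unfolding T_def by auto
      then have "x \<otimes>\<^bsub>M\<^esub> y \<in> t (ccomp C m n)" "ccomp C m n \<in> carrier ?L" using t(4)[of m n x y] by auto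
      then show "\<psi> (x \<otimes>\<^bsub>M\<lparr>carrier := T\<rparr>\<^esub> y) = \<psi> x \<otimes>\<^bsub>?L\<^esub> \<psi> y"
        using \<psi>[OF mn(1,2)] \<psi>[OF mn(3,4)] \<psi>[of "ccomp C m n"] by simp
    next
      fix m assume m: "m \<in> carrier ?L"
      then obtain x where x: "x \<in> t m" using t(1)[of m] by auto
      then have "x \<in> T" unfolding T_def using m by (rule UN_I[rotated])
      then show "\<exists>x\<in>carrier (M\<lparr>carrier := T\<rparr>). \<psi> x = m" using \<psi>[OF m x] by (intro bexI[of _ x]) simp_all
    qed
    then show ?thesis by (rule mpv_image[OF mpv_submonoid[OF M sub] local_monoid[OF c]])
  qed
  then show "C \<in> lV V" unfolding lV_def using fc by blast
qed

subsection \<open>Quotients by congruences\<close>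

text \<open>The arrows of the quotient are representatives of the classes rather than classes, which
  keeps the type of arrows and allows induction on their number.\<close>

definition rep :: "('m \<Rightarrow> 'm \<Rightarrow> bool) \<Rightarrow> 'm \<Rightarrow> 'm" where
  "rep R x = (SOME y. R x y)"

definition quotient_cat :: "('o, 'm) cat \<Rightarrow> ('m \<Rightarrow> 'm \<Rightarrow> bool) \<Rightarrow> ('o, 'm) cat" where
  "quotient_cat C R = C\<lparr>arr := rep R ` arr C, ident := \<lambda>c. rep R (ident C c), ccomp := \<lambda>x y. rep R (ccomp C x y)\<rparr>"

lemma quotient_cat_simps [simp]:
  "obj (quotient_cat C R) = obj C" "arr (quotient_cat C R) = rep R ` arr C" "src (quotient_cat C R) = src C"
  "tgt (quotient_cat C R) = tgt C" "ident (quotient_cat C R) = (\<lambda>c. rep R (ident C c))"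
  "ccomp (quotient_cat C R) = (\<lambda>x y. rep R (ccomp C x y))"
  by (simp_all add: quotient_cat_def)

locale cat_cong = fin_cat C for C :: "('o, 'm) cat" +
  fixes R :: "'m \<Rightarrow> 'm \<Rightarrow> bool"
  assumes cong: "cat_congruence C R"
begin

lemma R_arr: "R x y \<Longrightarrow> x \<in> arr C" "R x y \<Longrightarrow> y \<in> arr C" "R x y \<Longrightarrow> src C x = src C y" "R x y \<Longrightarrow> tgt C x = tgt C y"
  using cong unfolding cat_congruence_def by metis+

lemma R_refl: "x \<in> arr C \<Longrightarrow> R x x" and R_sym: "R x y \<Longrightarrow> R y x" and R_trans: "R x y \<Longrightarrow> R y z \<Longrightarrow> R x z"
  using cong unfolding cat_congruence_def by metis+

lemma R_left: "R x y \<Longrightarrow> u \<in> arr C \<Longrightarrow> tgt C u = src C x \<Longrightarrow> R (u \<cdot> x) (u \<cdot> y)"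
  and R_right: "R x y \<Longrightarrow> u \<in> arr C \<Longrightarrow> src C u = tgt C x \<Longrightarrow> R (x \<cdot> u) (y \<cdot> u)"
  using cong unfolding cat_congruence_def by metis+

lemma R_comp: "R x y \<Longrightarrow> R u v \<Longrightarrow> tgt C x = src C u \<Longrightarrow> R (x \<cdot> u) (y \<cdot> v)"
  using R_trans[OF R_right[of x y u] R_left[of u v y]] R_arr by metis

lemma rep_R: "x \<in> arr C \<Longrightarrow> R x (rep R x)"
  unfolding rep_def by (rule someI) (rule R_refl)

lemma rep_arr [simp]:
  assumes "x \<in> arr C"
  shows "rep R x \<in> arr C" "src C (rep R x) = src C x" "tgt C (rep R x) = tgt C x"
  using R_arr[OF rep_R[OF assms]] by simp_all

lemma rep_eq: "R x y \<Longrightarrow> rep R x = rep R y"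
proof -
  assume "R x y"
  then have "R x = R y" using R_sym R_trans by blast
  then show ?thesis by (simp add: rep_def)
qed

lemma rep_eq_iff: "x \<in> arr C \<Longrightarrow> y \<in> arr C \<Longrightarrow> rep R x = rep R y \<longleftrightarrow> R x y"
  using rep_eq rep_R R_sym R_trans by metis

lemma rep_rep [simp]: "x \<in> arr C \<Longrightarrow> rep R (rep R x) = rep R x"
  using rep_eq[OF rep_R] by simp

lemma rep_comp:
  assumes "m \<in> arr C" "n \<in> arr C" "tgt C m = src C n"
  shows "rep R (rep R m \<cdot> n) = rep R (m \<cdot> n)" "rep R (m \<cdot> rep R n) = rep R (m \<cdot> n)"
  using assms rep_eq[OF R_right[OF rep_R[of m]]] rep_eq[OF R_left[OF rep_R[of n]]] by simp_all

lemma finite_category_quotient: "finite_category (quotient_cat C R)"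
  unfolding finite_category_def is_category_def hom_set_def
  using fin_obj fin_arr by (auto simp: rep_comp comp_assoc)

lemma card_quotient_less:
  assumes "R x y" "x \<noteq> y"
  shows "card (arr (quotient_cat C R)) < card (arr C)"
proof -
  have "\<not> inj_on (rep R) (arr C)" using assms rep_eq R_arr[OF assms(1)] by (auto simp: inj_on_def)
  then show ?thesis using fin_arr by (simp add: card_image_le inj_on_iff_eq_card le_neq_implies_less)
qed

lemma rel_morph_of_quotient:
  assumes "rel_morph (quotient_cat C R) N t (=)"
  shows "rel_morph C N (\<lambda>m. t (rep R m)) R"
  unfolding rel_morph_def
proof (intro conjI ballI impI)
  fix m n x y assume mn: "m \<in> arr C" "n \<in> arr C" "tgt C m = src C n" "x \<in> t (rep R m)" "y \<in> t (rep R n)"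
  then have "x \<otimes>\<^bsub>N\<^esub> y \<in> t (rep R (rep R m \<cdot> rep R n))"
    using rel_morphD(4)[OF assms, of "rep R m" "rep R n" x y] by simp
  then show "x \<otimes>\<^bsub>N\<^esub> y \<in> t (rep R (m \<cdot> n))" using mn by (simp add: rep_comp)
next
  fix m n assume mn: "m \<in> arr C" "n \<in> arr C" "src C m = src C n" "tgt C m = tgt C n"
    "t (rep R m) \<inter> t (rep R n) \<noteq> {}"
  then obtain x where "x \<in> t (rep R m)" "x \<in> t (rep R n)" by blast
  then have "rep R m = rep R n" using rel_morphD(5)[OF assms, of "rep R m" "rep R n" x] mn by simp
  then show "R m n" using mn by (simp add: rep_eq_iff)
qed (use rel_morphD(1,2,3)[OF assms] in auto)

end

section \<open>The largest LH-congruence of a category\<close>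

text \<open>For a Fitting pseudovariety the normal subgroups in \<open>H\<close> are closed under products, and so
  one of maximal order contains all others.\<close>

definition max_normal :: "nat monoid set \<Rightarrow> nat monoid \<Rightarrow> nat set" where
  "max_normal H G = (SOME K. K \<lhd> G \<and> G\<lparr>carrier := K\<rparr> \<in> H \<and> (\<forall>L. L \<lhd> G \<and> G\<lparr>carrier := L\<rparr> \<in> H \<longrightarrow> L \<subseteq> K))"

lemma (in group_pv) max_normal:
  assumes fit: "Fitting H" and G: "group (G :: nat monoid)" "finite (carrier G)"
  shows "max_normal H G \<lhd> G" "G\<lparr>carrier := max_normal H G\<rparr> \<in> H"
    "L \<lhd> G \<Longrightarrow> G\<lparr>carrier := L\<rparr> \<in> H \<Longrightarrow> L \<subseteq> max_normal H G"
proof -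
  interpret G: group G by fact
  let ?P = "\<lambda>K. K \<lhd> G \<and> G\<lparr>carrier := K\<rparr> \<in> H"
  have sub: "K \<subseteq> carrier G" if "?P K" for K
    using that normal_imp_subgroup subgroup.subset by blast
  have "?P {\<one>\<^bsub>G\<^esub>}"
  proof
    show "{\<one>\<^bsub>G\<^esub>} \<lhd> G" by (rule G.one_is_normal)
    have "group (G\<lparr>carrier := {\<one>\<^bsub>G\<^esub>}\<rparr>)" by (intro subgroup.subgroup_is_group G.triv_subgroup G(1))
    then have "belongs_to (G\<lparr>carrier := {\<one>\<^bsub>G\<^esub>}\<rparr>) H" by (intro belongs_trivial group.is_monoid) simp_all
    then show "G\<lparr>carrier := {\<one>\<^bsub>G\<^esub>}\<rparr> \<in> H" by (simp add: belongs_nat)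
  qed
  moreover have "card K < Suc (card (carrier G))" if "?P K" for K
    using card_mono[OF G(2) sub[OF that]] by simp
  ultimately obtain K where K: "?P K" and max: "\<And>L. ?P L \<Longrightarrow> card L \<le> card K"
    using ex_has_greatest_nat[of ?P "{\<one>\<^bsub>G\<^esub>}" card "Suc (card (carrier G))"] by (metis less_imp_le)
  have "L \<subseteq> K" if L: "?P L" for L
  proof -
    have KL: "?P (K <#>\<^bsub>G\<^esub> L)"
      using G.normal_subgroup_set_mult_closed[of K L] K L fit G unfolding Fitting_def by blast
    have sK: "subgroup K G" "subgroup L G" using K L normal_imp_subgroup by blast+
    have "K \<subseteq> K <#>\<^bsub>G\<^esub> L"
      using sub[OF K] subgroup.one_closed[OF sK(2)] by (force simp: set_mult_def)
    moreover have "finite (K <#>\<^bsub>G\<^esub> L)" using finite_subset[OF sub[OF KL] G(2)] .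
    ultimately have "K = K <#>\<^bsub>G\<^esub> L" using max[OF KL] card_seteq by blast
    moreover have "L \<subseteq> K <#>\<^bsub>G\<^esub> L"
      using sub[OF L] subgroup.one_closed[OF sK(1)] by (force simp: set_mult_def)
    ultimately show ?thesis by simp
  qed
  then have "\<exists>K. K \<lhd> G \<and> G\<lparr>carrier := K\<rparr> \<in> H \<and> (\<forall>L. L \<lhd> G \<and> G\<lparr>carrier := L\<rparr> \<in> H \<longrightarrow> L \<subseteq> K)"
    using K by blast
  from someI_ex[OF this, folded max_normal_def]
  show "max_normal H G \<lhd> G" "G\<lparr>carrier := max_normal H G\<rparr> \<in> H"
    "L \<lhd> G \<Longrightarrow> G\<lparr>carrier := L\<rparr> \<in> H \<Longrightarrow> L \<subseteq> max_normal H G" by blast+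
qed

definition unit_group :: "('o, 'm) cat \<Rightarrow> 'm \<Rightarrow> 'm monoid" where
  "unit_group C e = \<lparr>carrier = {x \<in> arr C. src C x = src C e \<and> tgt C x = src C e \<and> ccomp C e x = x \<and> ccomp C x e = x \<and>
     (\<exists>y\<in>arr C. src C y = src C e \<and> tgt C y = src C e \<and> ccomp C e y = y \<and> ccomp C y e = y \<and> ccomp C x y = e \<and> ccomp C y x = e)},
     monoid.mult = ccomp C, one = e\<rparr>"

context fin_cat
begin

definition idem_arr :: "'m \<Rightarrow> bool" where
  "idem_arr e \<longleftrightarrow> e \<in> arr C \<and> tgt C e = src C e \<and> e \<cdot> e = e"

lemma unit_group_simps [simp]: "monoid.mult (unit_group C e) = ccomp C" "\<one>\<^bsub>unit_group C e\<^esub> = e"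
  by (simp_all add: unit_group_def)

lemma unit_groupI:
  assumes "x \<in> arr C" "src C x = src C e" "tgt C x = src C e" "e \<cdot> x = x" "x \<cdot> e = x"
    "y \<in> arr C" "src C y = src C e" "tgt C y = src C e" "e \<cdot> y = y" "y \<cdot> e = y" "x \<cdot> y = e" "y \<cdot> x = e"
  shows "x \<in> carrier (unit_group C e)"
  using assms unfolding unit_group_def by auto

lemma unit_groupD:
  assumes "x \<in> carrier (unit_group C e)"
  shows "x \<in> arr C" "src C x = src C e" "tgt C x = src C e" "e \<cdot> x = x" "x \<cdot> e = x"
  using assms unfolding unit_group_def by auto

lemma finite_unit_group: "finite (carrier (unit_group C e))"
  by (rule finite_subset[OF _ fin_arr]) (auto simp: unit_group_def)

lemma group_unit_group:
  assumes "idem_arr e"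
  shows "group (unit_group C e)"
proof (rule groupI)
  note e = assms[unfolded idem_arr_def]
  fix x assume x: "x \<in> carrier (unit_group C e)"
  then obtain y where y: "y \<in> arr C" "src C y = src C e" "tgt C y = src C e" "e \<cdot> y = y" "y \<cdot> e = y" "x \<cdot> y = e" "y \<cdot> x = e"
    unfolding unit_group_def by auto
  note xD = unit_groupD[OF x]
  have "y \<in> carrier (unit_group C e)" by (rule unit_groupI[of y e x]) (use y xD in simp_all)
  then show "\<exists>y\<in>carrier (unit_group C e). y \<otimes>\<^bsub>unit_group C e\<^esub> x = \<one>\<^bsub>unit_group C e\<^esub>"
    using y by auto
  show "\<one>\<^bsub>unit_group C e\<^esub> \<otimes>\<^bsub>unit_group C e\<^esub> x = x" using xD by simp
  fix x' assume x': "x' \<in> carrier (unit_group C e)"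
  then obtain y' where y': "y' \<in> arr C" "src C y' = src C e" "tgt C y' = src C e" "e \<cdot> y' = y'" "y' \<cdot> e = y'" "x' \<cdot> y' = e" "y' \<cdot> x' = e"
    unfolding unit_group_def by auto
  note x'D = unit_groupD[OF x']
  have "x \<cdot> x' \<in> carrier (unit_group C e)"
  proof (rule unit_groupI[of _ e "y' \<cdot> y"])
    show "e \<cdot> (x \<cdot> x') = x \<cdot> x'" using xD x'D e comp_assoc[of e x x'] by simp
    show "x \<cdot> x' \<cdot> e = x \<cdot> x'" using xD x'D e comp_assoc[of x x' e] by simp
    show "e \<cdot> (y' \<cdot> y) = y' \<cdot> y" using y y' e comp_assoc[of e y' y] by simp
    show "y' \<cdot> y \<cdot> e = y' \<cdot> y" using y y' e comp_assoc[of y' y e] by simp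
    have "x' \<cdot> (y' \<cdot> y) = y" using comp_assoc[of x' y' y] xD x'D y y' by simp
    then show "x \<cdot> x' \<cdot> (y' \<cdot> y) = e" using comp_assoc[of x x' "y' \<cdot> y"] xD x'D y y' by simp
    have "y \<cdot> (x \<cdot> x') = x'" using comp_assoc[of y x x'] xD x'D y y' by simp
    then show "y' \<cdot> y \<cdot> (x \<cdot> x') = e" using comp_assoc[of y' y "x \<cdot> x'"] xD x'D y y' by simp
  qed (use xD x'D y y' in simp_all)
  then show "x \<otimes>\<^bsub>unit_group C e\<^esub> x' \<in> carrier (unit_group C e)" by simp
  fix z assume "z \<in> carrier (unit_group C e)"
  then show "x \<otimes>\<^bsub>unit_group C e\<^esub> x' \<otimes>\<^bsub>unit_group C e\<^esub> z = x \<otimes>\<^bsub>unit_group C e\<^esub> (x' \<otimes>\<^bsub>unit_group C e\<^esub> z)"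
    using xD x'D unit_groupD by (simp add: comp_assoc)
next
  show "\<one>\<^bsub>unit_group C e\<^esub> \<in> carrier (unit_group C e)"
    using assms unfolding idem_arr_def by (simp add: unit_groupI[of e e e])
qed

text \<open>Such \<open>u\<close> and \<open>v\<close> carry \<open>x\<close> to the loop \<open>uxv\<close> in the local monoid \<open>eCe\<close>.\<close>

definition context_at :: "'m \<Rightarrow> 'm \<Rightarrow> 'm \<Rightarrow> 'm \<Rightarrow> bool" where
  "context_at e u v x \<longleftrightarrow> idem_arr e \<and> u \<in> arr C \<and> v \<in> arr C \<and> src C u = src C e \<and> tgt C u = src C x \<and>
     src C v = tgt C x \<and> tgt C v = src C e \<and> e \<cdot> u = u \<and> v \<cdot> e = v"

end

context cat_cong
begin

lemma monoid_ker_cat: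
  assumes "idem_arr g"
  shows "monoid (ker_cat C R g)"
proof -
  note g = assms[unfolded idem_arr_def]
  show ?thesis
  proof (rule monoidI)
    fix x y assume "x \<in> carrier (ker_cat C R g)" "y \<in> carrier (ker_cat C R g)"
    then have xy: "R x g" "g \<cdot> x = x" "x \<cdot> g = x" "R y g" "g \<cdot> y = y" "y \<cdot> g = y"
      by (simp_all add: ker_cat_def)
    note a = R_arr[OF xy(1)] R_arr[OF xy(4)]
    have "R (x \<cdot> y) (g \<cdot> g)" by (rule R_comp[OF xy(1,4)]) (use a g in simp)
    then show "x \<otimes>\<^bsub>ker_cat C R g\<^esub> y \<in> carrier (ker_cat C R g)"
      using xy a g comp_assoc[of g x y] comp_assoc[of x y g] by (simp add: ker_cat_def)
  next
    fix x y z assume "x \<in> carrier (ker_cat C R g)" "y \<in> carrier (ker_cat C R g)" "z \<in> carrier (ker_cat C R g)"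
    then have "R x g" "R y g" "R z g" by (simp_all add: ker_cat_def)
    then show "x \<otimes>\<^bsub>ker_cat C R g\<^esub> y \<otimes>\<^bsub>ker_cat C R g\<^esub> z = x \<otimes>\<^bsub>ker_cat C R g\<^esub> (y \<otimes>\<^bsub>ker_cat C R g\<^esub> z)"
      using R_arr[of _ g] g by (simp add: ker_cat_def comp_assoc)
  qed (use g R_refl in \<open>simp_all add: ker_cat_def\<close>)
qed

end

text \<open>Two arrows are congruent if no context at an idempotent \<open>e\<close> distinguishes them in the
  group of units of \<open>eCe\<close>, taken modulo its largest normal subgroup in \<open>H\<close>.\<close>

definition radical_cong :: "nat monoid set \<Rightarrow> ('o, nat) cat \<Rightarrow> nat \<Rightarrow> nat \<Rightarrow> bool" where
  "radical_cong H C x y \<longleftrightarrow> x \<in> arr C \<and> y \<in> arr C \<and> src C x = src C y \<and> tgt C x = tgt C y \<and>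
     (\<forall>e u v. fin_cat.context_at C e u v x \<longrightarrow>
        (ccomp C (ccomp C u x) v \<in> carrier (unit_group C e) \<longleftrightarrow> ccomp C (ccomp C u y) v \<in> carrier (unit_group C e)) \<and>
        (ccomp C (ccomp C u x) v \<in> carrier (unit_group C e) \<longrightarrow>
           (\<exists>k\<in>max_normal H (unit_group C e). ccomp C (ccomp C u y) v = ccomp C k (ccomp C (ccomp C u x) v))))"

locale fitting_cat = group_pv H + fin_cat C for H :: "nat monoid set" and C :: "('o, nat) cat" +
  assumes fit: "Fitting H"
begin

abbreviation "K \<equiv> \<lambda>e. max_normal H (unit_group C e)"

lemma K_normal: "idem_arr e \<Longrightarrow> K e \<lhd> unit_group C e"
  and K_in: "idem_arr e \<Longrightarrow> (unit_group C e)\<lparr>carrier := K e\<rparr> \<in> H"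
  and K_max: "idem_arr e \<Longrightarrow> L \<lhd> unit_group C e \<Longrightarrow> (unit_group C e)\<lparr>carrier := L\<rparr> \<in> H \<Longrightarrow> L \<subseteq> K e"
  using max_normal[OF fit group_unit_group finite_unit_group] by blast+

lemma K_subgroup: "idem_arr e \<Longrightarrow> subgroup (K e) (unit_group C e)"
  using K_normal normal_imp_subgroup by blast

lemma K_closed: "idem_arr e \<Longrightarrow> k \<in> K e \<Longrightarrow> k \<in> carrier (unit_group C e)"
  using subgroup.mem_carrier[OF K_subgroup] .

abbreviation "R \<equiv> radical_cong H C"

lemma RD:
  assumes "R x y"
  shows "x \<in> arr C" "y \<in> arr C" "src C x = src C y" "tgt C x = tgt C y"
    "context_at e u v x \<Longrightarrow> u \<cdot> x \<cdot> v \<in> carrier (unit_group C e) \<longleftrightarrow> u \<cdot> y \<cdot> v \<in> carrier (unit_group C e)"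
    "context_at e u v x \<Longrightarrow> u \<cdot> x \<cdot> v \<in> carrier (unit_group C e) \<Longrightarrow> \<exists>k\<in>K e. u \<cdot> y \<cdot> v = k \<cdot> (u \<cdot> x \<cdot> v)"
  using assms unfolding radical_cong_def by simp_all

lemma RI:
  assumes "x \<in> arr C" "y \<in> arr C" "src C x = src C y" "tgt C x = tgt C y"
    "\<And>e u v. context_at e u v x \<Longrightarrow> u \<cdot> x \<cdot> v \<in> carrier (unit_group C e) \<longleftrightarrow> u \<cdot> y \<cdot> v \<in> carrier (unit_group C e)"
    "\<And>e u v. context_at e u v x \<Longrightarrow> u \<cdot> x \<cdot> v \<in> carrier (unit_group C e) \<Longrightarrow> \<exists>k\<in>K e. u \<cdot> y \<cdot> v = k \<cdot> (u \<cdot> x \<cdot> v)"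
  shows "R x y"
  using assms unfolding radical_cong_def by simp

lemma context_at_cong: "src C x = src C y \<Longrightarrow> tgt C x = tgt C y \<Longrightarrow> context_at e u v x \<longleftrightarrow> context_at e u v y"
  by (simp add: context_at_def)

lemma radical_cat_congruence: "cat_congruence C R"
  unfolding cat_congruence_def
proof (intro conjI allI impI ballI)
  fix x assume x: "x \<in> arr C"
  show "R x x"
  proof (rule RI)
    fix e u v assume "context_at e u v x" and U: "u \<cdot> x \<cdot> v \<in> carrier (unit_group C e)"
    then have e: "idem_arr e" unfolding context_at_def by blast
    show "\<exists>k\<in>K e. u \<cdot> x \<cdot> v = k \<cdot> (u \<cdot> x \<cdot> v)"
      using subgroup.one_closed[OF K_subgroup[OF e]] unit_groupD(4)[OF U] by (intro bexI[of _ e]) simp_all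
  qed (use x in simp_all)
next
  fix x y assume xy: "R x y"
  note D = RD[OF xy]
  show "R y x"
  proof (rule RI)
    fix e u v assume "context_at e u v y" and U: "u \<cdot> y \<cdot> v \<in> carrier (unit_group C e)"
    then have c: "context_at e u v x" using D context_at_cong by metis
    then have e: "idem_arr e" unfolding context_at_def by blast
    interpret G: group "unit_group C e" by (rule group_unit_group[OF e])
    have U': "u \<cdot> x \<cdot> v \<in> carrier (unit_group C e)" using D(5)[OF c] U by simp
    obtain k where k: "k \<in> K e" "u \<cdot> y \<cdot> v = k \<cdot> (u \<cdot> x \<cdot> v)" using D(6)[OF c U'] by blast
    note kG = K_closed[OF e k(1)]
    have "inv\<^bsub>unit_group C e\<^esub> k \<cdot> (u \<cdot> y \<cdot> v) = u \<cdot> x \<cdot> v"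
      using G.inv_solve_left[OF U' kG U] k(2) by simp
    then show "\<exists>k\<in>K e. u \<cdot> x \<cdot> v = k \<cdot> (u \<cdot> y \<cdot> v)"
      using subgroup.m_inv_closed[OF K_subgroup[OF e] k(1)] by (intro bexI[of _ "inv\<^bsub>unit_group C e\<^esub> k"]) simp_all
  next
    fix e u v assume "context_at e u v y"
    then have c: "context_at e u v x" using D context_at_cong by metis
    then show "u \<cdot> y \<cdot> v \<in> carrier (unit_group C e) \<longleftrightarrow> u \<cdot> x \<cdot> v \<in> carrier (unit_group C e)" using D(5) by simp
  qed (use D in simp_all)
next
  fix x y z assume xy: "R x y" and yz: "R y z"
  note D = RD[OF xy] and E = RD[OF yz]
  show "R x z"
  proof (rule RI)
    fix e u v assume c: "context_at e u v x"
    then have c': "context_at e u v y" using D context_at_cong by metis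
    show "u \<cdot> x \<cdot> v \<in> carrier (unit_group C e) \<longleftrightarrow> u \<cdot> z \<cdot> v \<in> carrier (unit_group C e)"
      using D(5)[OF c] E(5)[OF c'] by simp
    assume U: "u \<cdot> x \<cdot> v \<in> carrier (unit_group C e)"
    have e: "idem_arr e" using c unfolding context_at_def by blast
    interpret G: group "unit_group C e" by (rule group_unit_group[OF e])
    obtain k where k: "k \<in> K e" "u \<cdot> y \<cdot> v = k \<cdot> (u \<cdot> x \<cdot> v)" using D(6)[OF c U] by blast
    obtain k' where k': "k' \<in> K e" "u \<cdot> z \<cdot> v = k' \<cdot> (u \<cdot> y \<cdot> v)"
      using E(6)[OF c'] U D(5)[OF c] by blast
    have "u \<cdot> z \<cdot> v = k' \<cdot> k \<cdot> (u \<cdot> x \<cdot> v)"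
      using G.m_assoc[OF K_closed[OF e k'(1)] K_closed[OF e k(1)] U] k k' by simp
    moreover have "k' \<cdot> k \<in> K e" using subgroup.m_closed[OF K_subgroup[OF e] k'(1) k(1)] by simp
    ultimately show "\<exists>k\<in>K e. u \<cdot> z \<cdot> v = k \<cdot> (u \<cdot> x \<cdot> v)" by blast
  qed (use D E in simp_all)
next
  fix x y w assume xy: "R x y" and w: "w \<in> arr C"
  note D = RD[OF xy]
  { assume w': "tgt C w = src C x"
    show "R (w \<cdot> x) (w \<cdot> y)"
    proof (rule RI)
      fix e u v assume c: "context_at e u v (w \<cdot> x)"
      then have c': "context_at e (u \<cdot> w) v x"
        using D w w' comp_assoc[of e u w] unfolding context_at_def idem_arr_def by simp
      have eq: "u \<cdot> (w \<cdot> x) \<cdot> v = u \<cdot> w \<cdot> x \<cdot> v" "u \<cdot> (w \<cdot> y) \<cdot> v = u \<cdot> w \<cdot> y \<cdot> v"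
        using c D w w' unfolding context_at_def by (simp_all add: comp_assoc)
      show "u \<cdot> (w \<cdot> x) \<cdot> v \<in> carrier (unit_group C e) \<longleftrightarrow> u \<cdot> (w \<cdot> y) \<cdot> v \<in> carrier (unit_group C e)"
        unfolding eq by (rule D(5)[OF c'])
      assume "u \<cdot> (w \<cdot> x) \<cdot> v \<in> carrier (unit_group C e)"
      then show "\<exists>k\<in>K e. u \<cdot> (w \<cdot> y) \<cdot> v = k \<cdot> (u \<cdot> (w \<cdot> x) \<cdot> v)" unfolding eq by (rule D(6)[OF c'])
    qed (use D w w' in simp_all)
  }
  { assume w': "src C w = tgt C x"
    show "R (x \<cdot> w) (y \<cdot> w)"
    proof (rule RI)
      fix e u v assume c: "context_at e u v (x \<cdot> w)"
      then have c': "context_at e u (w \<cdot> v) x"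
        using D w w' comp_assoc[of w v e] unfolding context_at_def idem_arr_def by simp
      have eq: "u \<cdot> (x \<cdot> w) \<cdot> v = u \<cdot> x \<cdot> (w \<cdot> v)" "u \<cdot> (y \<cdot> w) \<cdot> v = u \<cdot> y \<cdot> (w \<cdot> v)"
        using c D w w' unfolding context_at_def by (simp_all add: comp_assoc)
      show "u \<cdot> (x \<cdot> w) \<cdot> v \<in> carrier (unit_group C e) \<longleftrightarrow> u \<cdot> (y \<cdot> w) \<cdot> v \<in> carrier (unit_group C e)"
        unfolding eq by (rule D(5)[OF c'])
      assume "u \<cdot> (x \<cdot> w) \<cdot> v \<in> carrier (unit_group C e)"
      then show "\<exists>k\<in>K e. u \<cdot> (y \<cdot> w) \<cdot> v = k \<cdot> (u \<cdot> (x \<cdot> w) \<cdot> v)" unfolding eq by (rule D(6)[OF c'])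
    qed (use D w w' in simp_all)
  }
qed (use RD in blast)+

text \<open>The context \<open>u = v = g\<close> shows that an element \<open>x = gx = xg\<close> in the class of \<open>g\<close> belongs to
  the normal subgroup at \<open>g\<close>.\<close>

lemma radical_LH_congruence: "LH_congruence H C R"
  unfolding LH_congruence_def
proof (intro conjI ballI impI)
  fix g assume "g \<in> arr C" "src C g = tgt C g \<and> g \<cdot> g = g"
  then have g: "idem_arr g" "g \<in> arr C" "tgt C g = src C g" "g \<cdot> g = g" by (simp_all add: idem_arr_def)
  have gU: "g \<in> carrier (unit_group C g)" by (rule unit_groupI[of g g g]) (use g in simp_all)
  have "x \<in> K g" if "R x g" "g \<cdot> x = x" "x \<cdot> g = x" for x
  proof -
    have "R g x" using radical_cat_congruence that(1) unfolding cat_congruence_def by blast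
    note D = RD[OF this]
    have c: "context_at g g g g" unfolding context_at_def using g by simp
    obtain k where k: "k \<in> K g" "g \<cdot> x \<cdot> g = k \<cdot> (g \<cdot> g \<cdot> g)" using D(6)[OF c] g gU by auto
    then show ?thesis using that g unit_groupD(5)[OF K_closed[OF g(1) k(1)]] by simp
  qed
  then have "id \<in> hom (ker_cat C R g) ((unit_group C g)\<lparr>carrier := K g\<rparr>)"
    by (intro homI) (simp_all add: ker_cat_def)
  moreover have cc: "cat_cong C R" by standard (rule radical_cat_congruence)
  moreover have "belongs_to ((unit_group C g)\<lparr>carrier := K g\<rparr>) H" using K_in[OF g(1)] by (simp add: belongs_nat)
  ultimately show "belongs_to (ker_cat C R g) H"
    using belongs_embed[OF _ cat_cong.monoid_ker_cat[OF cc g(1)]] inj_on_id by blast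
qed (rule radical_cat_congruence)

text \<open>The map \<open>\<sigma> s = u (\<psi> s) v\<close> becomes a homomorphism to \<open>eCe\<close> if \<open>M\<close> is given the sandwich
  product \<open>s w s'\<close>, where \<open>w\<close> lifts \<open>vu\<close>; and \<open>\<phi>\<close> is compatible with that product. It
  therefore suffices to compare \<open>\<sigma>\<close> and \<open>\<phi>\<close> on the semigroup \<open>B\<close> of all \<open>s\<close> whose image is a
  unit. For an idempotent \<open>i\<close> of \<open>B\<close> with \<open>iBi\<close> as small as possible, \<open>iBi\<close> is a group, and
  \<open>\<sigma>\<close> maps it onto the group of units. The kernel of \<open>\<phi>\<close> on \<open>iBi\<close> embeds into a local group
  of \<open>\<phi>\<close>, and its image under \<open>\<sigma>\<close> is a normal subgroup in \<open>H\<close>. Finally \<open>\<sigma> m'\<close> differs from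
  \<open>\<sigma> m\<close> by an element of that image.\<close>

lemma radical_cong_of_LH_image:
  fixes M :: "nat monoid"
  assumes M: "monoid M" "finite (carrier M)" and \<phi>: "\<phi> \<in> hom M N" "LH_hom H M \<phi>"
    and c: "c \<in> obj C" and \<psi>: "\<psi> \<in> epi M (local_monoid C c)"
    and m: "m \<in> carrier M" "m' \<in> carrier M" "\<phi> m = \<phi> m'"
    and ctx: "context_at e u v (\<psi> m)" and U: "u \<cdot> \<psi> m \<cdot> v \<in> carrier (unit_group C e)"
  shows "u \<cdot> \<psi> m' \<cdot> v \<in> carrier (unit_group C e) \<and> (\<exists>k\<in>K e. u \<cdot> \<psi> m' \<cdot> v = k \<cdot> (u \<cdot> \<psi> m \<cdot> v))"
proof -
  interpret M: monoid M by fact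
  let ?G = "unit_group C e"
  have \<psi>c: "\<psi> s \<in> arr C" "src C (\<psi> s) = c" "tgt C (\<psi> s) = c" if "s \<in> carrier M" for s
    using hom_in_carrier[OF epi_hom[OF \<psi>] that] by simp_all
  have \<psi>m: "\<psi> (s \<otimes>\<^bsub>M\<^esub> s') = \<psi> s \<cdot> \<psi> s'" if "s \<in> carrier M" "s' \<in> carrier M" for s s'
    using hom_mult[OF epi_hom[OF \<psi>] that] by simp
  have e: "idem_arr e" "e \<in> arr C" "tgt C e = src C e" "e \<cdot> e = e"
    and u: "u \<in> arr C" "src C u = src C e" "tgt C u = c" "e \<cdot> u = u"
    and v: "v \<in> arr C" "src C v = c" "tgt C v = src C e" "v \<cdot> e = v"
    using ctx \<psi>c[OF m(1)] unfolding context_at_def idem_arr_def by simp_all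
  interpret G: group ?G by (rule group_unit_group[OF e(1)])
  obtain w where w: "w \<in> carrier M" "\<psi> w = v \<cdot> u"
    using epi_obtain[OF \<psi>, of "v \<cdot> u"] u v by auto
  define \<sigma> where "\<sigma> s = u \<cdot> \<psi> s \<cdot> v" for s
  define star where "star s s' = s \<otimes>\<^bsub>M\<^esub> w \<otimes>\<^bsub>M\<^esub> s'" for s s'
  have star: "star s s' \<in> carrier M" if "s \<in> carrier M" "s' \<in> carrier M" for s s'
    using that w unfolding star_def by simp
  have star_assoc: "star (star s s') s'' = star s (star s' s'')"
    if "s \<in> carrier M" "s' \<in> carrier M" "s'' \<in> carrier M" for s s' s''
    using that w unfolding star_def by (simp add: M.m_assoc)
  have \<sigma>: "\<sigma> s \<in> arr C" "src C (\<sigma> s) = src C e" "tgt C (\<sigma> s) = src C e" "e \<cdot> \<sigma> s = \<sigma> s" "\<sigma> s \<cdot> e = \<sigma> s"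
    if "s \<in> carrier M" for s
    using \<psi>c[OF that] u v e comp_assoc[of e u "\<psi> s \<cdot> v"] comp_assoc[of "u \<cdot> \<psi> s" v e] comp_assoc[of u "\<psi> s" v]
    unfolding \<sigma>_def by simp_all
  have \<sigma>_star: "\<sigma> (star s s') = \<sigma> s \<cdot> \<sigma> s'" if "s \<in> carrier M" "s' \<in> carrier M" for s s'
    using that \<psi>c[of s] \<psi>c[of s'] u v w unfolding \<sigma>_def star_def by (simp add: \<psi>m comp_assoc)
  have \<phi>_star: "\<phi> (star s s') = \<phi> s \<otimes>\<^bsub>N\<^esub> \<phi> w \<otimes>\<^bsub>N\<^esub> \<phi> s'" if "s \<in> carrier M" "s' \<in> carrier M" for s s'
    using that w unfolding star_def by (simp add: hom_mult[OF \<phi>(1)])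
  define B where "B = {s \<in> carrier M. \<sigma> s \<in> carrier ?G}"
  have BM: "s \<in> carrier M" "\<sigma> s \<in> carrier ?G" if "s \<in> B" for s using that unfolding B_def by simp_all
  have B_star: "star s s' \<in> B" if "s \<in> B" "s' \<in> B" for s s'
    using BM[OF that(1)] BM[OF that(2)] star[of s s'] G.m_closed[of "\<sigma> s" "\<sigma> s'"] \<sigma>_star[of s s']
    unfolding B_def by simp
  have finB: "finite B" using M(2) unfolding B_def by simp
  interpret B: finite_semigroup_on B star
    by standard (use finB B_star star_assoc BM in auto)
  have mB: "m \<in> B" using m(1) U unfolding B_def \<sigma>_def by simp
  define loc where "loc i = (\<lambda>b. star (star i b) i) ` B" for i
  obtain i0 where i0: "i0 \<in> B" "star i0 i0 = i0" using B.ex_idempotent mB by blast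
  obtain i where i: "i \<in> B" "star i i = i" and i_min: "\<And>j. j \<in> B \<Longrightarrow> star j j = j \<Longrightarrow> card (loc i) \<le> card (loc j)"
    using ex_has_least_nat[of "\<lambda>i. i \<in> B \<and> star i i = i" i0 "\<lambda>i. card (loc i)"] i0 by blast
  note iM = BM(1)[OF i(1)]
  have loc_iff: "s \<in> loc i \<longleftrightarrow> s \<in> B \<and> star i s = s \<and> star s i = s" for s
  proof
    assume "s \<in> loc i"
    then obtain b where b: "b \<in> B" "s = star (star i b) i" unfolding loc_def by blast
    note bM = BM(1)[OF b(1)]
    have "s \<in> B" using b i B_star by simp
    moreover have "star i s = s" using bM iM i(2) b(2) star star_assoc[of i i b] star_assoc[of i "star i b" i] by simp
    moreover have "star s i = s" using bM iM i(2) b(2) star star_assoc[of "star i b" i i] by simp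
    ultimately show "s \<in> B \<and> star i s = s \<and> star s i = s" by blast
  next
    assume "s \<in> B \<and> star i s = s \<and> star s i = s"
    then show "s \<in> loc i" unfolding loc_def by (intro image_eqI[of _ _ s]) simp_all
  qed
  let ?E = "\<lparr>carrier = loc i, monoid.mult = star, one = i\<rparr>"
  have mon_E: "monoid ?E"
  proof (rule monoidI, goal_cases)
    case (1 x y)
    then have xy: "x \<in> B" "star i x = x" "star x i = x" "y \<in> B" "star i y = y" "star y i = y" by (simp_all add: loc_iff)
    then show ?case using B_star[of x y] star_assoc[of i x y] star_assoc[of x y i] BM(1) iM by (simp add: loc_iff)
  next
    case (3 x y z)
    then show ?case using star_assoc BM(1) by (simp add: loc_iff)
  qed (use i in \<open>simp_all add: loc_iff\<close>)
  interpret E: group ?E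
  proof (rule finite_monoid_unique_idempotent_group[OF mon_E])
    show "finite (carrier ?E)" using finB by (simp add: loc_def)
    fix j assume "j \<in> carrier ?E" "j \<otimes>\<^bsub>?E\<^esub> j = j"
    then have j: "j \<in> B" "star i j = j" "star j i = j" "star j j = j" by (simp_all add: loc_iff)
    note jM = BM(1)[OF j(1)]
    have "loc j \<subseteq> loc i"
    proof
      fix s assume "s \<in> loc j"
      then obtain b where b: "b \<in> B" "s = star (star j b) j" unfolding loc_def by blast
      note bM = BM(1)[OF b(1)]
      have "s \<in> B" using b j B_star by simp
      moreover have "star i s = s"
        using bM iM jM j b(2) star star_assoc[of i "star j b" j] star_assoc[of i j b] by simp
      moreover have "star s i = s" using bM iM jM j b(2) star star_assoc[of "star j b" j i] by simp
      ultimately show "s \<in> loc i" by (simp add: loc_iff)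
    qed
    then have "loc j = loc i" using i_min[OF j(1,4)] card_seteq[of "loc i" "loc j"] finB by (simp add: loc_def)
    then have "i \<in> loc j" using i by (simp add: loc_iff)
    then obtain b where b: "b \<in> B" "i = star (star j b) j" unfolding loc_def by blast
    have "star i j = i" using star_assoc[of "star j b" j j] BM(1)[OF b(1)] jM j(4) b(2) star by simp
    then show "j = \<one>\<^bsub>?E\<^esub>" using j(2) by simp
  qed
  have \<sigma>i: "\<sigma> i = e"
    using \<sigma>_star[OF iM iM] i(2) BM(2)[OF i(1)] G.l_cancel_one[of "\<sigma> i" "\<sigma> i"] by simp
  define f where "f = i \<otimes>\<^bsub>M\<^esub> w"
  have f: "f \<in> carrier M" "f \<otimes>\<^bsub>M\<^esub> f = f"
    using iM w i(2) M.m_assoc[of "i \<otimes>\<^bsub>M\<^esub> w" i w] unfolding f_def star_def by simp_all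
  have KG: "belongs_to (ker_monoid M \<phi> f) H" using \<phi>(2) f unfolding LH_hom_def by blast
  interpret KG: group "ker_monoid M \<phi> f" by (rule belongs_group[OF KG])
  have to_KG: "s \<otimes>\<^bsub>M\<^esub> w \<in> carrier (ker_monoid M \<phi> f)"
    if "s \<in> carrier M" "star i s = s" "star s i = s" "\<phi> s = \<phi> i" for s
    using that w iM f M.m_assoc[of f s w] M.m_assoc[of "s \<otimes>\<^bsub>M\<^esub> w" i w]
    unfolding f_def star_def by (simp add: hom_mult[OF \<phi>(1)])
  \<comment> \<open>The image of \<open>NN\<close> will be a normal subgroup in \<open>H\<close>, hence contained in \<open>K e\<close>.\<close>
  define NN where "NN = {s \<in> loc i. \<phi> s = \<phi> i}"
  have \<phi>E: "\<phi> (star a b) = \<phi> (star a' b')"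
    if "a \<in> carrier M" "b \<in> carrier M" "a' \<in> carrier M" "b' \<in> carrier M" "\<phi> a = \<phi> a'" "\<phi> b = \<phi> b'" for a b a' b'
    using that by (simp add: \<phi>_star)
  have locM: "s \<in> carrier M" if "s \<in> loc i" for s using that BM(1) by (simp add: loc_iff)
  have NN_sub: "subgroup NN ?E"
  proof (rule E.subgroupI)
    show "NN \<subseteq> carrier ?E" unfolding NN_def by auto
    show "NN \<noteq> {}" using i unfolding NN_def by (auto simp: loc_iff)
    fix a assume a: "a \<in> NN"
    let ?a = "inv\<^bsub>?E\<^esub> a"
    have a': "a \<in> loc i" "\<phi> a = \<phi> i" "?a \<in> loc i" using a E.inv_closed[of a] unfolding NN_def by simp_all
    have "\<phi> ?a = \<phi> (star i ?a)" using a'(3) by (simp add: loc_iff)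
    also have "\<dots> = \<phi> (star a ?a)" using a' locM iM by (intro \<phi>E) simp_all
    also have "star a ?a = i" using E.r_inv[of a] a'(1) by simp
    finally show "?a \<in> NN" using a' unfolding NN_def by simp
    fix b assume "b \<in> NN"
    then have b': "b \<in> loc i" "\<phi> b = \<phi> i" unfolding NN_def by simp_all
    have "\<phi> (star a b) = \<phi> (star i i)" using a' b' locM iM by (intro \<phi>E) simp_all
    then show "a \<otimes>\<^bsub>?E\<^esub> b \<in> NN" using E.m_closed[of a b] a' b' i unfolding NN_def by simp
  qed
  have \<sigma>E: "\<sigma> \<in> hom ?E ?G"
    using \<sigma>_star locM by (intro homI) (simp_all add: loc_iff BM(2))
  interpret \<sigma>: group_hom ?E ?G \<sigma> by standard (rule \<sigma>E)
  have \<sigma>_onto: "\<exists>s\<in>loc i. \<sigma> s = h" if h: "h \<in> carrier ?G" for h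
  proof -
    let ?g = "\<sigma> m" let ?gi = "inv\<^bsub>?G\<^esub> ?g"
    note g = unit_groupD[OF BM(2)[OF mB]] and gi = unit_groupD[OF G.inv_closed[OF BM(2)[OF mB]]] and hD = unit_groupD[OF h]
    have "\<psi> m \<cdot> v \<cdot> ?gi \<cdot> h \<cdot> ?gi \<cdot> u \<cdot> \<psi> m \<in> carrier (local_monoid C c)"
      using \<psi>c[OF m(1)] u v gi hD by simp
    then obtain s where s: "s \<in> carrier M" "\<psi> s = \<psi> m \<cdot> v \<cdot> ?gi \<cdot> h \<cdot> ?gi \<cdot> u \<cdot> \<psi> m"
      by (rule epi_obtain[OF \<psi>])
    have "\<sigma> s = ?g \<cdot> ?gi \<cdot> h \<cdot> (?gi \<cdot> ?g)"
      using \<psi>c[OF m(1)] u v gi hD unfolding \<sigma>_def[of s] s(2) \<sigma>_def[of m] by (simp add: comp_assoc)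
    also have "\<dots> = h" using G.r_inv[OF BM(2)[OF mB]] G.l_inv[OF BM(2)[OF mB]] hD by simp
    finally have \<sigma>s: "\<sigma> s = h" .
    then have sB: "s \<in> B" using s(1) h unfolding B_def by simp
    have "star (star i s) i \<in> loc i" using sB unfolding loc_def by blast
    moreover have "\<sigma> (star (star i s) i) = h"
      using \<sigma>_star iM s(1) star \<sigma>s \<sigma>i hD by simp
    ultimately show ?thesis by blast
  qed
  define L where "L = \<sigma> ` NN"
  have L_sub: "subgroup L ?G" unfolding L_def by (rule \<sigma>.subgroup_img_is_subgroup[OF NN_sub])
  have "L \<lhd> ?G"
    unfolding G.normal_inv_iff
  proof (intro conjI ballI L_sub)
    fix x h assume x: "x \<in> carrier ?G" and "h \<in> L"
    then obtain b where b: "b \<in> loc i" "\<phi> b = \<phi> i" "h = \<sigma> b" unfolding L_def NN_def by blast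
    obtain a where a: "a \<in> loc i" "x = \<sigma> a" using \<sigma>_onto[OF x] by blast
    let ?a = "inv\<^bsub>?E\<^esub> a"
    have a': "?a \<in> loc i" using E.inv_closed[of a] a by simp
    have ab: "star a b \<in> loc i" "star (star a b) ?a \<in> loc i" using E.m_closed[of a b] E.m_closed[of "star a b" ?a] a a' b by simp_all
    have "\<phi> (star (star a b) ?a) = \<phi> (star (star a i) ?a)"
      using locM a a' b iM star by (intro \<phi>E) simp_all
    also have "star (star a i) ?a = i" using E.r_inv[of a] a by (simp add: loc_iff)
    finally have "star (star a b) ?a \<in> NN" using ab unfolding NN_def by simp
    moreover have "x \<otimes>\<^bsub>?G\<^esub> h \<otimes>\<^bsub>?G\<^esub> inv\<^bsub>?G\<^esub> x = \<sigma> (star (star a b) ?a)"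
      using \<sigma>.hom_mult[of "star a b" ?a] \<sigma>.hom_mult[of a b] \<sigma>.hom_inv[of a] a a' b ab by simp
    ultimately show "x \<otimes>\<^bsub>?G\<^esub> h \<otimes>\<^bsub>?G\<^esub> inv\<^bsub>?G\<^esub> x \<in> L" unfolding L_def by simp
  qed
  moreover have "?G\<lparr>carrier := L\<rparr> \<in> H"
  proof -
    have gN: "group (?E\<lparr>carrier := NN\<rparr>)" by (rule subgroup.subgroup_is_group[OF NN_sub E.is_group])
    have NNH: "belongs_to (?E\<lparr>carrier := NN\<rparr>) H"
    proof (rule belongs_embed[OF KG group.is_monoid[OF gN], of "\<lambda>s. s \<otimes>\<^bsub>M\<^esub> w"])
      show "(\<lambda>s. s \<otimes>\<^bsub>M\<^esub> w) \<in> hom (?E\<lparr>carrier := NN\<rparr>) (ker_monoid M \<phi> f)"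
      proof (rule homI)
        fix s assume "s \<in> carrier (?E\<lparr>carrier := NN\<rparr>)"
        then show "s \<otimes>\<^bsub>M\<^esub> w \<in> carrier (ker_monoid M \<phi> f)"
          using BM(1) unfolding NN_def by (intro to_KG) (simp_all add: loc_iff)
      next
        fix s s' assume "s \<in> carrier (?E\<lparr>carrier := NN\<rparr>)" "s' \<in> carrier (?E\<lparr>carrier := NN\<rparr>)"
        then have "s \<in> carrier M" "s' \<in> carrier M" using locM unfolding NN_def by simp_all
        then show "(s \<otimes>\<^bsub>?E\<lparr>carrier := NN\<rparr>\<^esub> s') \<otimes>\<^bsub>M\<^esub> w = s \<otimes>\<^bsub>M\<^esub> w \<otimes>\<^bsub>ker_monoid M \<phi> f\<^esub> (s' \<otimes>\<^bsub>M\<^esub> w)"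
          using w unfolding star_def by (simp add: M.m_assoc)
      qed
      show "inj_on (\<lambda>s. s \<otimes>\<^bsub>M\<^esub> w) (carrier (?E\<lparr>carrier := NN\<rparr>))"
      proof (rule inj_onI)
        fix s s' assume "s \<in> carrier (?E\<lparr>carrier := NN\<rparr>)" "s' \<in> carrier (?E\<lparr>carrier := NN\<rparr>)" and eq: "s \<otimes>\<^bsub>M\<^esub> w = s' \<otimes>\<^bsub>M\<^esub> w"
        then have "star s i = s" "star s' i = s'" unfolding NN_def by (simp_all add: loc_iff)
        then show "s = s'" using eq unfolding star_def by metis
      qed
    qed
    have \<sigma>_epi: "\<sigma> \<in> epi (?E\<lparr>carrier := NN\<rparr>) (?G\<lparr>carrier := L\<rparr>)"
    proof (intro epiI homI)
      fix a b assume "a \<in> carrier (?E\<lparr>carrier := NN\<rparr>)" "b \<in> carrier (?E\<lparr>carrier := NN\<rparr>)"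
      then show "\<sigma> (a \<otimes>\<^bsub>?E\<lparr>carrier := NN\<rparr>\<^esub> b) = \<sigma> a \<otimes>\<^bsub>?G\<lparr>carrier := L\<rparr>\<^esub> \<sigma> b"
        using \<sigma>_star locM unfolding NN_def by simp
    next
      fix y assume "y \<in> carrier (?G\<lparr>carrier := L\<rparr>)"
      then have "y \<in> \<sigma> ` NN" by (simp add: L_def)
      then obtain x where "x \<in> NN" "y = \<sigma> x" by (rule imageE)
      then show "\<exists>x\<in>carrier (?E\<lparr>carrier := NN\<rparr>). \<sigma> x = y" by (intro bexI[of _ x]) simp_all
    qed (simp add: L_def)
    have "monoid (?G\<lparr>carrier := L\<rparr>)"
      by (rule group.is_monoid[OF subgroup.subgroup_is_group[OF L_sub G.is_group]])
    then have "belongs_to (?G\<lparr>carrier := L\<rparr>) H" by (rule belongs_image[OF NNH _ \<sigma>_epi])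
    then show ?thesis by (simp add: belongs_nat)
  qed
  ultimately have LK: "L \<subseteq> K e" by (rule K_max[OF e(1)])
  \<comment> \<open>It remains to express \<open>\<sigma> m'\<close> as the product of \<open>\<sigma> m\<close> and an element of this image.\<close>
  define im where "im = star (star i m) i"
  define j where "j = inv\<^bsub>?E\<^esub> im"
  have im: "im \<in> loc i" unfolding im_def loc_def using mB by blast
  then have j: "j \<in> loc i" "star j im = i" "star im j = i"
    using E.inv_closed[of im] E.l_inv[of im] E.r_inv[of im] unfolding j_def by simp_all
  have jM: "j \<in> carrier M" "star i j = j" "star j i = j" using j(1) locM by (simp_all add: loc_iff)
  define n where "n = star (star j m') i"
  have nM: "n \<in> carrier M" "star i n = n" "star n i = n"
    using star iM jM m(2) i(2) star_assoc[of i "star j m'" i] star_assoc[of i j m'] star_assoc[of "star j m'" i i]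
    unfolding n_def by simp_all
  have "\<phi> n = \<phi> (star (star j m) i)"
    unfolding n_def using star jM iM m by (intro \<phi>E) simp_all
  also have "star (star j m) i = star j im"
    using jM iM m(1) star star_assoc[of j i m] star_assoc[of j "star i m" i] unfolding im_def by simp
  finally have \<phi>n: "\<phi> n = \<phi> i" using j by simp
  have nw: "n \<otimes>\<^bsub>M\<^esub> w \<in> carrier (ker_monoid M \<phi> f)" by (rule to_KG[OF nM \<phi>n])
  define q where "q = inv\<^bsub>ker_monoid M \<phi> f\<^esub> (n \<otimes>\<^bsub>M\<^esub> w)"
  have q: "q \<in> carrier M" "q \<otimes>\<^bsub>M\<^esub> (n \<otimes>\<^bsub>M\<^esub> w) = f" "n \<otimes>\<^bsub>M\<^esub> w \<otimes>\<^bsub>M\<^esub> q = f"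
    using KG.inv_closed[OF nw] KG.l_inv[OF nw] KG.r_inv[OF nw] unfolding q_def by simp_all
  have fi: "f \<otimes>\<^bsub>M\<^esub> i = i" and fn: "f \<otimes>\<^bsub>M\<^esub> n = n" using i(2) nM(2) unfolding f_def star_def by simp_all
  have "star (q \<otimes>\<^bsub>M\<^esub> i) n = q \<otimes>\<^bsub>M\<^esub> n"
    using fn q(1) nM(1) iM w unfolding star_def f_def by (simp add: M.m_assoc)
  also have "\<dots> = q \<otimes>\<^bsub>M\<^esub> (n \<otimes>\<^bsub>M\<^esub> w \<otimes>\<^bsub>M\<^esub> i)" using nM(3) unfolding star_def by simp
  also have "\<dots> = q \<otimes>\<^bsub>M\<^esub> (n \<otimes>\<^bsub>M\<^esub> w) \<otimes>\<^bsub>M\<^esub> i" using q(1) nM(1) iM w by (simp add: M.m_assoc)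
  finally have qn: "star (q \<otimes>\<^bsub>M\<^esub> i) n = i" using q(2) fi by simp
  have "star n (q \<otimes>\<^bsub>M\<^esub> i) = n \<otimes>\<^bsub>M\<^esub> w \<otimes>\<^bsub>M\<^esub> q \<otimes>\<^bsub>M\<^esub> i" using q(1) nM(1) iM w unfolding star_def by (simp add: M.m_assoc)
  then have nq: "star n (q \<otimes>\<^bsub>M\<^esub> i) = i" using q(3) fi by simp
  have qi: "q \<otimes>\<^bsub>M\<^esub> i \<in> carrier M" using q(1) iM by simp
  have inv: "\<sigma> n \<cdot> \<sigma> (q \<otimes>\<^bsub>M\<^esub> i) = e" "\<sigma> (q \<otimes>\<^bsub>M\<^esub> i) \<cdot> \<sigma> n = e"
    using \<sigma>_star[OF nM(1) qi, symmetric] \<sigma>_star[OF qi nM(1), symmetric] by (simp_all only: qn nq \<sigma>i)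
  have "\<sigma> n \<in> carrier ?G"
    by (rule unit_groupI[OF \<sigma>[OF nM(1)] \<sigma>[OF qi] inv])
  then have "n \<in> B" using nM(1) unfolding B_def by blast
  then have "n \<in> loc i" using nM(2,3) loc_iff by blast
  then have "n \<in> NN" using \<phi>n unfolding NN_def by blast
  then have nK: "\<sigma> n \<in> K e" using LK unfolding L_def by blast
  have \<sigma>n: "\<sigma> n = \<sigma> j \<cdot> \<sigma> m'"
    unfolding n_def using comp_assoc[of "\<sigma> j" "\<sigma> m'" e] \<sigma>[OF m(2)] \<sigma>[OF jM(1)] e(2)
    by (simp only: \<sigma>_star[OF star[OF jM(1) m(2)] iM] \<sigma>_star[OF jM(1) m(2)] \<sigma>i)
  have \<sigma>im: "\<sigma> im = \<sigma> m"
    unfolding im_def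
    by (simp only: \<sigma>_star[OF star[OF iM m(1)] iM] \<sigma>_star[OF iM m(1)] \<sigma>i \<sigma>[OF m(1)])
  have "\<sigma> m \<cdot> \<sigma> j = e" using \<sigma>_star[OF locM[OF im] jM(1)] by (simp only: j(3) \<sigma>im \<sigma>i)
  then have \<sigma>m': "\<sigma> m' = \<sigma> m \<cdot> \<sigma> n"
    using \<sigma>[OF m(2)] \<sigma>[OF m(1)] \<sigma>[OF jM(1)] comp_assoc[of "\<sigma> m" "\<sigma> j" "\<sigma> m'"] unfolding \<sigma>n by metis
  have mG: "\<sigma> m \<in> carrier ?G" by (rule BM(2)[OF mB])
  define k where "k = \<sigma> m \<cdot> \<sigma> n \<cdot> inv\<^bsub>?G\<^esub> \<sigma> m"
  have "k \<in> K e" using normal.inv_op_closed2[OF K_normal[OF e(1)] mG nK] unfolding k_def unit_group_simps .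
  moreover have "\<sigma> m' = k \<cdot> \<sigma> m"
  proof -
    have mn: "\<sigma> m \<cdot> \<sigma> n \<in> carrier ?G" using G.m_closed[OF mG K_closed[OF e(1) nK]] by (simp only: unit_group_simps)
    have "k \<cdot> \<sigma> m = \<sigma> m \<cdot> \<sigma> n \<cdot> e"
      using G.m_assoc[OF mn G.inv_closed[OF mG] mG] unfolding G.l_inv[OF mG] unfolding k_def unit_group_simps .
    then show ?thesis unfolding \<sigma>m' using unit_groupD(5)[OF mn] by metis
  qed
  moreover have "\<sigma> m' \<in> carrier ?G" using G.m_closed[OF mG K_closed[OF e(1) nK]] unfolding \<sigma>m' unit_group_simps .
  ultimately show ?thesis unfolding \<sigma>_def by blast
qed

text \<open>By the preceding lemma the local monoid of the quotient is an image of the submonoid \<open>\<phi> M\<close>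
  of \<open>N\<close>.\<close>

lemma quotient_local_monoid:
  fixes M N :: "nat monoid"
  assumes V: "monoid_pseudovariety V" and M: "LH_over H V M"
    and c: "c \<in> obj C" and \<psi>: "\<psi> \<in> epi M (local_monoid C c)"
  shows "local_monoid (quotient_cat C R) c \<in> V"
proof -
  interpret V: monoid_pv V by standard (rule V)
  interpret cat_cong C R by standard (rule radical_cat_congruence)
  obtain N \<phi> where N: "N \<in> V" and \<phi>: "\<phi> \<in> monoid_hom M N" and LH: "LH_hom H M \<phi>"
    and Mm: "monoid M" "finite (carrier M)"
    using M unfolding LH_over_def by blast
  interpret M: monoid M by fact
  interpret N: monoid N by (rule V.mpv_monoid[OF N])
  let ?L = "local_monoid (quotient_cat C R) c"
  interpret D: fin_cat "quotient_cat C R" by standard (rule finite_category_quotient)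
  have \<psi>c: "\<psi> s \<in> arr C" "src C (\<psi> s) = c" "tgt C (\<psi> s) = c" if "s \<in> carrier M" for s
    using hom_in_carrier[OF epi_hom[OF \<psi>] that] by simp_all
  have R: "R (\<psi> m) (\<psi> m')" if m: "m \<in> carrier M" "m' \<in> carrier M" "\<phi> m = \<phi> m'" for m m'
  proof (rule RI)
    fix e u v assume ctx: "context_at e u v (\<psi> m)"
    then have ctx': "context_at e u v (\<psi> m')" using \<psi>c[OF m(1)] \<psi>c[OF m(2)] by (simp add: context_at_def)
    note r = radical_cong_of_LH_image[OF Mm monoid_homD(1)[OF \<phi>] LH c \<psi>]
    show "u \<cdot> \<psi> m \<cdot> v \<in> carrier (unit_group C e) \<longleftrightarrow> u \<cdot> \<psi> m' \<cdot> v \<in> carrier (unit_group C e)"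
      using r[OF m ctx] r[OF m(2,1) m(3)[symmetric] ctx'] by blast
    assume "u \<cdot> \<psi> m \<cdot> v \<in> carrier (unit_group C e)"
    then show "\<exists>k\<in>K e. u \<cdot> \<psi> m' \<cdot> v = k \<cdot> (u \<cdot> \<psi> m \<cdot> v)" using r[OF m ctx] by blast
  qed (use \<psi>c m in simp_all)
  define A where "A = \<phi> ` carrier M"
  define \<theta> where "\<theta> x = rep R (\<psi> (SOME m. m \<in> carrier M \<and> \<phi> m = x))" for x
  have \<theta>: "\<theta> (\<phi> m) = rep R (\<psi> m)" if m: "m \<in> carrier M" for m
  proof -
    let ?m = "SOME m'. m' \<in> carrier M \<and> \<phi> m' = \<phi> m"
    have "?m \<in> carrier M \<and> \<phi> ?m = \<phi> m" by (rule someI[of _ m]) (simp add: m)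
    then show ?thesis unfolding \<theta>_def using rep_eq[OF R] m by blast
  qed
  have "submonoid A N"
  proof (rule submonoid.intro)
    show "A \<subseteq> carrier N" unfolding A_def using monoid_homD(3)[OF \<phi>] by blast
    show "\<one>\<^bsub>N\<^esub> \<in> A" unfolding A_def using monoid_homD(2)[OF \<phi>] M.one_closed by (metis imageI)
    fix x y assume "x \<in> A" "y \<in> A"
    then obtain m n where "m \<in> carrier M" "n \<in> carrier M" "x = \<phi> m" "y = \<phi> n" unfolding A_def by blast
    then have "x \<otimes>\<^bsub>N\<^esub> y = \<phi> (m \<otimes>\<^bsub>M\<^esub> n)" "m \<otimes>\<^bsub>M\<^esub> n \<in> carrier M" using monoid_homD(4)[OF \<phi>] by simp_all
    then show "x \<otimes>\<^bsub>N\<^esub> y \<in> A" unfolding A_def by blast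
  qed
  then have "N\<lparr>carrier := A\<rparr> \<in> V" by (rule V.mpv_submonoid[OF N])
  moreover have "\<theta> \<in> epi (N\<lparr>carrier := A\<rparr>) ?L"
  proof (intro epiI homI)
    fix x assume "x \<in> carrier (N\<lparr>carrier := A\<rparr>)"
    then obtain m where m: "m \<in> carrier M" "x = \<phi> m" unfolding A_def by auto
    then show "\<theta> x \<in> carrier ?L" using \<theta>[OF m(1)] \<psi>c[OF m(1)] by simp
  next
    fix x y assume "x \<in> carrier (N\<lparr>carrier := A\<rparr>)" "y \<in> carrier (N\<lparr>carrier := A\<rparr>)"
    then obtain m n where mn: "m \<in> carrier M" "n \<in> carrier M" "x = \<phi> m" "y = \<phi> n" unfolding A_def by auto
    then have "\<theta> (x \<otimes>\<^bsub>N\<^esub> y) = rep R (\<psi> (m \<otimes>\<^bsub>M\<^esub> n))"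
      using \<theta>[of "m \<otimes>\<^bsub>M\<^esub> n"] monoid_homD(4)[OF \<phi>] by simp
    also have "\<psi> (m \<otimes>\<^bsub>M\<^esub> n) = \<psi> m \<cdot> \<psi> n" using hom_mult[OF epi_hom[OF \<psi>] mn(1,2)] by simp
    finally show "\<theta> (x \<otimes>\<^bsub>N\<lparr>carrier := A\<rparr>\<^esub> y) = \<theta> x \<otimes>\<^bsub>?L\<^esub> \<theta> y"
      using mn \<theta> \<psi>c[OF mn(1)] \<psi>c[OF mn(2)] by (simp add: rep_comp)
  next
    fix y assume "y \<in> carrier ?L"
    then obtain x where x: "x \<in> arr C" "y = rep R x" "src C x = c" "tgt C x = c" by auto
    then have "x \<in> carrier (local_monoid C c)" by simp
    then obtain m where m: "m \<in> carrier M" "\<psi> m = x" by (rule epi_obtain[OF \<psi>])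
    then show "\<exists>x\<in>carrier (N\<lparr>carrier := A\<rparr>). \<theta> x = y" unfolding A_def using \<theta>[OF m(1)] x(2) by auto
  qed
  moreover have "monoid ?L" by (rule D.local_monoid) (simp add: c)
  ultimately show ?thesis using V.mpv_image by blast
qed

end

lemma (in LH_Malcev) ex_LH_congruence:
  assumes local: "is_local V" and fit: "Fitting H" and C: "C \<in> lV (Malcev (LH H) V)"
  shows "\<exists>R N t. LH_congruence H C R \<and> N \<in> V \<and> rel_morph C N t R"
proof -
  have fc: "finite_category C" and loc: "\<And>c. c \<in> obj C \<Longrightarrow> local_monoid C c \<in> Malcev (LH H) V"
    using C unfolding lV_def by blast+
  interpret fitting_cat H C by standard (rule fc, rule fit)
  interpret cat_cong C R by standard (rule radical_cat_congruence)
  have "local_monoid (quotient_cat C R) c \<in> V" if c: "c \<in> obj C" for c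
  proof -
    obtain M :: "nat monoid" and \<psi> where "LH_over H V M" "\<psi> \<in> epi M (local_monoid C c)"
      using loc[OF c] unfolding Malcev_eq_images by blast
    then show ?thesis by (rule quotient_local_monoid[OF V _ c])
  qed
  then have "quotient_cat C R \<in> lV V" unfolding lV_def using finite_category_quotient by simp
  then have "quotient_cat C R \<in> gV V" using local unfolding is_local_def by simp
  then obtain N where "N \<in> V" "cat_divides (quotient_cat C R) (one_object_cat N)" unfolding gV_def by blast
  moreover from this obtain t where "rel_morph (quotient_cat C R) N t (=)"
    unfolding cat_divides_one_object_iff by blast
  ultimately show ?thesis using radical_LH_congruence rel_morph_of_quotient by blast
qed

section \<open>Zeros: the Brandt monoid\<close>

lemma matrix_unit_mult:
  "matrix_unit i j ** matrix_unit k l = (if j = k then matrix_unit i l else 0)"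
  unfolding vec_eq_iff matrix_matrix_mult_def matrix_unit_def
  using exhaust_2[of i] exhaust_2[of j] exhaust_2[of k] exhaust_2[of l]
  by (auto simp: forall_2 sum_2)

lemma matrix_unit_neq: "matrix_unit i j \<noteq> 0" "matrix_unit i j \<noteq> mat 1"
proof -
  have "matrix_unit i j $ i $ j = 1" by (simp add: matrix_unit_def)
  then show "matrix_unit i j \<noteq> 0" by auto
  have "matrix_unit i j $ (if i = 1 then 2 else 1) $ (if i = 1 then 2 else 1) = 0"
    by (simp add: matrix_unit_def)
  then show "matrix_unit i j \<noteq> mat 1" by (auto simp: mat_def)
qed

lemma matrix_unit_inj: "matrix_unit i j = matrix_unit k l \<Longrightarrow> i = k \<and> j = l"
proof -
  assume "matrix_unit i j = matrix_unit k l"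
  then have "matrix_unit k l $ i $ j = matrix_unit i j $ i $ j" by simp
  then have "matrix_unit k l $ i $ j = 1" by (simp add: matrix_unit_def)
  then show ?thesis by (simp add: matrix_unit_def split: if_splits)
qed

text \<open>The elements \<open>e i j\<close> are the matrix units, with truth values as indices, and \<open>z\<close> is the
  zero. Let \<open>True\<close> say that an end point of an arrow is a given object \<open>c\<close>: then arrows are
  mapped to matrix units, and two arrows of which exactly one meets \<open>c\<close> at the place where
  they should be composed have product \<open>z\<close>.\<close>

definition Brandt_table :: "('a, 'b) monoid_scheme \<Rightarrow> (bool \<Rightarrow> bool \<Rightarrow> 'a) \<Rightarrow> 'a \<Rightarrow> bool" where
  "Brandt_table B e z \<longleftrightarrow>
     (\<forall>i j. e i j \<in> carrier B \<and> e i j \<noteq> z \<and> e i j \<noteq> \<one>\<^bsub>B\<^esub>) \<and> z \<in> carrier B \<and> z \<noteq> \<one>\<^bsub>B\<^esub> \<and>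
     (\<forall>i j k l. e i j \<otimes>\<^bsub>B\<^esub> e k l = (if j = k then e i l else z)) \<and>
     (\<forall>b\<in>carrier B. z \<otimes>\<^bsub>B\<^esub> b = z \<and> b \<otimes>\<^bsub>B\<^esub> z = z) \<and>
     (\<forall>i j k l. e i j = e k l \<longrightarrow> i = k \<and> j = l)"

lemma (in monoid_pv) Brandt_elements:
  assumes "belongs_to Brandt_monoid V"
  obtains B e z where "B \<in> V" "Brandt_table B e z"
proof -
  let ?X = "Brandt_monoid"
  obtain B h where B: "B \<in> V" "h \<in> iso ?X B" and mX: "monoid ?X"
    using assms unfolding belongs_to_def is_iso_def by blast
  have hh: "h \<in> hom ?X B" and inj: "inj_on h (carrier ?X)" using B(2) by (simp_all add: iso_iff)
  have h1: "h (mat 1) = \<one>\<^bsub>B\<^esub>"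
    using epi_one[OF mX mpv_monoid[OF B(1)] iso_imp_epi[OF B(2)]] by (simp add: Brandt_monoid_def)
  define idx :: "bool \<Rightarrow> 2" where "idx b = (if b then 1 else 2)" for b
  have idx: "idx b = idx c \<longleftrightarrow> b = c" for b c unfolding idx_def by simp
  define m where "m i j = matrix_unit (idx i) (idx j)" for i j
  have mC: "m i j \<in> carrier ?X" "0 \<in> carrier ?X" "mat 1 \<in> carrier ?X" for i j
    unfolding m_def idx_def Brandt_monoid_def by auto
  have mult: "x \<otimes>\<^bsub>?X\<^esub> y = x ** y" for x y by (simp add: Brandt_monoid_def)
  have hm: "h x \<otimes>\<^bsub>B\<^esub> h y = h (x ** y)" if "x \<in> carrier ?X" "y \<in> carrier ?X" for x y
    using hom_mult[OF hh that] mult by simp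
  have heq: "h x = h y \<longleftrightarrow> x = y" if "x \<in> carrier ?X" "y \<in> carrier ?X" for x y
    using inj_on_eq_iff[OF inj that] .
  have "Brandt_table B (\<lambda>i j. h (m i j)) (h 0)"
    unfolding Brandt_table_def
  proof (intro conjI allI ballI impI)
    fix b assume "b \<in> carrier B"
    then obtain x where x: "x \<in> carrier ?X" "h x = b" by (rule epi_obtain[OF iso_imp_epi[OF B(2)]])
    have "0 ** x = 0" "x ** 0 = 0" by (simp_all add: matrix_matrix_mult_def vec_eq_iff)
    then show "h 0 \<otimes>\<^bsub>B\<^esub> b = h 0" "b \<otimes>\<^bsub>B\<^esub> h 0 = h 0"
      using hm[OF mC(2) x(1)] hm[OF x(1) mC(2)] x(2) by simp_all
  next
    fix i j k l
    have "m i j ** m k l = (if j = k then m i l else 0)"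
      unfolding m_def matrix_unit_mult idx ..
    then show "h (m i j) \<otimes>\<^bsub>B\<^esub> h (m k l) = (if j = k then h (m i l) else h 0)"
      using hm[OF mC(1) mC(1)] by simp
    assume "h (m i j) = h (m k l)"
    then have "m i j = m k l" using heq[OF mC(1) mC(1)] by simp
    then have "idx i = idx k \<and> idx j = idx l" unfolding m_def by (rule matrix_unit_inj)
    then show "i = k" "j = l" by (simp_all add: idx)
  next
    fix i j
    show "h (m i j) \<noteq> h 0" using heq[OF mC(1,2)] matrix_unit_neq unfolding m_def by simp
    show "h (m i j) \<noteq> \<one>\<^bsub>B\<^esub>" using heq[OF mC(1,3)] matrix_unit_neq h1 unfolding m_def by simp
  next
    have "(0 :: int^2^2) \<noteq> mat 1" by (simp add: vec_eq_iff mat_def forall_2)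
    then show "h 0 \<noteq> \<one>\<^bsub>B\<^esub>" using heq[OF mC(2,3)] h1 by simp
  qed (use mC hom_in_carrier[OF hh] in simp_all)
  then show thesis by (rule that[OF B(1)])
qed

text \<open>The singletons and the empty set multiply like the arrows with a zero for undefined
  products. The identity is not a new element, but the set of all identities.\<close>

definition power_monoid :: "('o, 'm) cat \<Rightarrow> 'm set monoid" where
  "power_monoid C = \<lparr>carrier = Pow (arr C),
     monoid.mult = (\<lambda>X Y. {ccomp C x y |x y. x \<in> X \<and> y \<in> Y \<and> tgt C x = src C y}), one = ident C ` obj C\<rparr>"

context fin_cat
begin

lemma power_monoid_simps [simp]:
  "carrier (power_monoid C) = Pow (arr C)" "\<one>\<^bsub>power_monoid C\<^esub> = ident C ` obj C"
  "X \<otimes>\<^bsub>power_monoid C\<^esub> Y = {x \<cdot> y |x y. x \<in> X \<and> y \<in> Y \<and> tgt C x = src C y}"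
  by (simp_all add: power_monoid_def)

lemma monoid_power_monoid: "monoid (power_monoid C)"
proof (rule monoidI)
  let ?P = "power_monoid C"
  fix X Y Z assume "X \<in> carrier ?P" "Y \<in> carrier ?P" "Z \<in> carrier ?P"
  then have XYZ: "X \<subseteq> arr C" "Y \<subseteq> arr C" "Z \<subseteq> arr C" by simp_all
  show "X \<otimes>\<^bsub>?P\<^esub> Y \<otimes>\<^bsub>?P\<^esub> Z = X \<otimes>\<^bsub>?P\<^esub> (Y \<otimes>\<^bsub>?P\<^esub> Z)"
  proof (intro equalityI subsetI)
    fix p assume "p \<in> X \<otimes>\<^bsub>?P\<^esub> Y \<otimes>\<^bsub>?P\<^esub> Z"
    then obtain x y z where 1: "p = x \<cdot> y \<cdot> z" "x \<in> X" "y \<in> Y" "z \<in> Z" "tgt C x = src C y" "tgt C (x \<cdot> y) = src C z"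
      by auto
    then have "x \<in> arr C" "y \<in> arr C" "z \<in> arr C" using XYZ by auto
    with 1 have "p = x \<cdot> (y \<cdot> z)" "y \<cdot> z \<in> Y \<otimes>\<^bsub>?P\<^esub> Z" "tgt C x = src C (y \<cdot> z)" by (auto simp: comp_assoc)
    then show "p \<in> X \<otimes>\<^bsub>?P\<^esub> (Y \<otimes>\<^bsub>?P\<^esub> Z)" using 1(2) unfolding power_monoid_simps(3)[of X] by blast
  next
    fix p assume "p \<in> X \<otimes>\<^bsub>?P\<^esub> (Y \<otimes>\<^bsub>?P\<^esub> Z)"
    then obtain x y z where 1: "p = x \<cdot> (y \<cdot> z)" "x \<in> X" "y \<in> Y" "z \<in> Z" "tgt C y = src C z" "tgt C x = src C (y \<cdot> z)"
      by auto
    then have "x \<in> arr C" "y \<in> arr C" "z \<in> arr C" using XYZ by auto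
    with 1 have "p = x \<cdot> y \<cdot> z" "x \<cdot> y \<in> X \<otimes>\<^bsub>?P\<^esub> Y" "tgt C (x \<cdot> y) = src C z" by (auto simp: comp_assoc)
    then show "p \<in> X \<otimes>\<^bsub>?P\<^esub> Y \<otimes>\<^bsub>?P\<^esub> Z" using 1(4) unfolding power_monoid_simps(3)[of _ Z] by blast
  qed
  show "\<one>\<^bsub>?P\<^esub> \<otimes>\<^bsub>?P\<^esub> X = X"
  proof (intro equalityI subsetI)
    fix x assume "x \<in> \<one>\<^bsub>?P\<^esub> \<otimes>\<^bsub>?P\<^esub> X"
    then obtain c y where 1: "c \<in> obj C" "y \<in> X" "tgt C (ident C c) = src C y" "x = ident C c \<cdot> y" by auto
    moreover from 1 XYZ(1) have "y \<in> arr C" by blast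
    ultimately show "x \<in> X" by simp
  next
    fix x assume x: "x \<in> X"
    then have "x \<in> arr C" using XYZ(1) by blast
    then have "x = ident C (src C x) \<cdot> x" "tgt C (ident C (src C x)) = src C x" "src C x \<in> obj C" by simp_all
    then show "x \<in> \<one>\<^bsub>?P\<^esub> \<otimes>\<^bsub>?P\<^esub> X" using x unfolding power_monoid_simps by blast
  qed
  show "X \<otimes>\<^bsub>?P\<^esub> \<one>\<^bsub>?P\<^esub> = X"
  proof (intro equalityI subsetI)
    fix x assume "x \<in> X \<otimes>\<^bsub>?P\<^esub> \<one>\<^bsub>?P\<^esub>"
    then obtain c y where 1: "c \<in> obj C" "y \<in> X" "tgt C y = src C (ident C c)" "x = y \<cdot> ident C c" by auto
    moreover from 1 XYZ(1) have "y \<in> arr C" by blast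
    ultimately show "x \<in> X" by simp
  next
    fix x assume x: "x \<in> X"
    then have "x \<in> arr C" using XYZ(1) by blast
    then have "x = x \<cdot> ident C (tgt C x)" "tgt C x = src C (ident C (tgt C x))" "tgt C x \<in> obj C" by simp_all
    then show "x \<in> X \<otimes>\<^bsub>?P\<^esub> \<one>\<^bsub>?P\<^esub>" using x unfolding power_monoid_simps by blast
  qed
  show "X \<otimes>\<^bsub>?P\<^esub> Y \<in> carrier ?P" using XYZ by (auto intro!: comp_arr(1))
qed auto

end

text \<open>The monoid \<open>Q\<close> consists of the identity and of the arrows and the zero with all their
  labels. If a label of \<open>m\<close> is idempotent, the matrix units show that \<open>m\<close> is a loop and at
  which object, and all arrows with that label are congruent to \<open>m\<close>; the fibres of the other
  idempotent labels are trivial.\<close>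

lemma (in LH_Malcev) LH_over_divisor_Brandt:
  fixes C :: "('o, 'm) cat"
  assumes Br: "belongs_to Brandt_monoid V" and fc: "finite_category C"
    and R: "LH_congruence H C R" and N: "N \<in> V" and t: "rel_morph C N t R"
  shows "\<exists>(M :: nat monoid) s. LH_over H V M \<and> rel_morph C M s (=)"
proof -
  interpret cat_cong C R
    by standard (use fc R in \<open>simp_all add: LH_congruence_def\<close>)
  obtain B e z where B: "B \<in> V" and table: "Brandt_table B e z" using Brandt_elements[OF Br] .
  have eB: "e i j \<in> carrier B" and ez: "e i j \<noteq> z" and e1: "e i j \<noteq> \<one>\<^bsub>B\<^esub>"
    and z1: "z \<noteq> \<one>\<^bsub>B\<^esub>"
    and ee: "e i j \<otimes>\<^bsub>B\<^esub> e k l = (if j = k then e i l else z)"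
    and zb: "b \<in> carrier B \<Longrightarrow> z \<otimes>\<^bsub>B\<^esub> b = z" and bz: "b \<in> carrier B \<Longrightarrow> b \<otimes>\<^bsub>B\<^esub> z = z"
    and e_inj: "e i j = e k l \<Longrightarrow> i = k \<and> j = l" for i j k l b
    using table unfolding Brandt_table_def by simp_all
  interpret N: monoid N by (rule mpv_monoid[OF N])
  interpret B: monoid B by (rule mpv_monoid[OF B])
  define I where "I = insert None (Some ` obj C)"
  define F where "F = (\<lambda>j :: 'o option. case j of None \<Rightarrow> N | Some _ \<Rightarrow> B)"
  have F [simp]: "F None = N" "F (Some c) = B" for c by (simp_all add: F_def)
  have I [simp]: "None \<in> I" "c \<in> obj C \<Longrightarrow> Some c \<in> I" and I_cases: "i \<in> I \<Longrightarrow> i = None \<or> (\<exists>c\<in>obj C. i = Some c)" for c i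
    unfolding I_def by auto
  let ?P = "product_group I F"
  have PV: "belongs_to ?P V"
  proof (rule belongs_product_monoid)
    show "finite I" using fin_obj unfolding I_def by simp
    show "belongs_to (F i) V" for i using N B by (cases i) (simp_all add: belongs_nat_monoid)
  qed
  have mP: "monoid ?P" using PV by (simp add: belongs_to_def)
  then interpret P: monoid ?P .
  have finF: "finite (carrier (F i))" for i using mpv_finite N B by (cases i) simp_all
  have finP: "finite (carrier ?P)" using fin_obj unfolding I_def by (intro finite_product finF) simp
  let ?W = "power_monoid C" let ?D = "?W \<times>\<times> ?P"
  define \<beta> where "\<beta> m c = e (src C m = c) (tgt C m = c)" for m c
  have \<beta>_comp: "\<beta> m c \<otimes>\<^bsub>B\<^esub> \<beta> n c = \<beta> (m \<cdot> n) c" if "m \<in> arr C" "n \<in> arr C" "tgt C m = src C n" for m n c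
    using that unfolding \<beta>_def by (simp add: ee)
  have \<beta>_zero: "\<beta> m (tgt C m) \<otimes>\<^bsub>B\<^esub> \<beta> n (tgt C m) = z" if "tgt C m \<noteq> src C n" for m n
    using that unfolding \<beta>_def by (auto simp: ee)
  have \<beta>: "\<beta> m c \<in> carrier B" "\<beta> m c \<noteq> z" "\<beta> m c \<noteq> \<one>\<^bsub>B\<^esub>" for m c
    unfolding \<beta>_def using eB ez e1 by simp_all
  \<comment> \<open>For each object \<open>c\<close> the label of an arrow tells which of its ends are \<open>c\<close>, so that the label
    of an undefined product is zero in some coordinate.\<close>
  define lab where "lab m k \<longleftrightarrow> k \<in> carrier ?P \<and> k None \<in> t m \<and> (\<forall>c\<in>obj C. k (Some c) = \<beta> m c)" for m k
  define zer where "zer k \<longleftrightarrow> k \<in> carrier ?P \<and> (\<exists>c\<in>obj C. k (Some c) = z)" for k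
  define Q where "Q = {(ident C ` obj C, \<one>\<^bsub>?P\<^esub>)} \<union> {({m}, k) |m k. m \<in> arr C \<and> lab m k} \<union> {({}, k) |k. zer k}"
  have Q_cases: thesis0 if "q \<in> Q" "q = (ident C ` obj C, \<one>\<^bsub>?P\<^esub>) \<Longrightarrow> thesis0"
    "\<And>m k. m \<in> arr C \<Longrightarrow> lab m k \<Longrightarrow> q = ({m}, k) \<Longrightarrow> thesis0" "\<And>k. zer k \<Longrightarrow> q = ({}, k) \<Longrightarrow> thesis0" for q thesis0
    using that unfolding Q_def by blast
  have Q1: "(ident C ` obj C, \<one>\<^bsub>?P\<^esub>) \<in> Q" and Q2: "\<And>m k. m \<in> arr C \<Longrightarrow> lab m k \<Longrightarrow> ({m}, k) \<in> Q"
    and Q3: "\<And>k. zer k \<Longrightarrow> ({}, k) \<in> Q" unfolding Q_def by blast+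
  have lab_P: "lab m k \<Longrightarrow> k \<in> carrier ?P" and zer_P: "zer k \<Longrightarrow> k \<in> carrier ?P" for m k
    unfolding lab_def zer_def by blast+
  have P_mult: "(k \<otimes>\<^bsub>?P\<^esub> l) None = k None \<otimes>\<^bsub>N\<^esub> l None" "c \<in> obj C \<Longrightarrow> (k \<otimes>\<^bsub>?P\<^esub> l) (Some c) = k (Some c) \<otimes>\<^bsub>B\<^esub> l (Some c)"
    for k l c by simp_all
  have P_in: "k (Some c) \<in> carrier B" if "k \<in> carrier ?P" "c \<in> obj C" for k c
    using PiE_mem[of k I "\<lambda>i. carrier (F i)" "Some c"] that by simp
  have lab_comp: "lab (m \<cdot> n) (k \<otimes>\<^bsub>?P\<^esub> l)"
    if "m \<in> arr C" "n \<in> arr C" "tgt C m = src C n" "lab m k" "lab n l" for m n k l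
    unfolding lab_def
  proof (intro conjI ballI)
    show "k \<otimes>\<^bsub>?P\<^esub> l \<in> carrier ?P" using that lab_P by (intro P.m_closed)
    show "(k \<otimes>\<^bsub>?P\<^esub> l) None \<in> t (m \<cdot> n)"
      unfolding P_mult using that by (intro rel_morphD(4)[OF t]) (simp_all add: lab_def)
    fix c assume "c \<in> obj C"
    then show "(k \<otimes>\<^bsub>?P\<^esub> l) (Some c) = \<beta> (m \<cdot> n) c"
      using that P_mult(2) \<beta>_comp by (simp only: lab_def)
  qed
  have zer_lab: "zer (k \<otimes>\<^bsub>?P\<^esub> l)" if "m \<in> arr C" "n \<in> arr C" "tgt C m \<noteq> src C n" "lab m k" "lab n l" for m n k l
    unfolding zer_def
  proof (intro conjI bexI)
    show "k \<otimes>\<^bsub>?P\<^esub> l \<in> carrier ?P" using that lab_P by (intro P.m_closed)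
    show c: "tgt C m \<in> obj C" using that by simp
    show "(k \<otimes>\<^bsub>?P\<^esub> l) (Some (tgt C m)) = z"
      using P_mult(2)[OF c] \<beta>_zero[OF that(3)] that(4,5) c unfolding lab_def by metis
  qed
  have zer_mult: "zer (k \<otimes>\<^bsub>?P\<^esub> l)" if kl: "k \<in> carrier ?P" "l \<in> carrier ?P" "zer k \<or> zer l" for k l
  proof -
    obtain c where c: "c \<in> obj C" "k (Some c) = z \<or> l (Some c) = z" using kl(3) unfolding zer_def by blast
    then have "(k \<otimes>\<^bsub>?P\<^esub> l) (Some c) = z"
      using P_mult(2)[OF c(1)] zb[OF P_in[OF kl(2) c(1)]] bz[OF P_in[OF kl(1) c(1)]] by metis
    then show ?thesis unfolding zer_def using P.m_closed[OF kl(1,2)] c(1) by blast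
  qed
  have WP: "monoid ?D" by (rule DirProd_monoid[OF monoid_power_monoid mP])
  interpret W: monoid ?W by (rule monoid_power_monoid)
  have Q_sub: "Q \<subseteq> carrier ?D"
  proof
    fix q assume "q \<in> Q"
    then show "q \<in> carrier ?D"
      using lab_P zer_P P.one_closed by (elim Q_cases) (auto simp del: carrier_product_group one_product_group)
  qed
  have D_mult: "(X, k) \<otimes>\<^bsub>?D\<^esub> (Y, l) = (X \<otimes>\<^bsub>?W\<^esub> Y, k \<otimes>\<^bsub>?P\<^esub> l)" for X Y k l
    by (simp add: DirProd_def)
  have single: "{m} \<otimes>\<^bsub>?W\<^esub> {n} = (if tgt C m = src C n then {m \<cdot> n} else {})" for m n by auto
  have empty: "{} \<otimes>\<^bsub>?W\<^esub> X = {}" "X \<otimes>\<^bsub>?W\<^esub> {} = {}" for X by auto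
  have subm: "submonoid Q ?D"
  proof (rule submonoid.intro[OF Q_sub])
    show "\<one>\<^bsub>?D\<^esub> \<in> Q" using Q1 by (simp add: DirProd_def)
    fix p q assume p: "p \<in> Q" and q: "q \<in> Q"
    show "p \<otimes>\<^bsub>?D\<^esub> q \<in> Q"
    proof (rule Q_cases[OF p])
      assume "p = (ident C ` obj C, \<one>\<^bsub>?P\<^esub>)"
      then have "p = \<one>\<^bsub>?D\<^esub>" by (simp add: DirProd_def)
      then show ?thesis using q monoid.l_one[OF WP, of q] Q_sub by auto
    next
      fix m k assume m: "m \<in> arr C" "lab m k" "p = ({m}, k)"
      show ?thesis
      proof (rule Q_cases[OF q])
        assume "q = (ident C ` obj C, \<one>\<^bsub>?P\<^esub>)"
        then have "q = \<one>\<^bsub>?D\<^esub>" by (simp add: DirProd_def)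
        then show ?thesis using p monoid.r_one[OF WP, of p] Q_sub by auto
      next
        fix n l assume n: "n \<in> arr C" "lab n l" "q = ({n}, l)"
        show ?thesis unfolding m(3) n(3) D_mult single
          using Q2[OF _ lab_comp[OF m(1) n(1) _ m(2) n(2)]] Q3[OF zer_lab[OF m(1) n(1) _ m(2) n(2)]] m n
          by (simp split: if_split del: mult_product_group)
      next
        fix l assume l: "zer l" "q = ({}, l)"
        show ?thesis unfolding m(3) l(2) D_mult empty
          by (intro Q3 zer_mult lab_P[OF m(2)] zer_P[OF l(1)] disjI2 l(1))
      qed
    next
      fix k assume k: "zer k" "p = ({}, k)"
      obtain Y l where Y: "q = (Y, l)" by (cases q)
      have "l \<in> carrier ?P" using q Q_sub Y by auto
      then show ?thesis unfolding k(2) Y D_mult empty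
        by (intro Q3 zer_mult zer_P[OF k(1)] disjI1 k(1))
    qed
  qed
  let ?Q = "?D\<lparr>carrier := Q\<rparr>"
  have mQ: "monoid ?Q" using subm WP by (rule submonoid.submonoid_is_monoid)
  have "finite (carrier ?D)" using fin_arr finP by (simp add: DirProd_def del: carrier_product_group)
  then have finQ: "finite (carrier ?Q)" using finite_subset[OF Q_sub] by simp
  have Q_mult: "(X, k) \<otimes>\<^bsub>?Q\<^esub> (Y, l) = (X \<otimes>\<^bsub>?W\<^esub> Y, k \<otimes>\<^bsub>?P\<^esub> l)" for X Y k l
    by (simp add: DirProd_def)
  have snd_hom: "snd \<in> monoid_hom ?Q ?P"
    unfolding monoid_hom_def
  proof (intro CollectI conjI homI)
    fix q assume "q \<in> carrier ?Q"
    then have "q \<in> carrier ?D" using Q_sub by auto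
    then show "snd q \<in> carrier ?P" by (cases q) (simp add: DirProd_def del: carrier_product_group)
  next
    fix p q
    show "snd (p \<otimes>\<^bsub>?Q\<^esub> q) = snd p \<otimes>\<^bsub>?P\<^esub> snd q" using Q_mult[of "fst p" "snd p" "fst q" "snd q"] by (metis prod.collapse snd_conv)
  qed (simp add: DirProd_def)
  \<comment> \<open>By the next three facts, all elements in a fibre of the second projection are of the same kind.\<close>
  have lab_one: "\<not> lab m \<one>\<^bsub>?P\<^esub>" if "m \<in> arr C" for m
  proof
    assume "lab m \<one>\<^bsub>?P\<^esub>"
    then have "\<one>\<^bsub>?P\<^esub> (Some (src C m)) = \<beta> m (src C m)" using that unfolding lab_def by simp
    then show False using \<beta>(3)[of m "src C m"] that by simp
  qed
  have zer_one: "\<not> zer \<one>\<^bsub>?P\<^esub>" using z1 unfolding zer_def by auto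
  have lab_zer: "\<not> zer k" if "lab m k" for m k using that \<beta>(2) unfolding lab_def zer_def by metis
  have LH: "LH_hom H ?Q snd" unfolding LH_hom_def
  proof (intro ballI impI)
    fix f assume f: "f \<in> carrier ?Q" "f \<otimes>\<^bsub>?Q\<^esub> f = f"
    have mker: "monoid (ker_monoid ?Q snd f)"
      by (rule monoid_ker_monoid[OF mQ monoid_homD(1)[OF snd_hom] f])
    have trivial: "belongs_to (ker_monoid ?Q snd f) H"
      if triv: "\<And>q. q \<in> Q \<Longrightarrow> snd q = snd f \<Longrightarrow> q = f"
    proof (rule belongs_trivial[OF mker], intro equalityI subsetI)
      fix q assume "q \<in> carrier (ker_monoid ?Q snd f)"
      then have "q \<in> carrier ?Q" "snd q = snd f" unfolding ker_monoid_simps(1) by blast+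
      then have "q = f" by (intro triv) simp_all
      then show "q \<in> {\<one>\<^bsub>ker_monoid ?Q snd f\<^esub>}" unfolding ker_monoid_simps(3) by simp
    next
      fix q assume "q \<in> {\<one>\<^bsub>ker_monoid ?Q snd f\<^esub>}"
      then have "q = f" unfolding ker_monoid_simps(3) by simp
      then show "q \<in> carrier (ker_monoid ?Q snd f)" using f unfolding ker_monoid_simps(1) by blast
    qed
    have "f \<in> Q" using f(1) by simp
    then show "belongs_to (ker_monoid ?Q snd f) H"
    proof (rule Q_cases)
      assume f1: "f = (ident C ` obj C, \<one>\<^bsub>?P\<^esub>)"
      show ?thesis
      proof (rule trivial)
        fix q assume "q \<in> Q" "snd q = snd f"
        then show "q = f" using f1 lab_one zer_one by (elim Q_cases) (simp_all del: one_product_group)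
      qed
    next
      fix k assume fk: "zer k" "f = ({}, k)"
      show ?thesis
      proof (rule trivial)
        fix q assume "q \<in> Q" "snd q = snd f"
        then show "q = f" using fk lab_zer zer_one by (elim Q_cases) (auto simp del: one_product_group)
      qed
    next
      fix m k assume m: "m \<in> arr C" "lab m k" "f = ({m}, k)"
      have "{m} \<otimes>\<^bsub>?W\<^esub> {m} = {m}" using f(2) unfolding m(3) Q_mult by simp
      then have mm: "tgt C m = src C m" "m \<cdot> m = m" unfolding single by (simp_all split: if_splits)
      have ker: "\<exists>n. q = ({n}, k) \<and> n \<in> carrier (ker_cat C R m)" if q: "q \<in> carrier (ker_monoid ?Q snd f)" for q
      proof -
        have "q \<in> carrier ?Q" and q': "f \<otimes>\<^bsub>?Q\<^esub> q = q" "q \<otimes>\<^bsub>?Q\<^esub> f = q" and "snd q = snd f"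
          using q unfolding ker_monoid_simps(1) by blast+
        then have qQ: "q \<in> Q" and qk: "snd q = k" using m(3) by simp_all
        from qQ obtain n where n: "n \<in> arr C" "lab n k" "q = ({n}, k)"
          using qk lab_one[OF m(1)] m(2) lab_zer[OF m(2)]
          by (elim Q_cases) (auto simp del: one_product_group)
        have "\<beta> n (src C m) = \<beta> m (src C m)"
          using n(2) m(2) ends(1)[OF m(1)] unfolding lab_def by metis
        then have st: "src C n = src C m" "tgt C n = src C m"
          unfolding \<beta>_def using e_inj mm(1) by blast+
        have "R n m" using rel_morphD(5)[OF t n(1) m(1)] st mm(1) n(2) m(2) unfolding lab_def by metis
        moreover have "{m} \<otimes>\<^bsub>?W\<^esub> {n} = {n}" "{n} \<otimes>\<^bsub>?W\<^esub> {m} = {n}" using q' unfolding m(3) n(3) Q_mult by (simp_all only: prod.inject)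
        then have "m \<cdot> n = n" "n \<cdot> m = n" unfolding single using st mm(1) by simp_all
        ultimately show ?thesis using n(3) by (auto simp: ker_cat_def)
      qed
      show ?thesis
      proof (rule belongs_embed[OF _ mker, of "ker_cat C R m" "\<lambda>q. the_elem (fst q)"])
        show "belongs_to (ker_cat C R m) H" using R m(1) mm unfolding LH_congruence_def by simp
        show "(\<lambda>q. the_elem (fst q)) \<in> hom (ker_monoid ?Q snd f) (ker_cat C R m)"
        proof (rule homI)
          fix q assume "q \<in> carrier (ker_monoid ?Q snd f)"
          from ker[OF this] show "the_elem (fst q) \<in> carrier (ker_cat C R m)" by auto
        next
          fix p q assume "p \<in> carrier (ker_monoid ?Q snd f)" "q \<in> carrier (ker_monoid ?Q snd f)"
          from ker[OF this(1)] ker[OF this(2)] obtain n n' where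
            n: "p = ({n}, k)" "n \<in> carrier (ker_cat C R m)" "q = ({n'}, k)" "n' \<in> carrier (ker_cat C R m)" by blast
          then have "tgt C n = src C n'" using R_arr[of n m] R_arr[of n' m] mm by (simp add: ker_cat_def)
          then have "p \<otimes>\<^bsub>?Q\<^esub> q = ({n \<cdot> n'}, k \<otimes>\<^bsub>?P\<^esub> k)" unfolding n Q_mult single by simp
          then show "the_elem (fst (p \<otimes>\<^bsub>ker_monoid ?Q snd f\<^esub> q)) = the_elem (fst p) \<otimes>\<^bsub>ker_cat C R m\<^esub> the_elem (fst q)"
            using n by (simp add: ker_cat_def)
        qed
        show "inj_on (\<lambda>q. the_elem (fst q)) (carrier (ker_monoid ?Q snd f))"
        proof (rule inj_onI)
          fix p q assume "p \<in> carrier (ker_monoid ?Q snd f)" "q \<in> carrier (ker_monoid ?Q snd f)"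
            and eq: "the_elem (fst p) = the_elem (fst q)"
          from ker[OF this(1)] ker[OF this(2)] eq show "p = q" by auto
        qed
      qed
    qed
  qed
  have overQ: "LH_over H V ?Q" by (rule LH_overI[OF mQ finQ PV snd_hom LH])
  define s where "s m = {({m}, k) |k. lab m k} \<union> (if m \<in> ident C ` obj C then {(ident C ` obj C, \<one>\<^bsub>?P\<^esub>)} else {})" for m
  have s_cases: thesis0 if "q \<in> s m" "\<And>k. lab m k \<Longrightarrow> q = ({m}, k) \<Longrightarrow> thesis0"
    "\<And>c. c \<in> obj C \<Longrightarrow> m = ident C c \<Longrightarrow> q = \<one>\<^bsub>?D\<^esub> \<Longrightarrow> thesis0" for q m thesis0
    using that unfolding s_def by (auto simp: DirProd_def split: if_splits simp del: one_product_group)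
  have s1: "({m}, k) \<in> s m" if "lab m k" for m k using that unfolding s_def by blast
  have sQ: "s m \<subseteq> Q" if "m \<in> arr C" for m
    using that Q1 Q2 unfolding s_def by auto
  have s: "rel_morph C ?Q s (=)"
    unfolding rel_morph_def
  proof (intro conjI ballI impI)
    fix m assume m: "m \<in> arr C"
    obtain x where x: "x \<in> t m" using rel_morphD(1)[OF t m] by blast
    define k where "k = (\<lambda>i\<in>I. case i of None \<Rightarrow> x | Some c \<Rightarrow> \<beta> m c)"
    have "k \<in> carrier ?P"
      using rel_morphD(2)[OF t m x] \<beta>(1) unfolding k_def by (auto dest!: I_cases)
    then have "lab m k" using x unfolding lab_def k_def by simp
    then show "s m \<noteq> {}" using s1 by blast
    show "s m \<subseteq> carrier ?Q" using sQ[OF m] by simp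
  next
    fix c assume "c \<in> obj C"
    then show "\<one>\<^bsub>?Q\<^esub> \<in> s (ident C c)" unfolding s_def by (simp add: DirProd_def)
  next
    fix m n x y assume mn: "m \<in> arr C" "n \<in> arr C" "tgt C m = src C n" and x: "x \<in> s m" and y: "y \<in> s n"
    have xD: "x \<in> carrier ?D" "y \<in> carrier ?D" using sQ[OF mn(1)] sQ[OF mn(2)] Q_sub x y by blast+
    have "x \<otimes>\<^bsub>?D\<^esub> y \<in> s (m \<cdot> n)"
    proof (rule s_cases[OF x])
      fix c assume "c \<in> obj C" "m = ident C c" "x = \<one>\<^bsub>?D\<^esub>"
      then show ?thesis using y mn monoid.l_one[OF WP xD(2)] by simp
    next
      fix k assume k: "lab m k" "x = ({m}, k)"
      show ?thesis
      proof (rule s_cases[OF y])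
        fix c assume "c \<in> obj C" "n = ident C c" "y = \<one>\<^bsub>?D\<^esub>"
        then show ?thesis using x mn monoid.r_one[OF WP xD(1)] by simp
      next
        fix l assume l: "lab n l" "y = ({n}, l)"
        show ?thesis unfolding k(2) l(2) D_mult single
          using s1[OF lab_comp[OF mn k(1) l(1)]] mn(3) by (simp del: mult_product_group)
      qed
    qed
    then show "x \<otimes>\<^bsub>?Q\<^esub> y \<in> s (m \<cdot> n)" by simp
  next
    fix m n assume mn: "m \<in> arr C" "n \<in> arr C" "src C m = src C n" "tgt C m = tgt C n" "s m \<inter> s n \<noteq> {}"
    then obtain q where q: "q \<in> s m" "q \<in> s n" by blast
    have one: "\<one>\<^bsub>?D\<^esub> = (ident C ` obj C, \<one>\<^bsub>?P\<^esub>)" by (simp add: DirProd_def)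
    show "m = n"
    proof (rule s_cases[OF q(1)])
      fix k assume k: "lab m k" "q = ({m}, k)"
      have "q \<noteq> \<one>\<^bsub>?D\<^esub>" using lab_one[OF mn(1)] k unfolding one by blast
      show ?thesis
      proof (rule s_cases[OF q(2)])
        fix l assume "lab n l" "q = ({n}, l)"
        then show ?thesis using k(2) by simp
      qed (use \<open>q \<noteq> \<one>\<^bsub>?D\<^esub>\<close> in blast)
    next
      fix c assume c: "c \<in> obj C" "m = ident C c" "q = \<one>\<^bsub>?D\<^esub>"
      show ?thesis
      proof (rule s_cases[OF q(2)])
        fix l assume "lab n l" "q = ({n}, l)"
        then show ?thesis using lab_one[OF mn(2)] c(3) unfolding one by blast
      next
        fix c' assume "c' \<in> obj C" "n = ident C c'"
        then show ?thesis using c mn(3) by simp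
      qed
    qed
  qed
  obtain M :: "nat monoid" and h where M: "LH_over H V M" "h \<in> iso ?Q M" "h \<one>\<^bsub>?Q\<^esub> = \<one>\<^bsub>M\<^esub>"
    using LH_over_nat_copy[OF overQ] .
  have h: "h \<in> hom ?Q M" "inj_on h (carrier ?Q)" using M(2) unfolding iso_iff by blast+
  have "rel_morph C M (\<lambda>m. h ` s m) (=)" by (rule rel_morph_embed[OF s h(1) M(3) h(2)])
  then show ?thesis using M(1) by blast
qed

section \<open>Extension-closed pseudovarieties of groups\<close>

context group_pv
begin

lemma belongs_extension:
  assumes ext: "closed_under_extension H" and G: "group G" "finite (carrier G)"
    and \<pi>: "\<pi> \<in> hom G Q" and Q: "belongs_to Q H"
    and ker: "belongs_to (G\<lparr>carrier := kernel G Q \<pi>\<rparr>) H"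
  shows "belongs_to G H"
proof -
  interpret G: group G by fact
  interpret Q: group Q by (rule belongs_group(1)[OF Q])
  obtain P :: "nat monoid" and h where P: "monoid P" "finite (carrier P)" "h \<in> iso G P"
    using finite_monoid_nat_copy[OF G.is_monoid G(2)] by metis
  have "G \<cong> P" using P(3) unfolding is_iso_def by blast
  then interpret P: group P using G.iso_imp_group P(1) by blast
  define h' where "h' = inv_into (carrier G) h"
  have h': "h' \<in> iso P G" unfolding h'_def by (rule monoid_iso_sym[OF G.is_monoid P(3)])
  have h'h: "h' \<in> hom P G" "inj_on h' (carrier P)" using h' unfolding iso_iff by blast+
  interpret \<pi>: group_hom P Q "\<pi> \<circ> h'"
    by standard (rule hom_compose[OF h'h(1) \<pi>])
  let ?N = "kernel P Q (\<pi> \<circ> h')"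
  have sub: "subgroup ?N P" by (rule \<pi>.subgroup_kernel)
  have "belongs_to (P\<lparr>carrier := ?N\<rparr>) H"
  proof (rule belongs_embed[OF ker])
    show "monoid (P\<lparr>carrier := ?N\<rparr>)"
      by (rule group.is_monoid[OF subgroup.subgroup_is_group[OF sub P.is_group]])
    show "h' \<in> hom (P\<lparr>carrier := ?N\<rparr>) (G\<lparr>carrier := kernel G Q \<pi>\<rparr>)"
    proof (rule homI)
      fix x assume "x \<in> carrier (P\<lparr>carrier := ?N\<rparr>)"
      then show "h' x \<in> carrier (G\<lparr>carrier := kernel G Q \<pi>\<rparr>)"
        using hom_in_carrier[OF h'h(1)] by (simp add: kernel_def)
    next
      fix x y assume "x \<in> carrier (P\<lparr>carrier := ?N\<rparr>)" "y \<in> carrier (P\<lparr>carrier := ?N\<rparr>)"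
      then show "h' (x \<otimes>\<^bsub>P\<lparr>carrier := ?N\<rparr>\<^esub> y) = h' x \<otimes>\<^bsub>G\<lparr>carrier := kernel G Q \<pi>\<rparr>\<^esub> h' y"
        using hom_mult[OF h'h(1)] by (simp add: kernel_def)
    qed
    show "inj_on h' (carrier (P\<lparr>carrier := ?N\<rparr>))"
      by (rule inj_on_subset[OF h'h(2)]) (simp add: kernel_def)
  qed
  then have "P\<lparr>carrier := ?N\<rparr> \<in> H" by (simp add: belongs_nat)
  moreover have "belongs_to (P Mod ?N) H"
    by (rule belongs_embed[OF Q _ \<pi>.FactGroup_hom \<pi>.FactGroup_inj_on])
       (rule group.is_monoid[OF normal.factorgroup_is_group[OF \<pi>.normal_kernel]])
  ultimately have "P \<in> H"
    using ext P(2) P.is_group \<pi>.normal_kernel unfolding closed_under_extension_def by blast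
  then show ?thesis unfolding belongs_to_def using \<open>G \<cong> P\<close> G.is_monoid by blast
qed

text \<open>The quotient of \<open>K\<^sub>1 K\<^sub>2\<close> by \<open>K\<^sub>1\<close> is an image of \<open>K\<^sub>2\<close>.\<close>

lemma extension_imp_Fitting:
  assumes ext: "closed_under_extension H"
  shows "Fitting H"
  unfolding Fitting_def
proof (intro allI impI, elim conjE)
  fix G :: "nat monoid" and K\<^sub>1 K\<^sub>2
  assume G: "group G" "finite (carrier G)" and K: "K\<^sub>1 \<lhd> G" "K\<^sub>2 \<lhd> G"
    and H: "G\<lparr>carrier := K\<^sub>1\<rparr> \<in> H" "G\<lparr>carrier := K\<^sub>2\<rparr> \<in> H"
  interpret G: group G by fact
  interpret S: second_isomorphism_grp K\<^sub>1 G K\<^sub>2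
    by (intro second_isomorphism_grp.intro second_isomorphism_grp_axioms.intro K normal_imp_subgroup)
  let ?P = "G\<lparr>carrier := K\<^sub>1 <#>\<^bsub>G\<^esub> K\<^sub>2\<rparr>"
  have sub: "subgroup (K\<^sub>1 <#>\<^bsub>G\<^esub> K\<^sub>2) G" by (rule S.normal_set_mult_subgroup)
  have P: "group ?P" by (rule subgroup.subgroup_is_group[OF sub G(1)])
  have fin: "finite (carrier ?P)" using finite_subset[OF subgroup.subset[OF sub] G(2)] by simp
  have N: "K\<^sub>1 \<lhd> ?P" by (rule G.normal_restrict_supergroup[OF sub K(1) S.H_contained_in_set_mult])
  interpret \<pi>: group_hom "G\<lparr>carrier := K\<^sub>2\<rparr>" "?P Mod K\<^sub>1" "\<lambda>g. K\<^sub>1 #>\<^bsub>G\<^esub> g"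
    by (rule S.normal_intersection_hom)
  have "(\<lambda>g. K\<^sub>1 #>\<^bsub>G\<^esub> g) \<in> epi (G\<lparr>carrier := K\<^sub>2\<rparr>) (?P Mod K\<^sub>1)"
    unfolding epi_def using \<pi>.homh S.normal_intersection_hom_surj by blast
  moreover have "belongs_to (G\<lparr>carrier := K\<^sub>2\<rparr>) H" using H(2) by (simp add: belongs_nat)
  ultimately have "belongs_to (?P Mod K\<^sub>1) H"
    using belongs_image[OF _ \<pi>.H.is_monoid] by blast
  moreover have "?P\<lparr>carrier := K\<^sub>1\<rparr> \<in> H" using H(1) by simp
  ultimately show "?P \<in> H"
    using ext[unfolded closed_under_extension_def, rule_format, of ?P K\<^sub>1] P fin N by blast
qed

text \<open>The local group of the composite at \<open>f\<close> is an extension: \<open>\<phi>\<close> maps it to the local group of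
  \<open>\<psi>\<close> at \<open>\<phi> f\<close>, and the kernel is the local group of \<open>\<phi>\<close> at \<open>f\<close>.\<close>

lemma LH_hom_comp:
  assumes ext: "closed_under_extension H"
    and M: "monoid M" "finite (carrier M)" and \<phi>: "\<phi> \<in> hom M M'" "LH_hom H M \<phi>"
    and \<psi>: "\<psi> \<in> hom M' N" "LH_hom H M' \<psi>"
  shows "LH_hom H M (\<psi> \<circ> \<phi>)"
  unfolding LH_hom_def
proof (intro ballI impI)
  fix f assume f: "f \<in> carrier M" "f \<otimes>\<^bsub>M\<^esub> f = f"
  let ?L = "ker_monoid M (\<psi> \<circ> \<phi>) f" and ?L' = "ker_monoid M' \<psi> (\<phi> f)"
  have f': "\<phi> f \<in> carrier M'" "\<phi> f \<otimes>\<^bsub>M'\<^esub> \<phi> f = \<phi> f"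
    using f hom_mult[OF \<phi>(1) f(1) f(1)] hom_in_carrier[OF \<phi>(1)] by simp_all
  have L': "belongs_to ?L' H" using \<psi>(2) f' unfolding LH_hom_def by blast
  have K: "belongs_to (ker_monoid M \<phi> f) H" using \<phi>(2) f unfolding LH_hom_def by blast
  interpret L': group ?L' by (rule belongs_group(1)[OF L'])
  interpret K: group "ker_monoid M \<phi> f" by (rule belongs_group(1)[OF K])
  have \<phi>L: "\<phi> \<in> hom ?L ?L'"
  proof (rule homI)
    fix x assume "x \<in> carrier ?L"
    then have x: "x \<in> carrier M" "f \<otimes>\<^bsub>M\<^esub> x = x" "x \<otimes>\<^bsub>M\<^esub> f = x" "\<psi> (\<phi> x) = \<psi> (\<phi> f)" by simp_all
    then show "\<phi> x \<in> carrier ?L'"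
      using hom_mult[OF \<phi>(1) f(1) x(1)] hom_mult[OF \<phi>(1) x(1) f(1)] hom_in_carrier[OF \<phi>(1)] by simp
  qed (use hom_mult[OF \<phi>(1)] in simp)
  have mL: "monoid ?L" by (rule monoid_ker_monoid[OF M(1) hom_compose[OF \<phi>(1) \<psi>(1)] f])
  have finL: "finite (carrier ?L)" by (rule finite_subset[OF _ M(2)]) auto
  have gL: "group ?L"
  proof (rule finite_monoid_unique_idempotent_group[OF mL finL])
    fix i assume i: "i \<in> carrier ?L" "i \<otimes>\<^bsub>?L\<^esub> i = i"
    have \<phi>i: "\<phi> i \<in> carrier ?L'" by (rule hom_in_carrier[OF \<phi>L i(1)])
    moreover have "\<phi> i \<otimes>\<^bsub>?L'\<^esub> \<phi> i = \<phi> i" using hom_mult[OF \<phi>L i(1) i(1)] i(2) by metis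
    ultimately have "\<phi> i = \<phi> f" using L'.l_cancel_one[OF \<phi>i \<phi>i] by simp
    then have iK: "i \<in> carrier (ker_monoid M \<phi> f)" using i(1) by simp
    moreover have "i \<otimes>\<^bsub>ker_monoid M \<phi> f\<^esub> i = i" using i(2) by simp
    ultimately show "i = \<one>\<^bsub>?L\<^esub>" using K.l_cancel_one[OF iK iK] by simp
  qed
  have "?L\<lparr>carrier := kernel ?L ?L' \<phi>\<rparr> = ker_monoid M \<phi> f"
    by (auto simp: ker_monoid_def kernel_def)
  then show "belongs_to ?L H" using belongs_extension[OF ext gL finL \<phi>L L'] K by simp
qed

end

section \<open>Categories whose local monoids are groups\<close>

text \<open>The local monoids need not be groups themselves: they are so modulo \<open>Q\<close>, and this is
  witnessed by homomorphisms into groups that separate the classes of \<open>Q\<close>, but possibly also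
  congruent elements.\<close>

locale locally_group = group_pv H + cat_cong C Q for H :: "nat monoid set"
    and C :: "('o, 'm) cat" and Q :: "'m \<Rightarrow> 'm \<Rightarrow> bool" +
  fixes G :: "'o \<Rightarrow> nat monoid" and \<phi> :: "'o \<Rightarrow> 'm \<Rightarrow> nat" and K0 :: "nat monoid" and z :: nat
  assumes K0: "K0 \<in> H" and z: "z \<in> carrier K0" "z \<noteq> \<one>\<^bsub>K0\<^esub>"
    and G: "\<And>x. x \<in> obj C \<Longrightarrow> G x \<in> H"
    and \<phi>: "\<And>x. x \<in> obj C \<Longrightarrow> \<phi> x \<in> hom (local_monoid C x) (G x)"
    and \<phi>Q: "\<And>x m n. x \<in> obj C \<Longrightarrow> m \<in> carrier (local_monoid C x) \<Longrightarrow> n \<in> carrier (local_monoid C x) \<Longrightarrow>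
      \<phi> x m = \<phi> x n \<Longrightarrow> Q m n"
begin

lemma group_G: "x \<in> obj C \<Longrightarrow> group (G x)" using G gpv_group by blast

lemma \<phi>_idem:
  assumes x: "x \<in> obj C" and m: "m \<in> carrier (local_monoid C x)" "m \<cdot> m = m"
  shows "\<phi> x m = \<one>\<^bsub>G x\<^esub>" "Q m (ident C x)"
proof -
  interpret Gx: group "G x" by (rule group_G[OF x])
  have *: "\<phi> x n = \<one>\<^bsub>G x\<^esub>" if "n \<in> carrier (local_monoid C x)" "n \<cdot> n = n" for n
  proof -
    have n: "\<phi> x n \<in> carrier (G x)" by (rule hom_in_carrier[OF \<phi>[OF x] that(1)])
    have "\<phi> x n \<otimes>\<^bsub>G x\<^esub> \<phi> x n = \<phi> x n" using hom_mult[OF \<phi>[OF x] that(1) that(1)] that(2) by simp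
    then show ?thesis using Gx.l_cancel_one[OF n n] by simp
  qed
  show "\<phi> x m = \<one>\<^bsub>G x\<^esub>" by (rule *[OF m])
  then show "Q m (ident C x)" using \<phi>Q[OF x m(1), of "ident C x"] *[of "ident C x"] x by simp
qed

definition reach :: "'o \<Rightarrow> 'o \<Rightarrow> bool" where
  "reach x y \<longleftrightarrow> (\<exists>m\<in>arr C. src C m = x \<and> tgt C m = y)"

lemma reach_refl: "x \<in> obj C \<Longrightarrow> reach x x"
  unfolding reach_def using ident_arr by blast

lemma reach_obj: "reach x y \<Longrightarrow> y \<in> obj C"
  unfolding reach_def using ends(2) by metis

lemma reach_trans: "reach x y \<Longrightarrow> reach y w \<Longrightarrow> reach x w"
  unfolding reach_def using comp_arr by metis

lemma reach_arr: "m \<in> arr C \<Longrightarrow> reach (src C m) (tgt C m)"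
  unfolding reach_def by blast

definition base :: "'o \<Rightarrow> 'o" where
  "base x = (SOME y. reach x y \<and> reach y x)"

lemma base: "x \<in> obj C \<Longrightarrow> reach x (base x)" "x \<in> obj C \<Longrightarrow> reach (base x) x" "x \<in> obj C \<Longrightarrow> base x \<in> obj C"
proof -
  assume x: "x \<in> obj C"
  have "reach x (base x) \<and> reach (base x) x"
    unfolding base_def by (rule someI[of _ x]) (use reach_refl[OF x] in blast)
  then show "reach x (base x)" "reach (base x) x" "base x \<in> obj C" using reach_obj by blast+
qed

lemma base_eq: "reach x y \<Longrightarrow> reach y x \<Longrightarrow> base x = base y"
proof -
  assume "reach x y" "reach y x"
  then have "(\<lambda>w. reach x w \<and> reach w x) = (\<lambda>w. reach y w \<and> reach w y)" using reach_trans by blast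
  then show ?thesis unfolding base_def by simp
qed

text \<open>Within a strongly connected component arrows become invertible modulo \<open>Q\<close>, so that a
  component is the same as the group at its base point.\<close>

lemma ex_connection:
  assumes x: "x \<in> obj C"
  shows "\<exists>p q. p \<in> arr C \<and> q \<in> arr C \<and> src C p = base x \<and> tgt C p = x \<and> src C q = x \<and> tgt C q = base x \<and>
    Q (p \<cdot> q) (ident C (base x)) \<and> Q (q \<cdot> p) (ident C x)"
proof -
  note b = base[OF x]
  obtain p where p: "p \<in> arr C" "src C p = base x" "tgt C p = x" using b(2) unfolding reach_def by blast
  obtain q' where q': "q' \<in> arr C" "src C q' = x" "tgt C q' = base x" using b(1) unfolding reach_def by blast
  have fsg: "finite_semigroup_on (carrier (local_monoid C y)) (ccomp C)" for y
    by standard (auto simp: finite_local_monoid comp_assoc)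
  \<comment> \<open>Idempotent loops are trivial modulo \<open>Q\<close>, so it suffices to extend \<open>q'\<close> such that the loop at the
    base point becomes idempotent.\<close>
  have "p \<cdot> q' \<in> carrier (local_monoid C (base x))" using p q' by simp
  then obtain y where y: "y \<in> carrier (local_monoid C (base x))" "p \<cdot> q' \<cdot> y \<cdot> (p \<cdot> q' \<cdot> y) = p \<cdot> q' \<cdot> y"
    using finite_semigroup_on.idempotent_multiple[OF fsg] by metis
  define q where "q = q' \<cdot> y"
  have q: "q \<in> arr C" "src C q = x" "tgt C q = base x" using q' y unfolding q_def by simp_all
  have pq: "p \<cdot> q = p \<cdot> q' \<cdot> y" unfolding q_def using p q' y by (simp add: comp_assoc)
  have pq1: "Q (p \<cdot> q) (ident C (base x))"
  proof (rule \<phi>_idem(2)[OF b(3)])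
    show "p \<cdot> q \<in> carrier (local_monoid C (base x))" using p q by simp
    show "p \<cdot> q \<cdot> (p \<cdot> q) = p \<cdot> q" unfolding pq by (rule y(2))
  qed
  let ?w = "q \<cdot> p"
  have w: "?w \<in> carrier (local_monoid C x)" using p q by simp
  have "Q (q \<cdot> (p \<cdot> q)) (q \<cdot> ident C (base x))" by (rule R_left[OF pq1]) (use p q in simp_all)
  then have "Q (q \<cdot> (p \<cdot> q) \<cdot> p) (q \<cdot> ident C (base x) \<cdot> p)" by (rule R_right) (use p q in simp_all)
  then have ww: "Q (?w \<cdot> ?w) ?w" using p q by (simp add: comp_assoc)
  obtain v where v: "v \<in> carrier (local_monoid C x)" "?w \<cdot> v \<cdot> (?w \<cdot> v) = ?w \<cdot> v"
    using finite_semigroup_on.idempotent_multiple[OF fsg w] by metis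
  have wv: "Q (?w \<cdot> v) (ident C x)" using \<phi>_idem(2)[OF x _ v(2)] w v by simp
  have "Q (?w \<cdot> ?w \<cdot> v) (?w \<cdot> v)" by (rule R_right[OF ww]) (use w v in simp_all)
  then have "Q (?w \<cdot> (?w \<cdot> v)) (ident C x)" using wv R_trans w v comp_assoc[of ?w ?w v] by simp
  moreover have "Q (?w \<cdot> (?w \<cdot> v)) ?w" using R_left[OF wv, of ?w] w v by simp
  ultimately have "Q ?w (ident C x)" using R_sym R_trans by blast
  then show ?thesis using p q pq1 by blast
qed

definition conn :: "'o \<Rightarrow> 'm \<times> 'm" where
  "conn x = (SOME (p, q). p \<in> arr C \<and> q \<in> arr C \<and> src C p = base x \<and> tgt C p = x \<and> src C q = x \<and> tgt C q = base x \<and>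
    Q (p \<cdot> q) (ident C (base x)) \<and> Q (q \<cdot> p) (ident C x))"

abbreviation "pp x \<equiv> fst (conn x)"
abbreviation "qq x \<equiv> snd (conn x)"

lemma conn:
  assumes x: "x \<in> obj C"
  shows "pp x \<in> arr C" "qq x \<in> arr C" "src C (pp x) = base x" "tgt C (pp x) = x" "src C (qq x) = x"
    "tgt C (qq x) = base x" "Q (pp x \<cdot> qq x) (ident C (base x))" "Q (qq x \<cdot> pp x) (ident C x)"
proof -
  have "case conn x of (p, q) \<Rightarrow> p \<in> arr C \<and> q \<in> arr C \<and> src C p = base x \<and> tgt C p = x \<and> src C q = x \<and> tgt C q = base x \<and>
    Q (p \<cdot> q) (ident C (base x)) \<and> Q (q \<cdot> p) (ident C x)"
    unfolding conn_def using ex_connection[OF x] by (intro someI_ex[of "\<lambda>(p, q). _ p q"]) simp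
  then show "pp x \<in> arr C" "qq x \<in> arr C" "src C (pp x) = base x" "tgt C (pp x) = x" "src C (qq x) = x"
    "tgt C (qq x) = base x" "Q (pp x \<cdot> qq x) (ident C (base x))" "Q (qq x \<cdot> pp x) (ident C x)"
    by (simp_all add: case_prod_beta)
qed

text \<open>These are the arrows that leave a strongly connected component. On a path each of them
  occurs at most once.\<close>

definition trans_arr :: "'m \<Rightarrow> bool" where
  "trans_arr a \<longleftrightarrow> a \<in> arr C \<and> \<not> reach (tgt C a) (src C a)"

definition J :: "('m + 'o) set" where "J = Inl ` arr C \<union> Inr ` obj C"

definition Fam :: "'m + 'o \<Rightarrow> nat monoid" where "Fam i = (case i of Inl a \<Rightarrow> K0 | Inr x \<Rightarrow> G x)"

definition KK :: "('m + 'o \<Rightarrow> nat) monoid" where "KK = product_group J Fam"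

lemma carrier_KK: "carrier KK = (\<Pi>\<^sub>E i\<in>J. carrier (Fam i))"
  and KK_mult: "i \<in> J \<Longrightarrow> (k \<otimes>\<^bsub>KK\<^esub> l) i = k i \<otimes>\<^bsub>Fam i\<^esub> l i"
  and KK_one: "i \<in> J \<Longrightarrow> \<one>\<^bsub>KK\<^esub> i = \<one>\<^bsub>Fam i\<^esub>"
  by (simp_all add: KK_def)

text \<open>There is one coordinate for each arrow that leaves a component, and one for each base
  point, which measures the steps inside its component. Letting every arrow and object be an
  index does no harm, as the other coordinates are constantly trivial.\<close>

definition \<kappa> :: "'m \<Rightarrow> 'm + 'o \<Rightarrow> nat" where
  "\<kappa> a = (\<lambda>i\<in>J. case i of Inl a' \<Rightarrow> if a' = a \<and> trans_arr a then z else \<one>\<^bsub>K0\<^esub>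
     | Inr x \<Rightarrow> if reach (tgt C a) (src C a) \<and> x = base (src C a)
                then \<phi> x (pp (src C a) \<cdot> a \<cdot> qq (tgt C a)) else \<one>\<^bsub>G x\<^esub>)"

lemma Fam: "i \<in> J \<Longrightarrow> Fam i \<in> H"
  unfolding J_def Fam_def using K0 G by auto

lemma KK: "belongs_to KK H"
  unfolding KK_def
proof (rule belongs_product)
  show "finite J" unfolding J_def using fin_arr fin_obj by simp
qed (simp add: Fam belongs_nat)

lemma group_KK: "group KK" by (rule belongs_group(1)[OF KK])

lemma conj_loop:
  assumes m: "m \<in> arr C" "reach (tgt C m) (src C m)"
  shows "pp (src C m) \<cdot> m \<cdot> qq (tgt C m) \<in> carrier (local_monoid C (base (src C m)))" "base (tgt C m) = base (src C m)"
proof -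
  show "base (tgt C m) = base (src C m)" using base_eq m reach_arr by blast
  then show "pp (src C m) \<cdot> m \<cdot> qq (tgt C m) \<in> carrier (local_monoid C (base (src C m)))"
    using m conn[of "src C m"] conn[of "tgt C m"] by simp
qed

lemma \<kappa>_carrier: "a \<in> arr C \<Longrightarrow> \<kappa> a \<in> carrier KK"
proof -
  assume a: "a \<in> arr C"
  have "\<kappa> a i \<in> carrier (Fam i)" if "i \<in> J" for i
  proof (cases i)
    case (Inl a')
    interpret K0: group K0 by (rule gpv_group[OF K0])
    show ?thesis using that Inl z(1) unfolding \<kappa>_def Fam_def by simp
  next
    case (Inr x)
    then have x: "x \<in> obj C" using that unfolding J_def by blast
    interpret Gx: group "G x" by (rule group_G[OF x])
    show ?thesis using that Inr hom_in_carrier[OF \<phi>[OF x]] conj_loop(1)[OF a] unfolding \<kappa>_def Fam_def by auto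
  qed
  moreover have "\<kappa> a \<in> extensional J" unfolding \<kappa>_def by (rule restrict_extensional)
  ultimately show ?thesis by (simp add: carrier_KK PiE_iff)
qed

text \<open>An arrow has many factorizations, and these may have different products in \<open>KK\<close>; therefore
  this is a relation.\<close>

inductive path_value :: "'m \<Rightarrow> ('m + 'o \<Rightarrow> nat) \<Rightarrow> bool" where
  nil: "x \<in> obj C \<Longrightarrow> path_value (ident C x) \<one>\<^bsub>KK\<^esub>"
| snoc: "path_value m k \<Longrightarrow> a \<in> arr C \<Longrightarrow> tgt C m = src C a \<Longrightarrow> path_value (m \<cdot> a) (k \<otimes>\<^bsub>KK\<^esub> \<kappa> a)"

lemma path_value_arr: "path_value m k \<Longrightarrow> m \<in> arr C \<and> k \<in> carrier KK"
proof (induction rule: path_value.induct)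
  case (nil x)
  then show ?case using monoid.one_closed[OF group.is_monoid[OF group_KK]] ident_arr(1) by blast
next
  case (snoc m k a)
  then have "k \<otimes>\<^bsub>KK\<^esub> \<kappa> a \<in> carrier KK"
    using monoid.m_closed[OF group.is_monoid[OF group_KK]] \<kappa>_carrier by blast
  then show ?case using snoc by simp
qed

lemma path_value_comp:
  assumes "path_value n l" "path_value m k" "tgt C m = src C n"
  shows "path_value (m \<cdot> n) (k \<otimes>\<^bsub>KK\<^esub> l)"
  using assms
proof (induction rule: path_value.induct)
  case (nil x)
  then show ?case
    using path_value_arr[OF nil(2)] monoid.r_one[OF group.is_monoid[OF group_KK]] by (metis ident_arr(2) ident_comp(2))
next
  case (snoc n l a)
  note mn = path_value_arr[OF snoc(1)] path_value_arr[OF snoc.prems(1)]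
  have st: "tgt C m = src C n" using snoc.prems(2) snoc.hyps mn by simp
  have "path_value (m \<cdot> n \<cdot> a) (k \<otimes>\<^bsub>KK\<^esub> l \<otimes>\<^bsub>KK\<^esub> \<kappa> a)"
    by (rule path_value.snoc[OF snoc.IH[OF snoc.prems(1) st]]) (use snoc.hyps mn st in simp_all)
  moreover have "m \<cdot> n \<cdot> a = m \<cdot> (n \<cdot> a)" using snoc.hyps mn st by (simp add: comp_assoc)
  moreover have "k \<otimes>\<^bsub>KK\<^esub> l \<otimes>\<^bsub>KK\<^esub> \<kappa> a = k \<otimes>\<^bsub>KK\<^esub> (l \<otimes>\<^bsub>KK\<^esub> \<kappa> a)"
    using monoid.m_assoc[OF group.is_monoid[OF group_KK]] mn \<kappa>_carrier[OF snoc.hyps(2)] by blast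
  ultimately show ?case by metis
qed

lemma path_value_arrow:
  assumes a: "a \<in> arr C"
  shows "path_value a (\<kappa> a)"
proof -
  have "path_value (ident C (src C a) \<cdot> a) (\<one>\<^bsub>KK\<^esub> \<otimes>\<^bsub>KK\<^esub> \<kappa> a)"
    by (rule snoc[OF nil]) (use a in simp_all)
  then show ?thesis
    using monoid.l_one[OF group.is_monoid[OF group_KK] \<kappa>_carrier[OF a]] a by (metis ident_comp(1))
qed

lemma KK_mult_one:
  assumes "i \<in> J" "k \<in> carrier KK" "l \<in> carrier KK"
  shows "k i = \<one>\<^bsub>Fam i\<^esub> \<Longrightarrow> (k \<otimes>\<^bsub>KK\<^esub> l) i = l i" "l i = \<one>\<^bsub>Fam i\<^esub> \<Longrightarrow> (k \<otimes>\<^bsub>KK\<^esub> l) i = k i"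
proof -
  interpret F: group "Fam i" by (rule gpv_group[OF Fam[OF assms(1)]])
  have "k i \<in> carrier (Fam i)" "l i \<in> carrier (Fam i)"
    using assms PiE_mem[of _ J "\<lambda>i. carrier (Fam i)" i] unfolding carrier_KK by blast+
  then show "k i = \<one>\<^bsub>Fam i\<^esub> \<Longrightarrow> (k \<otimes>\<^bsub>KK\<^esub> l) i = l i" "l i = \<one>\<^bsub>Fam i\<^esub> \<Longrightarrow> (k \<otimes>\<^bsub>KK\<^esub> l) i = k i"
    unfolding KK_mult[OF assms(1)] by simp_all
qed

lemma KK_mult3:
  assumes "i \<in> J" "f \<in> carrier KK" "g \<in> carrier KK" "l \<in> carrier KK"
    and "f i = \<one>\<^bsub>Fam i\<^esub>" "l i = \<one>\<^bsub>Fam i\<^esub>"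
  shows "(f \<otimes>\<^bsub>KK\<^esub> g \<otimes>\<^bsub>KK\<^esub> l) i = g i"
proof -
  have "f \<otimes>\<^bsub>KK\<^esub> g \<in> carrier KK" by (rule monoid.m_closed[OF group.is_monoid[OF group_KK] assms(2,3)])
  then have "(f \<otimes>\<^bsub>KK\<^esub> g \<otimes>\<^bsub>KK\<^esub> l) i = (f \<otimes>\<^bsub>KK\<^esub> g) i" by (rule KK_mult_one(2)[OF assms(1) _ assms(4,6)])
  also have "\<dots> = g i" by (rule KK_mult_one(1)[OF assms(1,2,3,5)])
  finally show ?thesis .
qed

lemma J_simps [simp]: "Inl a \<in> J \<longleftrightarrow> a \<in> arr C" "Inr x \<in> J \<longleftrightarrow> x \<in> obj C"
  unfolding J_def by auto

text \<open>A coordinate that is not trivial on a path tells where the path has been.\<close>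

lemma support_trans:
  assumes "path_value m k" "a \<in> arr C" "k (Inl a) \<noteq> \<one>\<^bsub>K0\<^esub>"
  shows "trans_arr a \<and> reach (src C m) (src C a) \<and> reach (tgt C a) (tgt C m)"
  using assms
proof (induction rule: path_value.induct)
  case (nil x)
  then show ?case by (simp add: KK_one Fam_def)
next
  case (snoc m k b)
  note mk = path_value_arr[OF snoc.hyps(1)]
  have "k (Inl a) \<noteq> \<one>\<^bsub>K0\<^esub> \<or> \<kappa> b (Inl a) \<noteq> \<one>\<^bsub>K0\<^esub>"
    using snoc.prems KK_mult_one(1)[of "Inl a" k "\<kappa> b"] mk \<kappa>_carrier[OF snoc.hyps(2)]
    by (auto simp: Fam_def)
  then show ?case
  proof
    assume "k (Inl a) \<noteq> \<one>\<^bsub>K0\<^esub>"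
    then have "trans_arr a \<and> reach (src C m) (src C a) \<and> reach (tgt C a) (tgt C m)" by (rule snoc.IH[OF snoc.prems(1)])
    then show ?thesis using mk snoc.hyps reach_arr[OF snoc.hyps(2)] reach_trans by simp blast
  next
    assume "\<kappa> b (Inl a) \<noteq> \<one>\<^bsub>K0\<^esub>"
    then have "a = b" "trans_arr a" using snoc.prems(1) unfolding \<kappa>_def by (auto split: if_splits)
    then show ?thesis using mk snoc.hyps reach_arr[of m] reach_refl[of "tgt C b"] by simp
  qed
qed

lemma support_base:
  assumes "path_value m k" "x \<in> obj C" "k (Inr x) \<noteq> \<one>\<^bsub>G x\<^esub>"
  shows "\<exists>y\<in>obj C. x = base y \<and> reach (src C m) y \<and> reach y (tgt C m)"
  using assms
proof (induction rule: path_value.induct)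
  case (nil x)
  then show ?case by (simp add: KK_one Fam_def)
next
  case (snoc m k b)
  note mk = path_value_arr[OF snoc.hyps(1)]
  have "k (Inr x) \<noteq> \<one>\<^bsub>G x\<^esub> \<or> \<kappa> b (Inr x) \<noteq> \<one>\<^bsub>G x\<^esub>"
    using snoc.prems KK_mult_one(1)[of "Inr x" k "\<kappa> b"] mk \<kappa>_carrier[OF snoc.hyps(2)]
    by (auto simp: Fam_def)
  then show ?case
  proof
    assume "k (Inr x) \<noteq> \<one>\<^bsub>G x\<^esub>"
    then obtain y where "y \<in> obj C" "x = base y" "reach (src C m) y" "reach y (tgt C m)"
      using snoc.IH[OF snoc.prems(1)] by blast
    then show ?thesis using mk snoc.hyps reach_arr[OF snoc.hyps(2)] reach_trans by (intro bexI[of _ y]) simp_all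
  next
    assume "\<kappa> b (Inr x) \<noteq> \<one>\<^bsub>G x\<^esub>"
    then have "x = base (src C b)" using snoc.prems(1) unfolding \<kappa>_def by (auto split: if_splits)
    then show ?thesis using mk snoc.hyps reach_arr[of m] reach_arr[of b] by (intro bexI[of _ "src C b"]) simp_all
  qed
qed

text \<open>Steps from \<open>x\<close> to \<open>y\<close> inside a component are transported to the base point with the
  connecting arrows, which cancel modulo \<open>Q\<close> only. As \<open>\<phi>\<close> need not be constant on classes of
  \<open>Q\<close>, the coordinate of the path is not the value of \<open>\<phi>\<close> at the transported arrow itself,
  but at some arrow congruent to it.\<close>

lemma component_value:
  assumes "path_value m k" "reach (tgt C m) (src C m)"
  shows "\<exists>n\<in>carrier (local_monoid C (base (src C m))). k (Inr (base (src C m))) = \<phi> (base (src C m)) n \<and>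
    Q n (pp (src C m) \<cdot> m \<cdot> qq (tgt C m))"
  using assms
proof (induction rule: path_value.induct)
  case (nil x)
  note c = conn[OF nil(1)] base(3)[OF nil(1)]
  have "\<one>\<^bsub>KK\<^esub> (Inr (base x)) = \<phi> (base x) (ident C (base x))"
    using \<phi>_idem(1)[OF c(9), of "ident C (base x)"] c by (simp add: KK_one Fam_def)
  moreover have "Q (ident C (base x)) (pp x \<cdot> ident C x \<cdot> qq x)" using R_sym[OF c(7)] c nil by simp
  ultimately show ?case using c nil by (intro bexI[of _ "ident C (base x)"]) simp_all
next
  case (snoc m k a)
  note mk = path_value_arr[OF snoc.hyps(1)]
  let ?b = "base (src C m)"
  have st: "src C (m \<cdot> a) = src C m" "tgt C (m \<cdot> a) = tgt C a" using mk snoc.hyps by simp_all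
  have ret: "reach (tgt C a) (src C m)" using snoc.prems unfolding st .
  have ra: "reach (tgt C a) (src C a)" using ret reach_arr[of m] mk snoc.hyps reach_trans by metis
  have rm: "reach (tgt C m) (src C m)" using reach_arr[OF snoc.hyps(2)] ret snoc.hyps reach_trans by metis
  have ba: "base (src C a) = ?b" using conj_loop(2)[of m] mk rm snoc.hyps by metis
  obtain n where n: "n \<in> carrier (local_monoid C ?b)" "k (Inr ?b) = \<phi> ?b n" "Q n (pp (src C m) \<cdot> m \<cdot> qq (tgt C m))"
    using snoc.IH[OF rm] by blast
  define n' where "n' = pp (src C a) \<cdot> a \<cdot> qq (tgt C a)"
  have n': "n' \<in> carrier (local_monoid C ?b)"
    using conj_loop(1)[OF snoc.hyps(2) ra] unfolding n'_def ba .
  have bo: "?b \<in> obj C" using base(3) mk by simp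
  have "\<kappa> a (Inr ?b) = \<phi> ?b n'" using ra bo ba unfolding \<kappa>_def n'_def by simp
  then have "(k \<otimes>\<^bsub>KK\<^esub> \<kappa> a) (Inr ?b) = \<phi> ?b (n \<cdot> n')"
    using hom_mult[OF \<phi>[OF bo] n(1) n'] n(2) bo by (simp add: KK_mult Fam_def)
  moreover have "Q (n \<cdot> n') (pp (src C m) \<cdot> (m \<cdot> a) \<cdot> qq (tgt C a))"
  proof -
    note c = conn[of "src C m"] conn[of "tgt C m"] conn[of "tgt C a"]
    let ?p = "pp (src C m)" let ?q = "qq (tgt C m)" let ?p' = "pp (tgt C m)" let ?q' = "qq (tgt C a)"
    have bm: "base (tgt C m) = ?b" using ba snoc.hyps by simp
    have e: "n' = ?p' \<cdot> a \<cdot> ?q'" unfolding n'_def using snoc.hyps by simp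
    have "Q (n \<cdot> n') (?p \<cdot> m \<cdot> ?q \<cdot> n')" by (rule R_right[OF n(3)]) (use n n' in simp_all)
    also have "?p \<cdot> m \<cdot> ?q \<cdot> n' = (?p \<cdot> m) \<cdot> (?q \<cdot> ?p') \<cdot> (a \<cdot> ?q')"
      unfolding e using mk snoc.hyps c bm by (simp add: comp_assoc)
    finally have 1: "Q (n \<cdot> n') ((?p \<cdot> m) \<cdot> (?q \<cdot> ?p') \<cdot> (a \<cdot> ?q'))" .
    have "Q (?p \<cdot> m \<cdot> (?q \<cdot> ?p')) (?p \<cdot> m \<cdot> ident C (tgt C m))"
      by (rule R_left[OF c(16)]) (use mk c in simp_all)
    then have "Q (?p \<cdot> m \<cdot> (?q \<cdot> ?p') \<cdot> (a \<cdot> ?q')) (?p \<cdot> m \<cdot> ident C (tgt C m) \<cdot> (a \<cdot> ?q'))"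
      by (rule R_right) (use mk c snoc.hyps bm in simp_all)
    also have "?p \<cdot> m \<cdot> ident C (tgt C m) \<cdot> (a \<cdot> ?q') = ?p \<cdot> (m \<cdot> a) \<cdot> ?q'"
      using mk c snoc.hyps by (simp add: comp_assoc)
    finally show ?thesis using 1 R_trans by blast
  qed
  moreover have "n \<cdot> n' \<in> carrier (local_monoid C ?b)" using n n' by simp
  ultimately show ?case unfolding st by blast
qed

text \<open>A path inside a component is trivial in all coordinates but one, and that one determines
  the arrow modulo \<open>Q\<close>.\<close>

lemma component_unique:
  assumes g: "path_value g h" "path_value g' h'" "src C g = src C g'" "tgt C g = tgt C g'"
    and ret: "reach (tgt C g) (src C g)" and eq: "h (Inr (base (src C g))) = h' (Inr (base (src C g)))"
  shows "Q g g'" "h = h'"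
proof -
  let ?x = "src C g" and ?y = "tgt C g" let ?b = "base ?x"
  note ga = path_value_arr[OF g(1)] path_value_arr[OF g(2)]
  have bo: "?b \<in> obj C" using ga base(3) by simp
  obtain n where n: "n \<in> carrier (local_monoid C ?b)" "h (Inr ?b) = \<phi> ?b n" "Q n (pp ?x \<cdot> g \<cdot> qq ?y)"
    using component_value[OF g(1) ret] by blast
  obtain n' where n': "n' \<in> carrier (local_monoid C ?b)" "h' (Inr ?b) = \<phi> ?b n'" "Q n' (pp ?x \<cdot> g' \<cdot> qq ?y)"
    using component_value[OF g(2)] ret g(3,4) by metis
  have "Q n n'" using \<phi>Q[OF bo n(1) n'(1)] n(2) n'(2) eq by simp
  then have Qpq: "Q (pp ?x \<cdot> g \<cdot> qq ?y) (pp ?x \<cdot> g' \<cdot> qq ?y)" using n(3) n'(3) R_sym R_trans by metis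
  have *: "Q (qq ?x \<cdot> (pp ?x \<cdot> f \<cdot> qq ?y) \<cdot> pp ?y) f" if f: "f \<in> arr C" "src C f = ?x" "tgt C f = ?y" for f
  proof -
    note c = conn[of ?x] conn[of ?y]
    have "qq ?x \<cdot> (pp ?x \<cdot> f \<cdot> qq ?y) \<cdot> pp ?y = qq ?x \<cdot> pp ?x \<cdot> f \<cdot> (qq ?y \<cdot> pp ?y)"
      using f ga c by (simp add: comp_assoc)
    moreover have "Q (qq ?x \<cdot> pp ?x \<cdot> f) (ident C ?x \<cdot> f)" by (rule R_right[OF c(8)]) (use f ga c in simp_all)
    then have "Q (qq ?x \<cdot> pp ?x \<cdot> f \<cdot> (qq ?y \<cdot> pp ?y)) (ident C ?x \<cdot> f \<cdot> ident C ?y)"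
      by (rule R_comp) (use f ga c in simp_all)
    ultimately show ?thesis using f by simp
  qed
  have "Q (qq ?x \<cdot> (pp ?x \<cdot> g \<cdot> qq ?y)) (qq ?x \<cdot> (pp ?x \<cdot> g' \<cdot> qq ?y))"
    by (rule R_left[OF Qpq]) (use ga conn[of ?x] conn[of ?y] in simp_all)
  then have mid: "Q (qq ?x \<cdot> (pp ?x \<cdot> g \<cdot> qq ?y) \<cdot> pp ?y) (qq ?x \<cdot> (pp ?x \<cdot> g' \<cdot> qq ?y) \<cdot> pp ?y)"
    by (rule R_right) (use ga conn[of ?x] conn[of ?y] conj_loop(2)[of g] ret in simp_all)
  have "Q (qq ?x \<cdot> (pp ?x \<cdot> g \<cdot> qq ?y) \<cdot> pp ?y) g" by (rule *) (use ga in simp_all)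
  moreover have "Q (qq ?x \<cdot> (pp ?x \<cdot> g' \<cdot> qq ?y) \<cdot> pp ?y) g'" by (rule *) (use ga g(3,4) in simp_all)
  ultimately show "Q g g'" using mid R_sym R_trans by blast
  have triv: "k i = \<one>\<^bsub>Fam i\<^esub>" if k: "path_value f k" "src C f = ?x" "tgt C f = ?y" and i: "i \<in> J" "i \<noteq> Inr ?b" for f k i
  proof (cases i)
    case (Inl a)
    then have a: "a \<in> arr C" using i by simp
    have "k (Inl a) = \<one>\<^bsub>K0\<^esub>"
    proof (rule ccontr)
      assume "k (Inl a) \<noteq> \<one>\<^bsub>K0\<^esub>"
      from support_trans[OF k(1) a this]
      have "\<not> reach (tgt C a) (src C a)" "reach ?x (src C a)" "reach (tgt C a) ?y"
        unfolding trans_arr_def k(2,3) by blast+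
      then show False using ret reach_trans by blast
    qed
    then show ?thesis using Inl by (simp add: Fam_def)
  next
    case (Inr x)
    then have x: "x \<in> obj C" using i by simp
    show ?thesis
    proof (rule ccontr)
      assume "k i \<noteq> \<one>\<^bsub>Fam i\<^esub>"
      then obtain y where y: "x = base y" "reach ?x y" "reach y ?y"
        using support_base[OF k(1) x] k(2,3) Inr unfolding Fam_def by auto
      then have "base y = ?b" using ret reach_trans base_eq by blast
      then show False using i(2) Inr y by simp
    qed
  qed
  show "h = h'"
  proof (rule PiE_ext)
    show "h \<in> (\<Pi>\<^sub>E i\<in>J. carrier (Fam i))" "h' \<in> (\<Pi>\<^sub>E i\<in>J. carrier (Fam i))"
      using ga unfolding carrier_KK by blast+
    fix i assume "i \<in> J"
    then show "h i = h' i"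
      using triv[OF g(1)] triv[OF g(2)] g(3,4) eq by (cases "i = Inr ?b") simp_all
  qed
qed

lemma path_value_split:
  assumes "path_value m k"
  shows "reach (tgt C m) (src C m) \<or> (\<exists>m0 k0 a g h. path_value m0 k0 \<and> trans_arr a \<and> tgt C m0 = src C a \<and>
    path_value g h \<and> src C g = tgt C a \<and> tgt C g = tgt C m \<and> reach (tgt C g) (src C g) \<and>
    m = m0 \<cdot> a \<cdot> g \<and> k = k0 \<otimes>\<^bsub>KK\<^esub> \<kappa> a \<otimes>\<^bsub>KK\<^esub> h)"
  using assms
proof (induction rule: path_value.induct)
  case (nil x)
  then show ?case using reach_refl by simp
next
  case (snoc m k b)
  interpret KK: group KK by (rule group_KK)
  note mk = path_value_arr[OF snoc.hyps(1)]
  show ?case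
  proof (cases "reach (tgt C b) (src C b)")
    case False
    have id: "path_value (ident C (tgt C b)) \<one>\<^bsub>KK\<^esub>" using nil snoc.hyps by simp
    have "m \<cdot> b = m \<cdot> b \<cdot> ident C (tgt C b)" using mk snoc.hyps by simp
    moreover have "k \<otimes>\<^bsub>KK\<^esub> \<kappa> b = k \<otimes>\<^bsub>KK\<^esub> \<kappa> b \<otimes>\<^bsub>KK\<^esub> \<one>\<^bsub>KK\<^esub>"
      using KK.r_one[OF KK.m_closed[OF conjunct2[OF mk] \<kappa>_carrier[OF snoc.hyps(2)]]] by metis
    moreover have "trans_arr b" using False snoc.hyps unfolding trans_arr_def by blast
    moreover have "src C (ident C (tgt C b)) = tgt C b" "tgt C (ident C (tgt C b)) = tgt C (m \<cdot> b)"
      "reach (tgt C (ident C (tgt C b))) (src C (ident C (tgt C b)))"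
      using mk snoc.hyps reach_refl[of "tgt C b"] by simp_all
    ultimately show ?thesis using snoc.hyps(1,3) id by blast
  next
    case True
    from snoc.IH show ?thesis
    proof
      assume "reach (tgt C m) (src C m)"
      then have "reach (tgt C (m \<cdot> b)) (src C (m \<cdot> b))" using True mk snoc.hyps reach_trans by simp
      then show ?thesis by blast
    next
      assume "\<exists>m0 k0 a g h. path_value m0 k0 \<and> trans_arr a \<and> tgt C m0 = src C a \<and>
        path_value g h \<and> src C g = tgt C a \<and> tgt C g = tgt C m \<and> reach (tgt C g) (src C g) \<and>
        m = m0 \<cdot> a \<cdot> g \<and> k = k0 \<otimes>\<^bsub>KK\<^esub> \<kappa> a \<otimes>\<^bsub>KK\<^esub> h"
      then obtain m0 k0 a g h where s: "path_value m0 k0" "trans_arr a" "tgt C m0 = src C a"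
        "path_value g h" "src C g = tgt C a" "tgt C g = tgt C m" "reach (tgt C g) (src C g)"
        "m = m0 \<cdot> a \<cdot> g" "k = k0 \<otimes>\<^bsub>KK\<^esub> \<kappa> a \<otimes>\<^bsub>KK\<^esub> h" by blast
      note a = path_value_arr[OF s(1)] path_value_arr[OF s(4)] s(2)[unfolded trans_arr_def]
      have gb: "path_value (g \<cdot> b) (h \<otimes>\<^bsub>KK\<^esub> \<kappa> b)" by (rule path_value.snoc[OF s(4)]) (use snoc.hyps s in simp_all)
      have ends: "src C (g \<cdot> b) = tgt C a" "tgt C (g \<cdot> b) = tgt C (m \<cdot> b)"
        using a s(5,6) mk snoc.hyps by simp_all
      have ret: "reach (tgt C (g \<cdot> b)) (src C (g \<cdot> b))"
        using True s(6,7) a snoc.hyps reach_trans by simp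
      have "m \<cdot> b = m0 \<cdot> a \<cdot> (g \<cdot> b)" using a s(3,5,6,8) snoc.hyps by (simp add: comp_assoc)
      moreover have "k \<otimes>\<^bsub>KK\<^esub> \<kappa> b = k0 \<otimes>\<^bsub>KK\<^esub> \<kappa> a \<otimes>\<^bsub>KK\<^esub> (h \<otimes>\<^bsub>KK\<^esub> \<kappa> b)"
        unfolding s(9)
        by (rule KK.m_assoc[OF KK.m_closed[OF _ \<kappa>_carrier] _ \<kappa>_carrier[OF snoc.hyps(2)]]) (use a in blast)+
      ultimately show ?thesis
        using s(1-3) gb ends ret
        by (intro disjI2 exI[of _ m0] exI[of _ k0] exI[of _ a] exI[of _ "g \<cdot> b"] exI[of _ "h \<otimes>\<^bsub>KK\<^esub> \<kappa> b"] conjI)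
    qed
  qed
qed

text \<open>An arrow is recovered modulo \<open>Q\<close> from the value of a path: the last arrow of the path that
  leaves a strongly connected component is determined by its coordinate, the part of the
  path after it by the coordinate of the last component, and the part before it by
  induction.\<close>

lemma path_value_unique:
  assumes "path_value m k" "path_value m' k" "src C m = src C m'" "tgt C m = tgt C m'"
  shows "Q m m'"
  using assms
proof (induction "card {x \<in> obj C. reach x (tgt C m)}" arbitrary: m m' k rule: less_induct)
  case less
  interpret KK: group KK by (rule group_KK)
  let ?y = "tgt C m"
  show ?case
  proof (cases "reach (tgt C m) (src C m)")
    case True
    then show ?thesis using component_unique(1)[OF less.prems(1,2)] less.prems by blast
  next
    case False
    obtain m0 k0 a g h where s: "path_value m0 k0" "trans_arr a" "tgt C m0 = src C a"
      "path_value g h" "src C g = tgt C a" "tgt C g = ?y" "reach (tgt C g) (src C g)"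
      "m = m0 \<cdot> a \<cdot> g" "k = k0 \<otimes>\<^bsub>KK\<^esub> \<kappa> a \<otimes>\<^bsub>KK\<^esub> h"
      using path_value_split[OF less.prems(1)] False by blast
    obtain m0' k0' a' g' h' where s': "path_value m0' k0'" "trans_arr a'" "tgt C m0' = src C a'"
      "path_value g' h'" "src C g' = tgt C a'" "tgt C g' = ?y" "reach (tgt C g') (src C g')"
      "m' = m0' \<cdot> a' \<cdot> g'" "k = k0' \<otimes>\<^bsub>KK\<^esub> \<kappa> a' \<otimes>\<^bsub>KK\<^esub> h'"
      using path_value_split[OF less.prems(2)] False less.prems(3,4) by metis
    note c = path_value_arr[OF s(1)] path_value_arr[OF s(4)] and c' = path_value_arr[OF s'(1)] path_value_arr[OF s'(4)]
    have ta: "a \<in> arr C" "\<not> reach (tgt C a) (src C a)" and ta': "a' \<in> arr C" "\<not> reach (tgt C a') (src C a')"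
      using s(2) s'(2) unfolding trans_arr_def by blast+
    have r: "reach (tgt C a) ?y" "reach ?y (tgt C a)" "reach (tgt C a') ?y" "reach ?y (tgt C a')"
      using s(5-7) s'(5-7) reach_arr[of g] reach_arr[of g'] c c' by metis+
    have rs: "reach (src C a) ?y" using reach_trans[OF reach_arr[OF ta(1)] r(1)] .
    have kk: "k0 \<otimes>\<^bsub>KK\<^esub> \<kappa> a \<in> carrier KK" "k0' \<otimes>\<^bsub>KK\<^esub> \<kappa> a' \<in> carrier KK"
      using KK.m_closed c c' \<kappa>_carrier ta ta' by blast+
    have Fl: "Fam (Inl b) = K0" and Fr: "Fam (Inr x) = G x" for b x unfolding Fam_def by simp_all
    have "k (Inl a) = z"
    proof -
      have "k0 (Inl a) = \<one>\<^bsub>K0\<^esub>" using support_trans[OF s(1) ta(1)] ta(2) s(3) by metis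
      moreover have "h (Inl a) = \<one>\<^bsub>K0\<^esub>" using support_trans[OF s(4) ta(1)] ta(2) s(5) by metis
      moreover have "\<kappa> a (Inl a) = z" using ta(1) s(2) unfolding \<kappa>_def by simp
      moreover have "Inl a \<in> J" using ta(1) by simp
      ultimately show ?thesis
        using KK_mult3[of "Inl a" k0 "\<kappa> a" h] c \<kappa>_carrier[OF ta(1)] unfolding s(9) Fl by simp
    qed
    have aa: "a' = a"
    proof (rule ccontr)
      assume ne: "a' \<noteq> a"
      have "k0' (Inl a) = \<one>\<^bsub>K0\<^esub>"
      proof (rule ccontr)
        assume "k0' (Inl a) \<noteq> \<one>\<^bsub>K0\<^esub>"
        then have "reach (tgt C a) (src C a')" using support_trans[OF s'(1) ta(1)] s'(3) by metis
        then show False using ta'(2) r reach_trans by blast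
      qed
      moreover have "h' (Inl a) = \<one>\<^bsub>K0\<^esub>"
      proof (rule ccontr)
        assume "h' (Inl a) \<noteq> \<one>\<^bsub>K0\<^esub>"
        then have "reach (tgt C a') (src C a)" using support_trans[OF s'(4) ta(1)] s'(5) by metis
        then show False using ta(2) r reach_trans by blast
      qed
      moreover have "\<kappa> a' (Inl a) = \<one>\<^bsub>K0\<^esub>" using ta(1) ne unfolding \<kappa>_def by simp
      moreover have "Inl a \<in> J" using ta(1) by simp
      ultimately have "k (Inl a) = \<one>\<^bsub>K0\<^esub>"
        using KK_mult3[of "Inl a" k0' "\<kappa> a'" h'] c' \<kappa>_carrier[OF ta'(1)] unfolding s'(9) Fl by simp
      then show False using \<open>k (Inl a) = z\<close> z(2) by simp
    qed
    let ?b = "base (src C g)"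
    have yo: "?y \<in> obj C" "src C g \<in> obj C" using path_value_arr[OF less.prems(1)] c by simp_all
    have bo: "?b \<in> obj C" by (rule base(3)[OF yo(2)])
    have \<kappa>b: "\<kappa> a (Inr ?b) = \<one>\<^bsub>G ?b\<^esub>" using ta(2) bo unfolding \<kappa>_def by simp
    have k0b: "f (Inr ?b) = \<one>\<^bsub>G ?b\<^esub>" if f: "path_value n f" "tgt C n = src C a" for n f
    proof (rule ccontr)
      assume "f (Inr ?b) \<noteq> \<one>\<^bsub>G ?b\<^esub>"
      then obtain x where x: "x \<in> obj C" "?b = base x" "reach x (src C a)"
        using support_base[OF f(1) bo] f(2) by metis
      have "reach (tgt C a) (base x)" using base(1)[OF yo(2)] s(5) x(2) by metis
      then have "reach (tgt C a) x" using base(2)[OF x(1)] reach_trans by blast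
      then show False using ta(2) x(3) reach_trans by blast
    qed
    have last: "(f \<otimes>\<^bsub>KK\<^esub> \<kappa> a \<otimes>\<^bsub>KK\<^esub> l) (Inr ?b) = l (Inr ?b)"
      if f: "path_value n f" "tgt C n = src C a" and l: "l \<in> carrier KK" for n f l
    proof -
      have fc: "f \<in> carrier KK" using path_value_arr[OF f(1)] by blast
      have bJ: "Inr ?b \<in> J" using bo by simp
      have "(f \<otimes>\<^bsub>KK\<^esub> \<kappa> a) (Inr ?b) = \<kappa> a (Inr ?b)"
        by (rule KK_mult_one(1)[OF bJ fc \<kappa>_carrier[OF ta(1)]]) (simp add: Fr k0b[OF f])
      then have "(f \<otimes>\<^bsub>KK\<^esub> \<kappa> a) (Inr ?b) = \<one>\<^bsub>Fam (Inr ?b)\<^esub>" by (simp add: Fr \<kappa>b)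
      then show ?thesis
        by (rule KK_mult_one(1)[OF bJ KK.m_closed[OF fc \<kappa>_carrier[OF ta(1)]] l])
    qed
    have gg: "src C g = src C g'" "tgt C g = tgt C g'" using s(5,6) s'(5,6) aa by simp_all
    have "h (Inr ?b) = h' (Inr ?b)"
      using last[OF s(1,3), of h] last[OF s'(1), of h'] s'(3) s(9) s'(9) c c' unfolding aa by simp
    note u = component_unique[OF s(4) s'(4) gg s(7) this]
    have "k0 \<otimes>\<^bsub>KK\<^esub> \<kappa> a = k0' \<otimes>\<^bsub>KK\<^esub> \<kappa> a"
    proof (rule KK.right_cancel[THEN iffD1])
      show "h \<in> carrier KK" "k0 \<otimes>\<^bsub>KK\<^esub> \<kappa> a \<in> carrier KK" "k0' \<otimes>\<^bsub>KK\<^esub> \<kappa> a \<in> carrier KK"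
        using kk c aa by simp_all
      show "k0 \<otimes>\<^bsub>KK\<^esub> \<kappa> a \<otimes>\<^bsub>KK\<^esub> h = k0' \<otimes>\<^bsub>KK\<^esub> \<kappa> a \<otimes>\<^bsub>KK\<^esub> h"
        using s(9) s'(9) u(2) aa by metis
    qed
    then have k0: "k0 = k0'"
      by (rule KK.right_cancel[THEN iffD1, rotated -1]) (use c c' \<kappa>_carrier[OF ta(1)] in blast)+
    have "Q m0 m0'"
    proof (rule less.hyps)
      have "{x \<in> obj C. reach x (tgt C m0)} \<subset> {x \<in> obj C. reach x ?y}"
      proof
        show "{x \<in> obj C. reach x (tgt C m0)} \<subseteq> {x \<in> obj C. reach x ?y}"
          using rs reach_trans unfolding s(3) by blast
        have "\<not> reach ?y (src C a)" using ta(2) r(1) reach_trans by blast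
        then show "{x \<in> obj C. reach x (tgt C m0)} \<noteq> {x \<in> obj C. reach x ?y}"
          using yo(1) reach_refl[OF yo(1)] unfolding s(3) by blast
      qed
      then show "card {x \<in> obj C. reach x (tgt C m0)} < card {x \<in> obj C. reach x ?y}"
        using fin_obj by (intro psubset_card_mono) simp_all
      show "path_value m0 k0" by (rule s(1))
      show "path_value m0' k0" using s'(1) k0 by simp
      show "src C m0 = src C m0'" using less.prems(3) s(8) s'(8) c c' s(3,5) s'(3,5) ta(1) ta'(1) by simp
      show "tgt C m0 = tgt C m0'" using s(3) s'(3) aa by simp
    qed
    then have "Q (m0 \<cdot> a) (m0' \<cdot> a)" by (rule R_right) (use ta s in simp_all)
    then have "Q (m0 \<cdot> a \<cdot> g) (m0' \<cdot> a \<cdot> g')" using u(1) by (rule R_comp) (use s ta c in simp)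
    then show ?thesis unfolding s(8) s'(8) aa .
  qed
qed

lemma rel_morph_KK: "rel_morph C KK (\<lambda>m. Collect (path_value m)) Q"
  unfolding rel_morph_def
proof (intro conjI ballI impI)
  fix m assume m: "m \<in> arr C"
  show "Collect (path_value m) \<noteq> {}" using path_value_arrow[OF m] by blast
  show "Collect (path_value m) \<subseteq> carrier KK" using path_value_arr by blast
next
  fix c assume "c \<in> obj C"
  then show "\<one>\<^bsub>KK\<^esub> \<in> Collect (path_value (ident C c))" using nil by blast
next
  fix m n x y assume "tgt C m = src C n" "x \<in> Collect (path_value m)" "y \<in> Collect (path_value n)"
  then show "x \<otimes>\<^bsub>KK\<^esub> y \<in> Collect (path_value (m \<cdot> n))" using path_value_comp by blast
next
  fix m m' assume "src C m = src C m'" "tgt C m = tgt C m'" "Collect (path_value m) \<inter> Collect (path_value m') \<noteq> {}"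
  then show "Q m m'" using path_value_unique by blast
qed

end

section \<open>Minimal congruences\<close>

context fin_cat
begin

text \<open>The equivalences of this preorder and of the next two are Green's relations \<open>J\<close>, \<open>R\<close> and \<open>L\<close>.\<close>

definition leJ :: "'m \<Rightarrow> 'm \<Rightarrow> bool" where
  "leJ p x \<longleftrightarrow> (\<exists>u\<in>arr C. \<exists>v\<in>arr C. tgt C u = src C x \<and> src C v = tgt C x \<and> p = u \<cdot> (x \<cdot> v))"

definition leR :: "'m \<Rightarrow> 'm \<Rightarrow> bool" where
  "leR p x \<longleftrightarrow> (\<exists>v\<in>arr C. src C v = tgt C x \<and> p = x \<cdot> v)"

definition leL :: "'m \<Rightarrow> 'm \<Rightarrow> bool" where
  "leL p x \<longleftrightarrow> (\<exists>u\<in>arr C. tgt C u = src C x \<and> p = u \<cdot> x)"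

lemma leR_refl: "x \<in> arr C \<Longrightarrow> leR x x"
  unfolding leR_def by (rule bexI[of _ "ident C (tgt C x)"]) simp_all

lemma leL_refl: "x \<in> arr C \<Longrightarrow> leL x x"
  unfolding leL_def by (rule bexI[of _ "ident C (src C x)"]) simp_all

lemma leR_trans:
  assumes x: "x \<in> arr C" and "leR p y" "leR y x"
  shows "leR p x"
proof -
  obtain v w where v: "v \<in> arr C" "src C v = tgt C x" "y = x \<cdot> v" and w: "w \<in> arr C" "src C w = tgt C y" "p = y \<cdot> w"
    using assms unfolding leR_def by blast
  then have "p = x \<cdot> (v \<cdot> w)" "v \<cdot> w \<in> arr C" "src C (v \<cdot> w) = tgt C x" using x by (simp_all add: comp_assoc)
  then show ?thesis unfolding leR_def by blast
qed

lemma leL_trans: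
  assumes x: "x \<in> arr C" and "leL p y" "leL y x"
  shows "leL p x"
proof -
  obtain v w where v: "v \<in> arr C" "tgt C v = src C x" "y = v \<cdot> x" and w: "w \<in> arr C" "tgt C w = src C y" "p = w \<cdot> y"
    using assms unfolding leL_def by blast
  then have "p = w \<cdot> v \<cdot> x" "w \<cdot> v \<in> arr C" "tgt C (w \<cdot> v) = src C x" using x by (simp_all add: comp_assoc)
  then show ?thesis unfolding leL_def by blast
qed

lemma leJ_trans:
  assumes x: "x \<in> arr C" and "leJ p y" "leJ y x"
  shows "leJ p x"
proof -
  obtain u v where u: "u \<in> arr C" "v \<in> arr C" "tgt C u = src C x" "src C v = tgt C x" "y = u \<cdot> (x \<cdot> v)"
    using assms(3) unfolding leJ_def by blast
  obtain u' v' where u': "u' \<in> arr C" "v' \<in> arr C" "tgt C u' = src C y" "src C v' = tgt C y" "p = u' \<cdot> (y \<cdot> v')"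
    using assms(2) unfolding leJ_def by blast
  have "tgt C u' = src C u" "src C v' = tgt C v" using u u' x by simp_all
  then have "p = (u' \<cdot> u) \<cdot> (x \<cdot> (v \<cdot> v'))" "u' \<cdot> u \<in> arr C" "v \<cdot> v' \<in> arr C" "tgt C (u' \<cdot> u) = src C x" "src C (v \<cdot> v') = tgt C x"
    using u u' x by (simp_all add: comp_assoc)
  then show ?thesis unfolding leJ_def by blast
qed

lemma leR_imp_leJ: "x \<in> arr C \<Longrightarrow> leR p x \<Longrightarrow> leJ p x"
  unfolding leR_def leJ_def
proof (elim bexE conjE)
  fix v assume "x \<in> arr C" "v \<in> arr C" "src C v = tgt C x" "p = x \<cdot> v"
  then show "\<exists>u\<in>arr C. \<exists>v\<in>arr C. tgt C u = src C x \<and> src C v = tgt C x \<and> p = u \<cdot> (x \<cdot> v)"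
    by (intro bexI[of _ "ident C (src C x)"] bexI[of _ v]) simp_all
qed

lemma leL_imp_leJ: "x \<in> arr C \<Longrightarrow> leL p x \<Longrightarrow> leJ p x"
  unfolding leL_def leJ_def
proof (elim bexE conjE)
  fix u assume "x \<in> arr C" "u \<in> arr C" "tgt C u = src C x" "p = u \<cdot> x"
  then show "\<exists>u\<in>arr C. \<exists>v\<in>arr C. tgt C u = src C x \<and> src C v = tgt C x \<and> p = u \<cdot> (x \<cdot> v)"
    by (intro bexI[of _ u] bexI[of _ "ident C (tgt C x)"]) simp_all
qed

lemma comp_leR: "p \<in> arr C \<Longrightarrow> q \<in> arr C \<Longrightarrow> tgt C p = src C q \<Longrightarrow> leR (p \<cdot> q) p"
  unfolding leR_def by auto

lemma comp_leL: "p \<in> arr C \<Longrightarrow> q \<in> arr C \<Longrightarrow> tgt C p = src C q \<Longrightarrow> leL (p \<cdot> q) q"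
  unfolding leL_def by auto

lemma semigroup_local: "finite_semigroup_on (carrier (local_monoid C c)) (ccomp C)"
  by standard (auto simp: finite_local_monoid comp_assoc)

text \<open>Stability, as in finite semigroups: from \<open>p = u p (q v)\<close> follows \<open>p = u\<^sup>n p (q v)\<^sup>n\<close> for
  all \<open>n\<close>, hence \<open>p = p (q v)\<^sup>n\<close> when the power of \<open>q v\<close> is idempotent.\<close>

lemma stable_right:
  assumes pq: "p \<in> arr C" "q \<in> arr C" "tgt C p = src C q" and le: "leJ p (p \<cdot> q)"
  shows "leR p (p \<cdot> q)"
proof -
  obtain u v where uv0: "u \<in> arr C" "v \<in> arr C" "tgt C u = src C (p \<cdot> q)" "src C v = tgt C (p \<cdot> q)"
    and p: "p = u \<cdot> (p \<cdot> q \<cdot> v)"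
    using le unfolding leJ_def by blast
  have uv: "u \<in> arr C" "v \<in> arr C" "tgt C u = src C p" "src C v = tgt C q" using uv0 pq by simp_all
  have p: "p = u \<cdot> (p \<cdot> (q \<cdot> v))" using p comp_assoc[OF pq(1,2) uv(2) pq(3) uv(4)[symmetric]] by metis
  have "src C (u \<cdot> (p \<cdot> (q \<cdot> v))) = src C u" "tgt C (u \<cdot> (p \<cdot> (q \<cdot> v))) = tgt C v" using uv pq by simp_all
  then have ends: "src C u = src C p" "tgt C v = tgt C p" unfolding p[symmetric] by simp_all
  let ?s = "q \<cdot> v"
  have s: "?s \<in> carrier (local_monoid C (tgt C p))" using pq uv ends by simp
  interpret S: finite_semigroup_on "carrier (local_monoid C (tgt C p))" "ccomp C" by (rule semigroup_local)
  have sp: "spower (ccomp C) ?s n \<in> arr C" "src C (spower (ccomp C) ?s n) = tgt C p" "tgt C (spower (ccomp C) ?s n) = tgt C p" for n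
    using S.spower_in[OF s, of n] by simp_all
  have "\<exists>w\<in>arr C. src C w = src C p \<and> tgt C w = src C p \<and> p = w \<cdot> (p \<cdot> spower (ccomp C) ?s n)" for n
  proof (induction n)
    case 0
    show ?case using uv ends p by (intro bexI[of _ u] conjI) simp_all
  next
    case (Suc n)
    then obtain w where w: "w \<in> arr C" "src C w = src C p" "tgt C w = src C p" "p = w \<cdot> (p \<cdot> spower (ccomp C) ?s n)" by blast
    have "p \<cdot> spower (ccomp C) ?s n = u \<cdot> (p \<cdot> ?s) \<cdot> spower (ccomp C) ?s n"
      by (rule arg_cong[OF p])
    also have "\<dots> = u \<cdot> (p \<cdot> (?s \<cdot> spower (ccomp C) ?s n))" using pq uv(1-4) ends sp by (simp add: comp_assoc)
    finally have "w \<cdot> (p \<cdot> spower (ccomp C) ?s n) = (w \<cdot> u) \<cdot> (p \<cdot> spower (ccomp C) ?s (Suc n))"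
      using pq uv(1-4) ends sp[of n] w(1-3) by (simp add: comp_assoc)
    then have "p = (w \<cdot> u) \<cdot> (p \<cdot> spower (ccomp C) ?s (Suc n))" using w(4) by metis
    then show ?case using w(1-3) uv(1-4) ends pq by (intro bexI[of _ "w \<cdot> u"] conjI) simp_all
  qed note P = this
  obtain n where n: "spower (ccomp C) ?s n \<cdot> spower (ccomp C) ?s n = spower (ccomp C) ?s n"
    by (rule S.idempotent_spower[OF s])
  let ?e = "spower (ccomp C) ?s n"
  obtain w where w: "w \<in> arr C" "src C w = src C p" "tgt C w = src C p" "p = w \<cdot> (p \<cdot> ?e)" using P[of n] by blast
  have "p \<cdot> ?e = w \<cdot> (p \<cdot> ?e) \<cdot> ?e" using w(4) by metis
  also have "\<dots> = w \<cdot> (p \<cdot> (?e \<cdot> ?e))" using w(1-3) pq sp by (simp add: comp_assoc)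
  finally have pe: "p \<cdot> ?e = p" using n w(4) by metis
  have ee: "?e = ?s \<cdot> spower (ccomp C) ?s (n + n)" using n S.spower_add[OF s, of n n] by simp
  let ?y = "spower (ccomp C) ?s (n + n)"
  have "p = p \<cdot> (?s \<cdot> ?y)" using pe ee by metis
  also have "\<dots> = p \<cdot> q \<cdot> (v \<cdot> ?y)" using pq uv(1-4) ends sp by (simp add: comp_assoc)
  finally have "p = p \<cdot> q \<cdot> (v \<cdot> ?y)" .
  then show ?thesis unfolding leR_def using pq uv(1-4) ends sp by (intro bexI[of _ "v \<cdot> ?y"]) simp_all
qed

lemma stable_left:
  assumes pq: "p \<in> arr C" "q \<in> arr C" "tgt C p = src C q" and le: "leJ q (p \<cdot> q)"
  shows "leL q (p \<cdot> q)"
proof -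
  obtain u v where uv0: "u \<in> arr C" "v \<in> arr C" "tgt C u = src C (p \<cdot> q)" "src C v = tgt C (p \<cdot> q)"
    and q: "q = u \<cdot> (p \<cdot> q \<cdot> v)"
    using le unfolding leJ_def by blast
  have uv: "u \<in> arr C" "v \<in> arr C" "tgt C u = src C p" "src C v = tgt C q" using uv0 pq by simp_all
  have "u \<cdot> (p \<cdot> q \<cdot> v) = u \<cdot> p \<cdot> q \<cdot> v" using uv pq by (simp add: comp_assoc)
  then have q: "q = u \<cdot> p \<cdot> q \<cdot> v" using q by metis
  have "src C (u \<cdot> p \<cdot> q \<cdot> v) = src C u" "tgt C (u \<cdot> p \<cdot> q \<cdot> v) = tgt C v" using uv pq by simp_all
  then have ends: "src C u = src C q" "tgt C v = tgt C q" unfolding q[symmetric] by simp_all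
  let ?s = "u \<cdot> p"
  have s: "?s \<in> carrier (local_monoid C (src C q))" using pq uv ends by simp
  interpret S: finite_semigroup_on "carrier (local_monoid C (src C q))" "ccomp C" by (rule semigroup_local)
  have sp: "spower (ccomp C) ?s n \<in> arr C" "src C (spower (ccomp C) ?s n) = src C q" "tgt C (spower (ccomp C) ?s n) = src C q" for n
    using S.spower_in[OF s, of n] by simp_all
  have "\<exists>w\<in>arr C. src C w = tgt C q \<and> tgt C w = tgt C q \<and> q = spower (ccomp C) ?s n \<cdot> q \<cdot> w" for n
  proof (induction n)
    case 0
    show ?case using uv ends q by (intro bexI[of _ v] conjI) simp_all
  next
    case (Suc n)
    then obtain w where w: "w \<in> arr C" "src C w = tgt C q" "tgt C w = tgt C q" "q = spower (ccomp C) ?s n \<cdot> q \<cdot> w" by blast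
    have "q = ?s \<cdot> (spower (ccomp C) ?s n \<cdot> q \<cdot> w) \<cdot> v" using q w(4) by metis
    also have "\<dots> = spower (ccomp C) ?s (Suc n) \<cdot> q \<cdot> (w \<cdot> v)"
      using pq uv(1-4) ends sp[of n] w(1-3) by (simp add: comp_assoc)
    finally show ?case using w(1-3) uv(1-4) ends pq by (intro bexI[of _ "w \<cdot> v"] conjI) simp_all
  qed note P = this
  obtain n where n: "spower (ccomp C) ?s n \<cdot> spower (ccomp C) ?s n = spower (ccomp C) ?s n"
    by (rule S.idempotent_spower[OF s])
  let ?e = "spower (ccomp C) ?s n"
  obtain w where w: "w \<in> arr C" "src C w = tgt C q" "tgt C w = tgt C q" "q = ?e \<cdot> q \<cdot> w" using P[of n] by blast
  have "?e \<cdot> q = ?e \<cdot> (?e \<cdot> q \<cdot> w)" using w(4) by metis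
  also have "\<dots> = ?e \<cdot> ?e \<cdot> q \<cdot> w" using w(1-3) pq sp by (simp add: comp_assoc)
  finally have eq: "?e \<cdot> q = q" using n w(4) by metis
  have ee: "?e = spower (ccomp C) ?s (n + n) \<cdot> ?s" using n S.spower_add[OF s, of n n] S.spower_add[OF s, of "n + n" 0] by simp
  let ?y = "spower (ccomp C) ?s (n + n)"
  have "q = ?y \<cdot> ?s \<cdot> q" using eq ee by metis
  also have "\<dots> = (?y \<cdot> u) \<cdot> (p \<cdot> q)" using pq uv(1-4) ends sp by (simp add: comp_assoc)
  finally have "q = (?y \<cdot> u) \<cdot> (p \<cdot> q)" .
  then show ?thesis unfolding leL_def using pq uv(1-4) ends sp by (intro bexI[of _ "?y \<cdot> u"]) simp_all
qed

definition eqH :: "'m \<Rightarrow> 'm \<Rightarrow> bool" where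
  "eqH x y \<longleftrightarrow> leR x y \<and> leR y x \<and> leL x y \<and> leL y x"

end

locale min_cong = cat_cong C R for C :: "('o, 'm) cat" and R :: "'m \<Rightarrow> 'm \<Rightarrow> bool" +
  assumes minimal: "\<And>R'. cat_congruence C R' \<Longrightarrow> (\<And>x y. R' x y \<Longrightarrow> R x y) \<Longrightarrow> R' x y \<Longrightarrow> x \<noteq> y \<Longrightarrow> R p q \<Longrightarrow> R' p q"
begin

lemma leJ_comp:
  assumes x: "x \<in> arr C" and p: "p \<in> arr C" "leJ p x" and u: "u \<in> arr C"
  shows "tgt C u = src C p \<Longrightarrow> leJ (u \<cdot> p) x" "src C u = tgt C p \<Longrightarrow> leJ (p \<cdot> u) x"
  using leJ_trans[OF x leL_imp_leJ[OF p(1) comp_leL[OF u p(1)]] p(2)]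
    leJ_trans[OF x leR_imp_leJ[OF p(1) comp_leR[OF p(1) u]] p(2)] by simp_all

text \<open>Let \<open>I\<close> be the ideal generated by \<open>x\<close> and \<open>y\<close>. The pairs of \<open>R\<close> that are diagonal or have
  both components in \<open>I\<close> form a congruence that contains \<open>(x, y)\<close>; by minimality this is
  \<open>R\<close>.\<close>

lemma minimal_ideal:
  assumes xy: "R x y" "x \<noteq> y" and pq: "R p q" "p \<noteq> q"
  shows "leJ p x \<or> leJ p y"
proof -
  note a = R_arr[OF xy(1)]
  define I where "I p \<longleftrightarrow> leJ p x \<or> leJ p y" for p
  have Iu: "I (u \<cdot> p)" if "I p" "p \<in> arr C" "u \<in> arr C" "tgt C u = src C p" for u p
    using that leJ_comp(1)[OF a(1), of p u] leJ_comp(1)[OF a(2), of p u] unfolding I_def by blast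
  have Iv: "I (p \<cdot> u)" if "I p" "p \<in> arr C" "u \<in> arr C" "src C u = tgt C p" for u p
    using that leJ_comp(2)[OF a(1), of p u] leJ_comp(2)[OF a(2), of p u] unfolding I_def by blast
  let ?R = "\<lambda>p q. R p q \<and> (p = q \<or> I p \<and> I q)"
  have "cat_congruence C ?R"
    unfolding cat_congruence_def
  proof (intro conjI allI impI ballI)
    fix p q u assume pq: "?R p q" and u: "u \<in> arr C"
    note b = R_arr[OF conjunct1[OF pq]]
    { assume "tgt C u = src C p"
      then show "R (u \<cdot> p) (u \<cdot> q)" "u \<cdot> p = u \<cdot> q \<or> I (u \<cdot> p) \<and> I (u \<cdot> q)"
        using pq u R_left[of p q u] Iu[of p u] Iu[of q u] b by auto }
    { assume "src C u = tgt C p"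
      then show "R (p \<cdot> u) (q \<cdot> u)" "p \<cdot> u = q \<cdot> u \<or> I (p \<cdot> u) \<and> I (q \<cdot> u)"
        using pq u R_right[of p q u] Iv[of p u] Iv[of q u] b by auto }
  next
    fix p q w assume "?R p q" "?R q w"
    then show "R p w" "p = w \<or> I p \<and> I w" using R_trans by blast+
  qed (use R_arr R_refl R_sym in blast)+
  moreover have "I x" "I y"
    using leR_imp_leJ[OF a(1) leR_refl] leR_imp_leJ[OF a(2) leR_refl] a unfolding I_def by blast+
  then have "?R x y" using xy(1) by blast
  ultimately have "?R p q" using minimal[of ?R x y p q] xy(2) pq(1) by blast
  then show ?thesis using pq(2) unfolding I_def by blast
qed

text \<open>The pairs of \<open>R\<close> that satisfy \<open>eqH\<close> form a congruence, although \<open>eqH\<close> alone is in general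
  not one: if \<open>pu\<close> and \<open>qu\<close> are different, then by the preceding lemma and stability \<open>p\<close> can
  be recovered from \<open>pu\<close>, and \<open>q\<close> from \<open>qu\<close>, by right multiplication. By minimality a single
  non-trivial pair of this kind suffices to conclude that this congruence is \<open>R\<close>.\<close>

lemma minimal_eqH:
  assumes xy: "R x y" "x \<noteq> y" "eqH x y" and pq: "R p q"
  shows "eqH p q"
proof -
  let ?R = "\<lambda>p q. R p q \<and> eqH p q"
  have refl: "eqH p p" if "p \<in> arr C" for p using that leR_refl leL_refl unfolding eqH_def by blast
  have "cat_congruence C ?R"
    unfolding cat_congruence_def
  proof (intro conjI allI impI ballI)
    fix p q w assume w: "?R p q" "?R q w"
    show "R p w" using w R_trans by blast
    have "p \<in> arr C" "w \<in> arr C" using w R_arr by blast+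
    then show "eqH p w" using w leR_trans leL_trans unfolding eqH_def by blast
  next
    fix p q u assume pq: "?R p q" and u: "u \<in> arr C"
    note b = R_arr[OF conjunct1[OF pq]]
    have h: "leR p q" "leR q p" "leL p q" "leL q p" using pq unfolding eqH_def by blast+
    obtain s where s: "s \<in> arr C" "tgt C s = src C p" "q = s \<cdot> p" using h(4) unfolding leL_def by blast
    obtain s' where s': "s' \<in> arr C" "tgt C s' = src C q" "p = s' \<cdot> q" using h(3) unfolding leL_def by blast
    obtain d where d: "d \<in> arr C" "src C d = tgt C p" "q = p \<cdot> d" using h(2) unfolding leR_def by blast
    obtain d' where d': "d' \<in> arr C" "src C d' = tgt C q" "p = q \<cdot> d'" using h(1) unfolding leR_def by blast
    { assume u': "src C u = tgt C p"
      show R': "R (p \<cdot> u) (q \<cdot> u)" using pq R_right[OF _ u u'] by blast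
      note c = R_arr[OF R']
      show "eqH (p \<cdot> u) (q \<cdot> u)"
      proof (cases "p \<cdot> u = q \<cdot> u")
        case False
        have "leJ p (p \<cdot> u) \<or> leJ p (q \<cdot> u)" by (rule minimal_ideal[OF R' False]) (use pq False in blast)+
        then have X: "leR p (p \<cdot> u) \<and> leR q (q \<cdot> u)"
        proof
          assume "leJ p (p \<cdot> u)"
          then have 1: "leR p (p \<cdot> u)" by (rule stable_right[OF b(1) u u'[symmetric]])
          then obtain w where w: "w \<in> arr C" "src C w = tgt C (p \<cdot> u)" "p = p \<cdot> u \<cdot> w" unfolding leR_def by blast
          have "q = s \<cdot> (p \<cdot> u \<cdot> w)" using s(3) w(3) by metis
          also have "\<dots> = s \<cdot> p \<cdot> u \<cdot> w" using s(1,2) u u' b w(1,2) by (simp add: comp_assoc)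
          finally have "q = q \<cdot> u \<cdot> w" using s(3) by metis
          then have "leR q (q \<cdot> u)" unfolding leR_def using w b u u' by (intro bexI[of _ w] conjI) simp_all
          then show ?thesis using 1 by blast
        next
          assume "leJ p (q \<cdot> u)"
          then have "leJ q (q \<cdot> u)" using leJ_trans[OF c(2) leL_imp_leJ[OF b(1) h(4)]] by blast
          then have 1: "leR q (q \<cdot> u)" using stable_right[OF b(2) u] u' b by simp
          then obtain w where w: "w \<in> arr C" "src C w = tgt C (q \<cdot> u)" "q = q \<cdot> u \<cdot> w" unfolding leR_def by blast
          have "p = s' \<cdot> (q \<cdot> u \<cdot> w)" using s'(3) w(3) by metis
          also have "\<dots> = s' \<cdot> q \<cdot> u \<cdot> w" using s'(1,2) u u' b w(1,2) by (simp add: comp_assoc)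
          finally have "p = p \<cdot> u \<cdot> w" using s'(3) by metis
          then have "leR p (p \<cdot> u)" unfolding leR_def using w b u u' by (intro bexI[of _ w] conjI) simp_all
          then show ?thesis using 1 by blast
        qed
        have Y: "leR (p \<cdot> u) p" "leR (q \<cdot> u) q" using comp_leR b u u' by simp_all
        have "leR (p \<cdot> u) (q \<cdot> u)" by (rule leR_trans[OF c(2) Y(1) leR_trans[OF c(2) h(1) conjunct2[OF X]]])
        moreover have "leR (q \<cdot> u) (p \<cdot> u)" by (rule leR_trans[OF c(1) Y(2) leR_trans[OF c(1) h(2) conjunct1[OF X]]])
        moreover have "s \<cdot> p \<cdot> u = s \<cdot> (p \<cdot> u)" "s' \<cdot> q \<cdot> u = s' \<cdot> (q \<cdot> u)"
          by (rule comp_assoc; use s(1,2) s'(1,2) u u' b in simp)+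
        then have e: "q \<cdot> u = s \<cdot> (p \<cdot> u)" "p \<cdot> u = s' \<cdot> (q \<cdot> u)"
          unfolding s(3)[symmetric] s'(3)[symmetric] .
        have "tgt C s = src C (p \<cdot> u)" "tgt C s' = src C (q \<cdot> u)" using s(2) s'(2) b u u' by simp_all
        then have "leL (q \<cdot> u) (p \<cdot> u)" "leL (p \<cdot> u) (q \<cdot> u)"
          unfolding leL_def using s(1) s'(1) e by blast+
        ultimately show ?thesis unfolding eqH_def by blast
      qed (use refl[OF c(1)] in simp) }
    { assume u': "tgt C u = src C p"
      show R': "R (u \<cdot> p) (u \<cdot> q)" using pq R_left[OF _ u u'] by blast
      note c = R_arr[OF R']
      show "eqH (u \<cdot> p) (u \<cdot> q)"
      proof (cases "u \<cdot> p = u \<cdot> q")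
        case False
        have "leJ p (u \<cdot> p) \<or> leJ p (u \<cdot> q)" by (rule minimal_ideal[OF R' False]) (use pq False in blast)+
        then have X: "leL p (u \<cdot> p) \<and> leL q (u \<cdot> q)"
        proof
          assume "leJ p (u \<cdot> p)"
          then have 1: "leL p (u \<cdot> p)" by (rule stable_left[OF u b(1) u'])
          then obtain w where w: "w \<in> arr C" "tgt C w = src C (u \<cdot> p)" "p = w \<cdot> (u \<cdot> p)" unfolding leL_def by blast
          have "q = w \<cdot> (u \<cdot> p) \<cdot> d" using d(3) w(3) by metis
          also have "\<dots> = w \<cdot> (u \<cdot> (p \<cdot> d))" using d(1,2) u u' b w(1,2) by (simp add: comp_assoc)
          finally have "q = w \<cdot> (u \<cdot> q)" using d(3) by metis
          then have "leL q (u \<cdot> q)" unfolding leL_def using w b u u' by (intro bexI[of _ w] conjI) simp_all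
          then show ?thesis using 1 by blast
        next
          assume "leJ p (u \<cdot> q)"
          then have "leJ q (u \<cdot> q)" using leJ_trans[OF c(2) leR_imp_leJ[OF b(1) h(2)]] by blast
          then have 1: "leL q (u \<cdot> q)" using stable_left[OF u b(2)] u' b by simp
          then obtain w where w: "w \<in> arr C" "tgt C w = src C (u \<cdot> q)" "q = w \<cdot> (u \<cdot> q)" unfolding leL_def by blast
          have "p = w \<cdot> (u \<cdot> q) \<cdot> d'" using d'(3) w(3) by metis
          also have "\<dots> = w \<cdot> (u \<cdot> (q \<cdot> d'))" using d'(1,2) u u' b w(1,2) by (simp add: comp_assoc)
          finally have "p = w \<cdot> (u \<cdot> p)" using d'(3) by metis
          then have "leL p (u \<cdot> p)" unfolding leL_def using w b u u' by (intro bexI[of _ w] conjI) simp_all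
          then show ?thesis using 1 by blast
        qed
        have Y: "leL (u \<cdot> p) p" "leL (u \<cdot> q) q" using comp_leL b u u' by simp_all
        have "leL (u \<cdot> p) (u \<cdot> q)" by (rule leL_trans[OF c(2) Y(1) leL_trans[OF c(2) h(3) conjunct2[OF X]]])
        moreover have "leL (u \<cdot> q) (u \<cdot> p)" by (rule leL_trans[OF c(1) Y(2) leL_trans[OF c(1) h(4) conjunct1[OF X]]])
        moreover have "u \<cdot> p \<cdot> d = u \<cdot> (p \<cdot> d)" "u \<cdot> q \<cdot> d' = u \<cdot> (q \<cdot> d')"
          by (rule comp_assoc; use d(1,2) d'(1,2) u u' b in simp)+
        then have e: "u \<cdot> p \<cdot> d = u \<cdot> q" "u \<cdot> q \<cdot> d' = u \<cdot> p"
          unfolding d(3)[symmetric] d'(3)[symmetric] .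
        have "src C d = tgt C (u \<cdot> p)" "src C d' = tgt C (u \<cdot> q)" using d(2) d'(2) b u u' by simp_all
        then have "leR (u \<cdot> q) (u \<cdot> p)" "leR (u \<cdot> p) (u \<cdot> q)"
          unfolding leR_def using d(1) d'(1) e[symmetric] by blast+
        ultimately show ?thesis unfolding eqH_def by blast
      qed (use refl[OF c(1)] in simp) }
  next
    fix p q assume "?R p q"
    then show "R q p" "eqH q p" using R_sym unfolding eqH_def by blast+
  qed (use R_arr R_refl refl in blast)+
  then have "?R p q" using minimal[of ?R x y p q] xy pq by blast
  then show ?thesis by blast
qed

end

locale min_LH_cong = group_pv H + min_cong C R for H :: "nat monoid set" and C :: "('o, 'm) cat" and R +
  assumes LH: "LH_congruence H C R"
begin

lemma ker_cat_belongs: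
  assumes "idem_arr g"
  shows "belongs_to (ker_cat C R g) H"
  using LH assms unfolding LH_congruence_def idem_arr_def by simp

lemma ker_cat_carrier: "x \<in> carrier (ker_cat C R g) \<longleftrightarrow> R x g \<and> g \<cdot> x = x \<and> x \<cdot> g = x"
  and ker_cat_mult [simp]: "monoid.mult (ker_cat C R g) = ccomp C" and ker_cat_one [simp]: "\<one>\<^bsub>ker_cat C R g\<^esub> = g"
  by (simp_all add: ker_cat_def)

text \<open>All of \<open>l\<close>, \<open>r1\<close>, \<open>r2\<close>, \<open>l r1\<close> and \<open>l r2\<close> are in the same \<open>J\<close>-class, because by minimality
  each element of a non-trivial class is below one of two different congruent elements. As
  \<open>l r1\<close> is equivalent to \<open>l\<close> for \<open>leR\<close> and to \<open>r1\<close> for \<open>leL\<close>, there is an idempotent \<open>g\<close>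
  between \<open>l\<close> and \<open>r1\<close>, by the theorem of Clifford and Miller. The element \<open>g r2 z g\<close> is
  congruent to \<open>g\<close>, hence a unit at \<open>g\<close>, and this makes \<open>l r2\<close> equivalent to \<open>l r1\<close> for
  \<open>leR\<close>. For \<open>leL\<close> this follows from \<open>cmp\<close> by stability.\<close>

lemma ex_middle_idempotent_aux:
  assumes l: "R l l'" "l \<noteq> l'" and r: "R r1 r2" "tgt C l = src C r1" and ne: "l \<cdot> r1 \<noteq> l \<cdot> r2"
    and cmp: "leL r1 r2 \<or> leL r2 r1" and J: "leJ l (l \<cdot> r1)"
  shows "\<exists>g z z'. idem_arr g \<and> src C g = tgt C l \<and> z \<in> arr C \<and> z' \<in> arr C \<and> src C z = tgt C r1 \<and> tgt C z' = src C l \<and>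
    l \<cdot> g = l \<and> g \<cdot> r1 = r1 \<and> g = r1 \<cdot> z \<and> g = z' \<cdot> l \<and> eqH (l \<cdot> r1) (l \<cdot> r2)"
proof -
  note la = R_arr[OF l(1)] and ra = R_arr[OF r(1)]
  have Rl: "R (l \<cdot> r1) (l \<cdot> r2)" by (rule R_left[OF r(1) la(1) r(2)])
  note xa = R_arr[OF Rl]
  have r12: "r1 \<noteq> r2" using ne by blast
  have t2: "tgt C l = src C r2" using r(2) ra by simp
  have J2: "leJ (l \<cdot> r2) l" by (rule leR_imp_leJ[OF la(1) comp_leR[OF la(1) ra(2) t2]])
  have "leJ r1 (l \<cdot> r1) \<or> leJ r1 (l \<cdot> r2)" by (rule minimal_ideal[OF Rl ne r(1) r12])
  then have J1: "leJ r1 (l \<cdot> r1)" using leJ_trans[OF xa(1) _ leJ_trans[OF xa(1) J2 J]] by blast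
  have "leR l (l \<cdot> r1)" by (rule stable_right[OF la(1) ra(1) r(2) J])
  then obtain z where z: "z \<in> arr C" "src C z = tgt C (l \<cdot> r1)" "l = l \<cdot> r1 \<cdot> z" unfolding leR_def by blast
  have "leL r1 (l \<cdot> r1)" by (rule stable_left[OF la(1) ra(1) r(2) J1])
  then obtain z' where z': "z' \<in> arr C" "tgt C z' = src C (l \<cdot> r1)" "r1 = z' \<cdot> (l \<cdot> r1)" unfolding leL_def by blast
  have zs: "src C z = tgt C r1" "tgt C z = tgt C l" "tgt C z' = src C l" "src C z' = src C r1"
  proof -
    have 1: "src C z = tgt C r1" "tgt C z' = src C l" using z(2) z'(2) la ra r(2) by simp_all
    then have "tgt C (l \<cdot> r1 \<cdot> z) = tgt C z" "src C (z' \<cdot> (l \<cdot> r1)) = src C z'"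
      using z(1) z'(1) la ra r(2) by simp_all
    then show "src C z = tgt C r1" "tgt C z = tgt C l" "tgt C z' = src C l" "src C z' = src C r1"
      unfolding z(3)[symmetric] z'(3)[symmetric] using 1 by simp_all
  qed
  define g where "g = r1 \<cdot> z"
  have ga: "g \<in> arr C" "src C g = src C r1" "tgt C g = src C r1" unfolding g_def using z zs ra r(2) by simp_all
  have "l \<cdot> r1 \<cdot> z = l \<cdot> g" unfolding g_def by (rule comp_assoc) (use la ra r(2) z(1) zs in simp_all)
  then have lg: "l \<cdot> g = l" using z(3) by metis
  have "z' \<cdot> l \<cdot> g = z' \<cdot> (l \<cdot> r1) \<cdot> z"
    unfolding g_def using la ra r(2) z(1) zs z'(1) by (simp add: comp_assoc)
  then have "z' \<cdot> l \<cdot> g = g" using z'(3) unfolding g_def by metis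
  moreover have "z' \<cdot> l \<cdot> g = z' \<cdot> l" using lg comp_assoc[of z' l g] la z'(1) zs ga r(2) by simp
  ultimately have g2: "g = z' \<cdot> l" by simp
  have "z' \<cdot> l \<cdot> r1 = z' \<cdot> (l \<cdot> r1)" by (rule comp_assoc) (use la ra r(2) z'(1) zs in simp_all)
  then have gr1: "g \<cdot> r1 = r1" using z'(3) g2 by metis
  have gg: "g \<cdot> g = g"
  proof -
    have "g \<cdot> g = z' \<cdot> l \<cdot> g" using g2 by metis
    also have "\<dots> = z' \<cdot> (l \<cdot> g)" using comp_assoc[of z' l g] la z'(1) zs ga r(2) by simp
    finally show ?thesis using lg g2 by simp
  qed
  have g: "idem_arr g" unfolding idem_arr_def using ga gg by simp
  define t where "t = g \<cdot> (r2 \<cdot> z) \<cdot> g"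
  have ts: "r2 \<cdot> z \<in> arr C" "src C (r2 \<cdot> z) = src C r1" "tgt C (r2 \<cdot> z) = src C r1"
    using ra z(1) zs r(2) by simp_all
  have "R (r1 \<cdot> z) (r2 \<cdot> z)" by (rule R_right[OF r(1) z(1) zs(1)])
  then have "R (r2 \<cdot> z) g" unfolding g_def by (rule R_sym)
  then have "R (g \<cdot> (r2 \<cdot> z)) (g \<cdot> g)" by (rule R_left) (use ga ts in simp_all)
  then have "R (g \<cdot> (r2 \<cdot> z) \<cdot> g) (g \<cdot> g \<cdot> g)" by (rule R_right) (use ga ts in simp_all)
  then have "R t g" unfolding t_def using gg by simp
  moreover have "g \<cdot> t = t" "t \<cdot> g = t"
    unfolding t_def using gg ga ts comp_assoc[of g g "r2 \<cdot> z \<cdot> g"] comp_assoc[of g "r2 \<cdot> z" g] comp_assoc[of "g \<cdot> (r2 \<cdot> z)" g g]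
    by simp_all
  ultimately have tK: "t \<in> carrier (ker_cat C R g)" by (simp add: ker_cat_carrier)
  interpret K: group "ker_cat C R g" by (rule belongs_group(1)[OF ker_cat_belongs[OF g]])
  obtain t' where "t' \<in> carrier (ker_cat C R g)" "t \<otimes>\<^bsub>ker_cat C R g\<^esub> t' = \<one>\<^bsub>ker_cat C R g\<^esub>"
    using K.r_inv[OF tK] K.inv_closed[OF tK] by blast
  then have t': "R t' g" "t \<cdot> t' = g" by (simp_all add: ker_cat_carrier)
  note t'a = R_arr[OF t'(1)]
  let ?x = "l \<cdot> r1" and ?y = "l \<cdot> r2"
  have "l \<cdot> t = l \<cdot> g \<cdot> (r2 \<cdot> z) \<cdot> g" unfolding t_def using la ga ts r(2) by (simp add: comp_assoc)
  also have "\<dots> = ?y \<cdot> (z \<cdot> g)" unfolding lg using la ga ra z(1) zs r(2) by (simp add: comp_assoc)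
  finally have lt: "l \<cdot> t = ?y \<cdot> (z \<cdot> g)" .
  have "l = l \<cdot> (t \<cdot> t')" using lg t'(2) by simp
  also have "\<dots> = ?y \<cdot> (z \<cdot> g) \<cdot> t'"
    using lt comp_assoc[of l t t'] la ga ts t'a r(2) unfolding t_def by simp
  also have "\<dots> = ?y \<cdot> (z \<cdot> g \<cdot> t')"
    using la ra ga z(1) zs t'a r(2) by (simp add: comp_assoc)
  finally have "l = ?y \<cdot> (z \<cdot> g \<cdot> t')" .
  then have ly: "leR l ?y" unfolding leR_def using la ra ga z(1) zs t'a r(2) by (intro bexI[of _ "z \<cdot> g \<cdot> t'"]) simp_all
  have lx: "leR l ?x" unfolding leR_def using z by blast
  have xl: "leR ?x l" "leR ?y l" using comp_leR la ra r(2) t2 by simp_all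
  have HR: "leR ?x ?y" "leR ?y ?x" using leR_trans xl lx ly xa by blast+
  have Jl: "leJ l ?y" by (rule leR_imp_leJ[OF xa(2) ly])
  have "leJ r2 ?x \<or> leJ r2 ?y" by (rule minimal_ideal[OF Rl ne R_sym[OF r(1)]]) (use r12 in simp)
  moreover have "leJ ?x ?y" by (rule leR_imp_leJ[OF xa(2) HR(1)])
  ultimately have Jr2: "leJ r2 ?y" using leJ_trans[OF xa(2)] by blast
  have r2y: "leL r2 ?y" by (rule stable_left[OF la(1) ra(2) t2 Jr2])
  have r1x: "leL r1 ?x" unfolding leL_def using z' by blast
  have xr: "leL ?x r1" "leL ?y r2" using comp_leL la ra r(2) t2 by simp_all
  have J12: "leJ r1 r2"
    by (rule leJ_trans[OF ra(2) leJ_trans[OF xa(2) J1 leR_imp_leJ[OF xa(2) HR(1)]] leL_imp_leJ[OF ra(2) xr(2)]])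
  have J21: "leJ r2 r1"
    by (rule leJ_trans[OF ra(1) leJ_trans[OF xa(1) Jr2 leR_imp_leJ[OF xa(1) HR(2)]] leL_imp_leJ[OF ra(1) xr(1)]])
  have rr: "leL r1 r2 \<and> leL r2 r1"
    using cmp
  proof
    assume 1: "leL r1 r2"
    then obtain a where a: "a \<in> arr C" "tgt C a = src C r2" "r1 = a \<cdot> r2" unfolding leL_def by blast
    have "leL r2 (a \<cdot> r2)" by (rule stable_left[OF a(1) ra(2) a(2)]) (use J21 a(3) in simp)
    then show ?thesis using 1 a(3) by simp
  next
    assume 1: "leL r2 r1"
    then obtain a where a: "a \<in> arr C" "tgt C a = src C r1" "r2 = a \<cdot> r1" unfolding leL_def by blast
    have "leL r1 (a \<cdot> r1)" by (rule stable_left[OF a(1) ra(1) a(2)]) (use J12 a(3) in simp)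
    then show ?thesis using 1 a(3) by simp
  qed
  have "leL ?x ?y" by (rule leL_trans[OF xa(2) leL_trans[OF ra(2) xr(1) conjunct1[OF rr]] r2y])
  moreover have "leL ?y ?x" by (rule leL_trans[OF xa(1) leL_trans[OF ra(1) xr(2) conjunct2[OF rr]] r1x])
  ultimately have "eqH ?x ?y" using HR unfolding eqH_def by blast
  moreover have "src C g = tgt C l" using ga(2) r(2) by simp
  moreover have "g = r1 \<cdot> z" by (rule g_def)
  ultimately show ?thesis using g z(1) z'(1) zs(1,3) lg gr1 g2
    by (intro exI[of _ g] exI[of _ z] exI[of _ z'] conjI)
qed

text \<open>By minimality \<open>l\<close> is below one of \<open>l r1\<close> and \<open>l r2\<close>, and the situation is symmetric.\<close>

lemma ex_middle_idempotent:
  assumes l: "R l l'" "l \<noteq> l'" and r: "R r1 r2" "tgt C l = src C r1" and ne: "l \<cdot> r1 \<noteq> l \<cdot> r2"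
    and cmp: "leL r1 r2 \<or> leL r2 r1"
  obtains g z z' r where "R r r1" "idem_arr g" "src C g = tgt C l" "z \<in> arr C" "z' \<in> arr C"
    "src C z = tgt C r" "tgt C z' = src C l" "l \<cdot> g = l" "g \<cdot> r = r" "g = r \<cdot> z" "g = z' \<cdot> l" "eqH (l \<cdot> r1) (l \<cdot> r2)"
proof -
  note la = R_arr[OF l(1)] and ra = R_arr[OF r(1)]
  have "leJ l (l \<cdot> r1) \<or> leJ l (l \<cdot> r2)" by (rule minimal_ideal[OF R_left[OF r(1) la(1) r(2)] ne l])
  then show thesis
  proof
    assume "leJ l (l \<cdot> r1)"
    from ex_middle_idempotent_aux[OF l r ne cmp this] show thesis
      by (elim exE conjE) (rule that[OF R_refl[OF ra(1)]])
  next
    assume J: "leJ l (l \<cdot> r2)"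
    have t2: "tgt C l = src C r2" using r(2) ra(3) by simp
    have cmp': "leL r2 r1 \<or> leL r1 r2" using cmp by blast
    from ex_middle_idempotent_aux[OF l R_sym[OF r(1)] t2 ne[symmetric] cmp' J]
    obtain g z z' where g: "idem_arr g" "src C g = tgt C l" "z \<in> arr C" "z' \<in> arr C" "src C z = tgt C r2" "tgt C z' = src C l"
      "l \<cdot> g = l" "g \<cdot> r2 = r2" "g = r2 \<cdot> z" "g = z' \<cdot> l" "eqH (l \<cdot> r2) (l \<cdot> r1)" by blast
    have "eqH (l \<cdot> r1) (l \<cdot> r2)" using g(11) unfolding eqH_def by blast
    then show thesis by (rule that[OF R_sym[OF r(1)] g(1-10)])
  qed
qed

end

section \<open>The kernel category of a congruence\<close>

text \<open>The classes of the left and right factor are given by their representatives. An arrow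
  \<open>(l, m, r)\<close> moves \<open>m\<close> from the right factor to the left one: it leads from \<open>(l, mr)\<close> to
  \<open>(lm, r)\<close>.\<close>

definition kernel_cat :: "('o, 'm) cat \<Rightarrow> ('m \<Rightarrow> 'm \<Rightarrow> bool) \<Rightarrow> ('m \<times> 'm, 'm \<times> 'm \<times> 'm) cat" where
  "kernel_cat C R =
     \<lparr>obj = {(l, r). l \<in> rep R ` arr C \<and> r \<in> rep R ` arr C \<and> tgt C l = src C r},
      arr = {(l, m, r). l \<in> rep R ` arr C \<and> m \<in> arr C \<and> r \<in> rep R ` arr C \<and> tgt C l = src C m \<and> tgt C m = src C r},
      src = (\<lambda>(l, m, r). (l, rep R (ccomp C m r))), tgt = (\<lambda>(l, m, r). (rep R (ccomp C l m), r)),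
      ident = (\<lambda>(l, r). (l, ident C (tgt C l), r)), ccomp = (\<lambda>(l, m, r) (l', m', r'). (l, ccomp C m m', r'))\<rparr>"

text \<open>Coterminal arrows are related if they act in the same way on all elements of the classes
  of \<open>l\<close> and \<open>r\<close>, which may be more than equality at the representatives.\<close>

definition same_action :: "('o, 'm) cat \<Rightarrow> ('m \<Rightarrow> 'm \<Rightarrow> bool) \<Rightarrow> 'm \<times> 'm \<times> 'm \<Rightarrow> 'm \<times> 'm \<times> 'm \<Rightarrow> bool" where
  "same_action C R a b \<longleftrightarrow> a \<in> arr (kernel_cat C R) \<and> b \<in> arr (kernel_cat C R) \<and>
     src (kernel_cat C R) a = src (kernel_cat C R) b \<and> tgt (kernel_cat C R) a = tgt (kernel_cat C R) b \<and>
     (case a of (l, m, r) \<Rightarrow> case b of (_, n, _) \<Rightarrow>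
        (\<forall>l' r'. R l' l \<longrightarrow> R r' r \<longrightarrow> ccomp C (ccomp C l' m) r' = ccomp C (ccomp C l' n) r'))"

context cat_cong
begin

abbreviation "KC \<equiv> kernel_cat C R"

lemma rep_image_iff: "x \<in> rep R ` arr C \<longleftrightarrow> x \<in> arr C \<and> rep R x = x"
  by (metis imageE imageI rep_arr(1) rep_rep)

lemma KC_obj: "(l, r) \<in> obj KC \<longleftrightarrow> l \<in> arr C \<and> rep R l = l \<and> r \<in> arr C \<and> rep R r = r \<and> tgt C l = src C r"
  unfolding kernel_cat_def by (auto simp: rep_image_iff)

lemma KC_arr: "(l, m, r) \<in> arr KC \<longleftrightarrow> l \<in> arr C \<and> rep R l = l \<and> m \<in> arr C \<and> r \<in> arr C \<and> rep R r = r \<and>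
    tgt C l = src C m \<and> tgt C m = src C r"
  unfolding kernel_cat_def by (auto simp: rep_image_iff)

lemma KC_simps [simp]: "src KC (l, m, r) = (l, rep R (m \<cdot> r))" "tgt KC (l, m, r) = (rep R (l \<cdot> m), r)"
  "ident KC (l, r) = (l, ident C (tgt C l), r)" "ccomp KC (l, m, r) (l', m', r') = (l, m \<cdot> m', r')"
  unfolding kernel_cat_def by simp_all

lemma KC_comp:
  assumes "(l, m, r) \<in> arr KC" "(l', m', r') \<in> arr KC" "tgt KC (l, m, r) = src KC (l', m', r')"
  shows "(l, m \<cdot> m', r') \<in> arr KC" "src KC (l, m \<cdot> m', r') = src KC (l, m, r)" "tgt KC (l, m \<cdot> m', r') = tgt KC (l', m', r')"
    "tgt C m = src C m'"
proof -
  have a: "l \<in> arr C" "rep R l = l" "m \<in> arr C" "r \<in> arr C" "rep R r = r" "tgt C l = src C m" "tgt C m = src C r"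
    and b: "l' \<in> arr C" "rep R l' = l'" "m' \<in> arr C" "r' \<in> arr C" "rep R r' = r'" "tgt C l' = src C m'" "tgt C m' = src C r'"
    and c: "rep R (l \<cdot> m) = l'" "r = rep R (m' \<cdot> r')"
    using assms by (simp_all add: KC_arr)
  have mm: "tgt C m = src C m'" using c(2) a(7) b by simp
  then show "tgt C m = src C m'" .
  show "(l, m \<cdot> m', r') \<in> arr KC" using a b mm by (simp add: KC_arr)
  have "rep R (m \<cdot> m' \<cdot> r') = rep R (m \<cdot> (m' \<cdot> r'))" using a b mm by (simp add: comp_assoc)
  also have "\<dots> = rep R (m \<cdot> r)" unfolding c(2) by (rule rep_comp(2)[symmetric]) (use a b mm in simp_all)
  finally show "src KC (l, m \<cdot> m', r') = src KC (l, m, r)" by simp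
  have "rep R (l \<cdot> (m \<cdot> m')) = rep R (l \<cdot> m \<cdot> m')" using a b mm by (simp add: comp_assoc)
  also have "\<dots> = rep R (l' \<cdot> m')" unfolding c(1)[symmetric] by (rule rep_comp(1)[symmetric]) (use a b mm in simp_all)
  finally show "tgt KC (l, m \<cdot> m', r') = tgt KC (l', m', r')" by simp
qed

lemma finite_category_KC: "finite_category KC"
  unfolding finite_category_def
proof (intro conjI)
  show "finite (obj KC)"
    by (rule finite_subset[of _ "arr C \<times> arr C"]) (auto simp: KC_obj fin_arr)
  show "finite (arr KC)"
    by (rule finite_subset[of _ "arr C \<times> arr C \<times> arr C"]) (auto simp: KC_arr fin_arr)
  show "is_category KC"
    unfolding is_category_def hom_set_def
  proof (intro conjI ballI impI)
    fix a assume a: "a \<in> arr KC"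
    obtain l m r where e: "a = (l, m, r)" by (cases a)
    have a': "l \<in> arr C" "rep R l = l" "m \<in> arr C" "r \<in> arr C" "rep R r = r" "tgt C l = src C m" "tgt C m = src C r"
      using a unfolding e by (simp_all add: KC_arr)
    show "src KC a \<in> obj KC" "tgt KC a \<in> obj KC" unfolding e using a' by (simp_all add: KC_obj)
    show "ccomp KC (ident KC (src KC a)) a = a" "ccomp KC a (ident KC (tgt KC a)) = a" unfolding e using a' by simp_all
  next
    fix c assume c: "c \<in> obj KC"
    obtain l r where e: "c = (l, r)" by (cases c)
    show "ident KC c \<in> {m \<in> arr KC. src KC m = c \<and> tgt KC m = c}"
      using c unfolding e by (simp add: KC_obj KC_arr)
  next
    fix a b assume ab: "a \<in> arr KC" "b \<in> arr KC" "tgt KC a = src KC b"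
    obtain l m r l' m' r' where e: "a = (l, m, r)" "b = (l', m', r')" by (cases a, cases b)
    show "ccomp KC a b \<in> {m \<in> arr KC. src KC m = src KC a \<and> tgt KC m = tgt KC b}"
      using KC_comp[of l m r l' m' r'] ab unfolding e KC_simps(4) by blast
  next
    fix a b c assume ab: "a \<in> arr KC" "b \<in> arr KC" "c \<in> arr KC" "tgt KC a = src KC b \<and> tgt KC b = src KC c"
    obtain l m r l' m' r' l'' m'' r'' where e: "a = (l, m, r)" "b = (l', m', r')" "c = (l'', m'', r'')"
      by (cases a, cases b, cases c)
    have "m \<in> arr C" "m' \<in> arr C" "m'' \<in> arr C" using ab unfolding e by (simp_all add: KC_arr)
    moreover have "tgt C m = src C m'" "tgt C m' = src C m''"
      using KC_comp(4)[of l m r l' m' r'] KC_comp(4)[of l' m' r' l'' m'' r''] ab unfolding e by blast+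
    ultimately show "ccomp KC (ccomp KC a b) c = ccomp KC a (ccomp KC b c)" unfolding e by (simp add: comp_assoc)
  qed
qed

lemma same_actionD:
  assumes "same_action C R (l, m, r) (l', n, r')"
  shows "(l, m, r) \<in> arr KC" "(l', n, r') \<in> arr KC" "l = l'" "r = r'" "rep R (m \<cdot> r) = rep R (n \<cdot> r)"
    "rep R (l \<cdot> m) = rep R (l \<cdot> n)" "R x l \<Longrightarrow> R y r \<Longrightarrow> x \<cdot> m \<cdot> y = x \<cdot> n \<cdot> y"
  using assms unfolding same_action_def by auto

lemma same_actionI:
  assumes "(l, m, r) \<in> arr KC" "(l, n, r) \<in> arr KC" "rep R (m \<cdot> r) = rep R (n \<cdot> r)" "rep R (l \<cdot> m) = rep R (l \<cdot> n)"
    "\<And>x y. R x l \<Longrightarrow> R y r \<Longrightarrow> x \<cdot> m \<cdot> y = x \<cdot> n \<cdot> y"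
  shows "same_action C R (l, m, r) (l, n, r)"
  using assms unfolding same_action_def by simp

lemma cat_congruence_same_action: "cat_congruence KC (same_action C R)"
  unfolding cat_congruence_def
proof (intro conjI allI impI ballI)
  fix a b u assume ab: "same_action C R a b" and u: "u \<in> arr KC"
  obtain l m r n p w q where e: "a = (l, m, r)" "b = (l, n, r)" "u = (p, w, q)"
    using same_actionD(3,4) ab by (cases a, cases b, cases u) blast
  note D = same_actionD[OF ab[unfolded e]]
  have am: "l \<in> arr C" "rep R l = l" "m \<in> arr C" "r \<in> arr C" "rep R r = r" "tgt C l = src C m" "tgt C m = src C r"
    and an: "n \<in> arr C" "tgt C l = src C n" "tgt C n = src C r"
    and au: "p \<in> arr C" "rep R p = p" "w \<in> arr C" "q \<in> arr C" "rep R q = q" "tgt C p = src C w" "tgt C w = src C q"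
    using D(1,2) u unfolding e by (simp_all add: KC_arr)
  { assume t: "tgt KC u = src KC a"
    then have tm: "tgt KC (p, w, q) = src KC (l, m, r)" and tn: "tgt KC (p, w, q) = src KC (l, n, r)"
      using D(5) unfolding e by simp_all
    note cm = KC_comp[OF u[unfolded e] D(1) tm] and cn = KC_comp[OF u[unfolded e] D(2) tn]
    have l: "rep R (p \<cdot> w) = l" using tm by simp
    have "same_action C R (p, w \<cdot> m, r) (p, w \<cdot> n, r)"
    proof (rule same_actionI[OF cm(1) cn(1)])
      show "rep R (w \<cdot> m \<cdot> r) = rep R (w \<cdot> n \<cdot> r)" using cm(2) cn(2) by simp
      show "rep R (p \<cdot> (w \<cdot> m)) = rep R (p \<cdot> (w \<cdot> n))" using cm(3) cn(3) D(6) by simp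
      fix x y assume x: "R x p" and y: "R y r"
      note xa = R_arr[OF x] and ya = R_arr[OF y]
      have "R (x \<cdot> w) (p \<cdot> w)" by (rule R_right[OF x au(3)]) (use au xa in simp)
      then have "R (x \<cdot> w) l" using R_trans rep_R[of "p \<cdot> w"] au l by simp
      then have "x \<cdot> w \<cdot> m \<cdot> y = x \<cdot> w \<cdot> n \<cdot> y" using D(7) y by blast
      moreover have "x \<cdot> (w \<cdot> m) = x \<cdot> w \<cdot> m" "x \<cdot> (w \<cdot> n) = x \<cdot> w \<cdot> n"
        using xa am an au cm(4) cn(4) by (simp_all add: comp_assoc)
      ultimately show "x \<cdot> (w \<cdot> m) \<cdot> y = x \<cdot> (w \<cdot> n) \<cdot> y" by simp
    qed
    then show "same_action C R (ccomp KC u a) (ccomp KC u b)" unfolding e by simp }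
  { assume t: "src KC u = tgt KC a"
    then have tm: "tgt KC (l, m, r) = src KC (p, w, q)" and tn: "tgt KC (l, n, r) = src KC (p, w, q)"
      using D(6) unfolding e by simp_all
    note cm = KC_comp[OF D(1) u[unfolded e] tm] and cn = KC_comp[OF D(2) u[unfolded e] tn]
    have r: "rep R (w \<cdot> q) = r" using tm by simp
    have "same_action C R (l, m \<cdot> w, q) (l, n \<cdot> w, q)"
    proof (rule same_actionI[OF cm(1) cn(1)])
      show "rep R (m \<cdot> w \<cdot> q) = rep R (n \<cdot> w \<cdot> q)" using cm(2) cn(2) D(5) by simp
      show "rep R (l \<cdot> (m \<cdot> w)) = rep R (l \<cdot> (n \<cdot> w))" using cm(3) cn(3) by simp
      fix x y assume x: "R x l" and y: "R y q"
      note xa = R_arr[OF x] and ya = R_arr[OF y]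
      have "R (w \<cdot> y) (w \<cdot> q)" by (rule R_left[OF y au(3)]) (use au ya in simp)
      then have "R (w \<cdot> y) r" using R_trans rep_R[of "w \<cdot> q"] au r by simp
      then have "x \<cdot> m \<cdot> (w \<cdot> y) = x \<cdot> n \<cdot> (w \<cdot> y)" using D(7) x by blast
      moreover have "x \<cdot> (m \<cdot> w) \<cdot> y = x \<cdot> m \<cdot> (w \<cdot> y)" "x \<cdot> (n \<cdot> w) \<cdot> y = x \<cdot> n \<cdot> (w \<cdot> y)"
        using xa ya am an au cm(4) cn(4) by (simp_all add: comp_assoc)
      ultimately show "x \<cdot> (m \<cdot> w) \<cdot> y = x \<cdot> (n \<cdot> w) \<cdot> y" by simp
    qed
    then show "same_action C R (ccomp KC a u) (ccomp KC b u)" unfolding e by simp }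
next
  fix a b assume "same_action C R a b"
  then show "same_action C R b a" unfolding same_action_def by (auto split: prod.splits)
next
  fix a b c assume "same_action C R a b" "same_action C R b c"
  then show "same_action C R a c" unfolding same_action_def by (auto split: prod.splits)
next
  fix a assume "a \<in> arr KC"
  then show "same_action C R a a" unfolding same_action_def by (auto split: prod.splits)
qed (simp_all add: same_action_def)

end

context min_LH_cong
begin

text \<open>If all loops \<open>n\<close> at \<open>(l, r)\<close> satisfy \<open>l' n r' = l' r'\<close> for all \<open>l'\<close> and \<open>r'\<close> congruent to
  \<open>l\<close> and \<open>r\<close>, the trivial homomorphism will do. Otherwise there is an idempotent \<open>g\<close>
  between \<open>l'\<close> and an element congruent to \<open>r\<close>, and \<open>R\<close> is contained in \<open>eqH\<close>. For every
  loop \<open>n\<close> then \<open>gn\<close> is congruent to \<open>g\<close>, hence related to it by \<open>eqH\<close>, and \<open>n \<mapsto> gn\<close> is a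
  homomorphism into the local group of \<open>R\<close> at \<open>g\<close>. It determines the action of \<open>n\<close>, since
  all elements congruent to \<open>l'\<close> are fixed by \<open>g\<close>.\<close>

lemma local_group_KC:
  assumes x: "x \<in> obj KC" and K0: "K0 \<in> H"
  shows "\<exists>N\<in>H. \<exists>\<phi>\<in>hom (local_monoid KC x) N.
    \<forall>a\<in>carrier (local_monoid KC x). \<forall>b\<in>carrier (local_monoid KC x). \<phi> a = \<phi> b \<longrightarrow> same_action C R a b"
proof -
  obtain l r where e: "x = (l, r)" by (cases x)
  have l: "l \<in> arr C" "rep R l = l" and r: "r \<in> arr C" "rep R r = r" and lr: "tgt C l = src C r"
    using x unfolding e KC_obj by blast+
  interpret KC: fin_cat KC by standard (rule finite_category_KC)
  define loop where "loop n \<longleftrightarrow> n \<in> arr C \<and> src C n = tgt C l \<and> tgt C n = tgt C l \<and> R (l \<cdot> n) l \<and> R (n \<cdot> r) r" for n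
  have loc: "\<exists>n. a = (l, n, r) \<and> loop n" if a: "a \<in> carrier (local_monoid KC x)" for a
  proof -
    obtain l' n r' where a': "a = (l', n, r')" by (cases a)
    have "(l', n, r') \<in> arr KC" "src KC (l', n, r') = (l, r)" "tgt KC (l', n, r') = (l, r)"
      using a unfolding a' e KC.carrier_local_monoid by blast+
    then have lr': "l' = l" "r' = r" and "(l', n, r') \<in> arr KC" "rep R (n \<cdot> r') = r" "rep R (l' \<cdot> n) = l"
      by simp_all
    then have n: "n \<in> arr C" "tgt C l = src C n" "tgt C n = src C r" "rep R (n \<cdot> r) = r" "rep R (l \<cdot> n) = l"
      unfolding lr' KC_arr by blast+
    then have "R (l \<cdot> n) l" "R (n \<cdot> r) r" using rep_R[of "l \<cdot> n"] rep_R[of "n \<cdot> r"] l r by simp_all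
    then show ?thesis using a' lr' n lr unfolding loop_def by simp
  qed
  have loc_arr: "(l, n, r) \<in> arr KC" "rep R (n \<cdot> r) = r" "rep R (l \<cdot> n) = l" if "loop n" for n
    using that l r lr rep_eq[of "n \<cdot> r" r] rep_eq[of "l \<cdot> n" l] unfolding loop_def KC_arr by simp_all
  have R_l: "R (x \<cdot> n) x" if "loop n" "R x l" for n x
  proof -
    have "R (x \<cdot> n) (l \<cdot> n)" by (rule R_right[OF that(2)]) (use that R_arr[OF that(2)] in \<open>simp_all add: loop_def\<close>)
    then show ?thesis using that R_trans R_sym unfolding loop_def by blast
  qed
  have R_r: "R (n \<cdot> y) y" if "loop n" "R y r" for n y
  proof -
    have "R (n \<cdot> y) (n \<cdot> r)" by (rule R_left[OF that(2)]) (use that R_arr[OF that(2)] lr in \<open>simp_all add: loop_def\<close>)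
    then show ?thesis using that R_trans R_sym unfolding loop_def by blast
  qed
  have sameI: "same_action C R (l, m, r) (l, n, r)"
    if "loop m" "loop n" "\<And>x y. R x l \<Longrightarrow> R y r \<Longrightarrow> x \<cdot> m \<cdot> y = x \<cdot> n \<cdot> y" for m n
    using that loc_arr[OF that(1)] loc_arr[OF that(2)] by (intro same_actionI) simp_all
  show ?thesis
  proof (cases "\<forall>n l' r'. loop n \<longrightarrow> R l' l \<longrightarrow> R r' r \<longrightarrow> l' \<cdot> n \<cdot> r' = l' \<cdot> r'")
    case True
    interpret K0: group K0 by (rule gpv_group[OF K0])
    have "(\<lambda>_. \<one>\<^bsub>K0\<^esub>) \<in> hom (local_monoid KC x) K0" by (rule homI) simp_all
    moreover have "same_action C R a b" if ab: "a \<in> carrier (local_monoid KC x)" "b \<in> carrier (local_monoid KC x)" for a b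
    proof -
      obtain m n where "a = (l, m, r)" "loop m" "b = (l, n, r)" "loop n" using loc[OF ab(1)] loc[OF ab(2)] by blast
      then show ?thesis using sameI[of m n] True by simp
    qed
    ultimately show ?thesis using K0 by blast
  next
    case False
    then obtain n0 l' r' where n0: "loop n0" and l': "R l' l" and r': "R r' r" and ne: "l' \<cdot> n0 \<cdot> r' \<noteq> l' \<cdot> r'" by blast
    note la = R_arr[OF l'] and ra = R_arr[OF r']
    have n0a: "n0 \<in> arr C" "src C n0 = tgt C l" "tgt C n0 = tgt C l" using n0 unfolding loop_def by blast+
    have ass: "l' \<cdot> n0 \<cdot> r' = l' \<cdot> (n0 \<cdot> r')" using la ra n0a lr by (simp add: comp_assoc)
    have 1: "R l' (l' \<cdot> n0)" "l' \<noteq> l' \<cdot> n0" using R_sym[OF R_l[OF n0 l']] ne by auto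
    have 2: "R r' (n0 \<cdot> r')" "tgt C l' = src C r'" "l' \<cdot> r' \<noteq> l' \<cdot> (n0 \<cdot> r')"
      using R_sym[OF R_r[OF n0 r']] la ra lr ne ass by simp_all
    have 3: "leL r' (n0 \<cdot> r') \<or> leL (n0 \<cdot> r') r'" using comp_leL[OF n0a(1) ra(1)] n0a ra lr by simp
    obtain g z z' r1 where g: "R r1 r'" "idem_arr g" "src C g = tgt C l'" "z \<in> arr C" "z' \<in> arr C"
      "src C z = tgt C r1" "tgt C z' = src C l'" "l' \<cdot> g = l'" "g \<cdot> r1 = r1" "g = r1 \<cdot> z" "g = z' \<cdot> l'" "eqH (l' \<cdot> r') (l' \<cdot> (n0 \<cdot> r'))"
      using ex_middle_idempotent[OF 1 2 3] .
    have H: "eqH p q" if "R p q" for p q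
      by (rule minimal_eqH[OF R_left[OF 2(1) la(1) 2(2)] 2(3) g(12) that])
    have ga: "g \<in> arr C" "tgt C g = src C g" "g \<cdot> g = g" "src C g = tgt C l" using g(2,3) la unfolding idem_arr_def by simp_all
    have r1: "R r1 r" using R_trans[OF g(1) r'] .
    note r1a = R_arr[OF r1]
    have "src C (z' \<cdot> l') = src C z'" "tgt C (r1 \<cdot> z) = tgt C z" using g(4-7) la r1a by simp_all
    then have zs: "src C z' = tgt C l" "tgt C z = tgt C l"
      unfolding g(10)[symmetric] g(11)[symmetric] using ga by simp_all
    have comm: "g \<cdot> n \<cdot> g = g \<cdot> n" "R (g \<cdot> n) g" "g \<cdot> n \<in> arr C" "src C (g \<cdot> n) = tgt C l" "tgt C (g \<cdot> n) = tgt C l"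
      if n: "loop n" for n
    proof -
      have na: "n \<in> arr C" "src C n = tgt C l" "tgt C n = tgt C l" using n unfolding loop_def by blast+
      show gn: "g \<cdot> n \<in> arr C" "src C (g \<cdot> n) = tgt C l" "tgt C (g \<cdot> n) = tgt C l" using ga na by simp_all
      have "z' \<cdot> l' \<cdot> n = z' \<cdot> (l' \<cdot> n)" by (rule comp_assoc) (use g(5,7) la na in simp_all)
      moreover have "R (z' \<cdot> (l' \<cdot> n)) (z' \<cdot> l')" by (rule R_left[OF R_l[OF n l'] g(5)]) (use g(7) la na in simp)
      ultimately show Rgn: "R (g \<cdot> n) g" using g(11) by metis
      have "leL (g \<cdot> n) g" using H[OF Rgn] unfolding eqH_def by blast
      then obtain a where a: "a \<in> arr C" "tgt C a = src C g" "g \<cdot> n = a \<cdot> g" unfolding leL_def by blast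
      have "a \<cdot> g \<cdot> g = a \<cdot> (g \<cdot> g)" by (rule comp_assoc) (use a ga in simp_all)
      then show "g \<cdot> n \<cdot> g = g \<cdot> n" unfolding a(3) ga(3) .
    qed
    define \<phi> where "\<phi> a = (case a of (_, n, _) \<Rightarrow> g \<cdot> n)" for a :: "'m \<times> 'm \<times> 'm"
    have \<phi>: "\<phi> \<in> hom (local_monoid KC x) (ker_cat C R g)"
    proof (rule homI)
      fix a assume "a \<in> carrier (local_monoid KC x)"
      then obtain n where n: "a = (l, n, r)" "loop n" using loc by blast
      have na: "n \<in> arr C" "src C n = tgt C l" "tgt C n = tgt C l" using n(2) unfolding loop_def by blast+
      have "g \<cdot> (g \<cdot> n) = g \<cdot> n" using comp_assoc[of g g n] ga na by simp
      then show "\<phi> a \<in> carrier (ker_cat C R g)" using comm[OF n(2)] by (simp add: ker_cat_carrier \<phi>_def n(1))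
    next
      fix a b assume "a \<in> carrier (local_monoid KC x)" "b \<in> carrier (local_monoid KC x)"
      then obtain m n where m: "a = (l, m, r)" "loop m" and n: "b = (l, n, r)" "loop n" using loc by meson
      have ma: "m \<in> arr C" "src C m = tgt C l" "tgt C m = tgt C l" and na: "n \<in> arr C" "src C n = tgt C l" "tgt C n = tgt C l"
        using m(2) n(2) unfolding loop_def by blast+
      have "g \<cdot> (m \<cdot> n) = g \<cdot> m \<cdot> n" using ma na ga by (simp add: comp_assoc)
      also have "\<dots> = g \<cdot> m \<cdot> g \<cdot> n" using comm(1)[OF m(2)] by simp
      also have "\<dots> = (g \<cdot> m) \<cdot> (g \<cdot> n)" using ma na ga by (simp add: comp_assoc)
      finally show "\<phi> (a \<otimes>\<^bsub>local_monoid KC x\<^esub> b) = \<phi> a \<otimes>\<^bsub>ker_cat C R g\<^esub> \<phi> b" unfolding m n \<phi>_def by simp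
    qed
    have same: "same_action C R a b"
      if ab: "a \<in> carrier (local_monoid KC x)" "b \<in> carrier (local_monoid KC x)" "\<phi> a = \<phi> b" for a b
    proof -
      obtain m n where m: "a = (l, m, r)" "loop m" and n: "b = (l, n, r)" "loop n" using loc ab(1,2) by meson
      have ma: "m \<in> arr C" "src C m = tgt C l" and na: "n \<in> arr C" "src C n = tgt C l"
        using m(2) n(2) unfolding loop_def by blast+
      have gmn: "g \<cdot> m = g \<cdot> n" using ab(3) unfolding m n \<phi>_def by simp
      show ?thesis unfolding m(1) n(1)
      proof (rule sameI[OF m(2) n(2)])
        fix y q assume y: "R y l" and "R q r"
        note ya = R_arr[OF y]
        have "leL y l'" using H[OF R_trans[OF y R_sym[OF l']]] unfolding eqH_def by blast
        then obtain a where a: "a \<in> arr C" "tgt C a = src C l'" "y = a \<cdot> l'" unfolding leL_def by blast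
        have "a \<cdot> l' \<cdot> g = a \<cdot> (l' \<cdot> g)" by (rule comp_assoc) (use a(1,2) la ga in simp_all)
        then have yg: "y \<cdot> g = y" unfolding a(3) g(8) .
        have "y \<cdot> m = y \<cdot> g \<cdot> m" using yg by simp
        also have "\<dots> = y \<cdot> (g \<cdot> n)" unfolding gmn[symmetric] by (rule comp_assoc) (use ya ga ma in simp_all)
        also have "\<dots> = y \<cdot> g \<cdot> n" by (rule comp_assoc[symmetric]) (use ya ga na in simp_all)
        finally show "y \<cdot> m \<cdot> q = y \<cdot> n \<cdot> q" using yg by simp
      qed
    qed
    obtain N k where N: "N \<in> H" "k \<in> iso (ker_cat C R g) N"
      using ker_cat_belongs[OF g(2)] unfolding belongs_to_def is_iso_def by blast
    have k: "k \<in> hom (ker_cat C R g) N" "inj_on k (carrier (ker_cat C R g))" using N(2) unfolding iso_iff by blast+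
    have "k \<circ> \<phi> \<in> hom (local_monoid KC x) N" by (rule hom_compose[OF \<phi> k(1)])
    moreover have "same_action C R a b"
      if ab: "a \<in> carrier (local_monoid KC x)" "b \<in> carrier (local_monoid KC x)" and eq: "(k \<circ> \<phi>) a = (k \<circ> \<phi>) b" for a b
    proof -
      have "\<phi> a = \<phi> b"
        using inj_onD[OF k(2) _ hom_in_carrier[OF \<phi> ab(1)] hom_in_carrier[OF \<phi> ab(2)]] eq by simp
      then show ?thesis by (rule same[OF ab])
    qed
    ultimately show ?thesis using N(1) by blast
  qed
qed

end

section \<open>Block products\<close>

text \<open>The component \<open>F\<close> is meant to be the product, over all letters \<open>a\<close> of a word, of values in
  \<open>K\<close> that depend on \<open>a\<close> and on the elements of \<open>N\<close> represented by the parts of the word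
  before and after \<open>a\<close>; the arguments \<open>x\<close> and \<open>y\<close> stand for a further prefix and suffix. The
  set \<open>I\<close> of parameters is inert.\<close>

definition block_product :: "'i set \<Rightarrow> ('n, 'a) monoid_scheme \<Rightarrow> ('k, 'b) monoid_scheme \<Rightarrow> ('n \<times> ('i \<times> 'n \<times> 'n \<Rightarrow> 'k)) monoid" where
  "block_product I N K =
     \<lparr>carrier = carrier N \<times> (I \<times> carrier N \<times> carrier N \<rightarrow>\<^sub>E carrier K),
      monoid.mult = (\<lambda>(n, F) (n', F'). (n \<otimes>\<^bsub>N\<^esub> n',
        \<lambda>(i, x, y)\<in>I \<times> carrier N \<times> carrier N. F (i, x, n' \<otimes>\<^bsub>N\<^esub> y) \<otimes>\<^bsub>K\<^esub> F' (i, x \<otimes>\<^bsub>N\<^esub> n, y))),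
      one = (\<one>\<^bsub>N\<^esub>, \<lambda>_\<in>I \<times> carrier N \<times> carrier N. \<one>\<^bsub>K\<^esub>)\<rparr>"

locale block = N: monoid N + K: group K for N :: "('n, 'a) monoid_scheme" and K :: "('k, 'b) monoid_scheme" +
  fixes I :: "'i set"
begin

abbreviation "BP \<equiv> block_product I N K"
abbreviation "D \<equiv> I \<times> carrier N \<times> carrier N"

lemma BP_carrier: "(n, F) \<in> carrier BP \<longleftrightarrow> n \<in> carrier N \<and> F \<in> D \<rightarrow>\<^sub>E carrier K"
  by (simp add: block_product_def)

lemma BP_snd: "p \<in> carrier BP \<Longrightarrow> snd p \<in> D \<rightarrow>\<^sub>E carrier K"
  by (cases p) (simp add: BP_carrier)

lemma BP_mult: "(n, F) \<otimes>\<^bsub>BP\<^esub> (n', F') = (n \<otimes>\<^bsub>N\<^esub> n', \<lambda>(i, x, y)\<in>D. F (i, x, n' \<otimes>\<^bsub>N\<^esub> y) \<otimes>\<^bsub>K\<^esub> F' (i, x \<otimes>\<^bsub>N\<^esub> n, y))"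
  by (simp add: block_product_def)

lemma BP_one: "\<one>\<^bsub>BP\<^esub> = (\<one>\<^bsub>N\<^esub>, \<lambda>_\<in>D. \<one>\<^bsub>K\<^esub>)"
  by (simp add: block_product_def)

lemma BP_apply: "snd ((n, F) \<otimes>\<^bsub>BP\<^esub> (n', F')) (i, x, y) = F (i, x, n' \<otimes>\<^bsub>N\<^esub> y) \<otimes>\<^bsub>K\<^esub> F' (i, x \<otimes>\<^bsub>N\<^esub> n, y)"
  if "i \<in> I" "x \<in> carrier N" "y \<in> carrier N"
  using that by (simp add: BP_mult)

lemma D_app: "F \<in> D \<rightarrow>\<^sub>E carrier K \<Longrightarrow> i \<in> I \<Longrightarrow> x \<in> carrier N \<Longrightarrow> y \<in> carrier N \<Longrightarrow> F (i, x, y) \<in> carrier K"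
  by (rule PiE_mem[of F D "\<lambda>_. carrier K"]) simp_all

lemma D_ext: "F = G" if "F \<in> D \<rightarrow>\<^sub>E carrier K" "G \<in> D \<rightarrow>\<^sub>E carrier K"
  "\<And>i x y. i \<in> I \<Longrightarrow> x \<in> carrier N \<Longrightarrow> y \<in> carrier N \<Longrightarrow> F (i, x, y) = G (i, x, y)" for F G
  by (rule PiE_ext[OF that(1,2)]) (use that(3) in auto)

lemma BP_closed:
  assumes "p \<in> carrier BP" "q \<in> carrier BP"
  shows "p \<otimes>\<^bsub>BP\<^esub> q \<in> carrier BP"
proof -
  obtain n F n' F' where e: "p = (n, F)" "q = (n', F')" by (cases p, cases q)
  have a: "n \<in> carrier N" "F \<in> D \<rightarrow>\<^sub>E carrier K" "n' \<in> carrier N" "F' \<in> D \<rightarrow>\<^sub>E carrier K"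
    using assms unfolding e BP_carrier by blast+
  have "(\<lambda>(i, x, y)\<in>D. F (i, x, n' \<otimes>\<^bsub>N\<^esub> y) \<otimes>\<^bsub>K\<^esub> F' (i, x \<otimes>\<^bsub>N\<^esub> n, y)) \<in> D \<rightarrow>\<^sub>E carrier K"
    unfolding restrict_PiE_iff using D_app[OF a(2)] D_app[OF a(4)] a(1,3) by (simp add: case_prod_beta mem_Times_iff)
  then show ?thesis unfolding e BP_mult BP_carrier using a by simp
qed

lemma monoid_BP: "monoid BP"
proof (rule monoidI)
  show "\<one>\<^bsub>BP\<^esub> \<in> carrier BP" unfolding BP_one BP_carrier by simp
  fix p assume p: "p \<in> carrier BP"
  obtain n F where e: "p = (n, F)" by (cases p)
  have a: "n \<in> carrier N" "F \<in> D \<rightarrow>\<^sub>E carrier K" using p unfolding e BP_carrier by blast+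
  have one: "(\<one>\<^bsub>N\<^esub>, \<lambda>_\<in>D. \<one>\<^bsub>K\<^esub>) \<in> carrier BP" unfolding BP_carrier by simp
  have l: "\<one>\<^bsub>BP\<^esub> \<otimes>\<^bsub>BP\<^esub> p \<in> carrier BP" and r: "p \<otimes>\<^bsub>BP\<^esub> \<one>\<^bsub>BP\<^esub> \<in> carrier BP"
    using BP_closed one p unfolding BP_one by blast+
  show "\<one>\<^bsub>BP\<^esub> \<otimes>\<^bsub>BP\<^esub> p = p"
  proof (rule prod_eqI)
    show "fst (\<one>\<^bsub>BP\<^esub> \<otimes>\<^bsub>BP\<^esub> p) = fst p" unfolding e BP_one BP_mult using a by simp
    show "snd (\<one>\<^bsub>BP\<^esub> \<otimes>\<^bsub>BP\<^esub> p) = snd p"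
    proof (rule D_ext)
      show "snd (\<one>\<^bsub>BP\<^esub> \<otimes>\<^bsub>BP\<^esub> p) \<in> D \<rightarrow>\<^sub>E carrier K" "snd p \<in> D \<rightarrow>\<^sub>E carrier K"
        using BP_snd l p by blast+
    qed (use a in \<open>simp add: e BP_one BP_apply D_app[OF a(2)]\<close>)
  qed
  show "p \<otimes>\<^bsub>BP\<^esub> \<one>\<^bsub>BP\<^esub> = p"
  proof (rule prod_eqI)
    show "fst (p \<otimes>\<^bsub>BP\<^esub> \<one>\<^bsub>BP\<^esub>) = fst p" unfolding e BP_one BP_mult using a by simp
    show "snd (p \<otimes>\<^bsub>BP\<^esub> \<one>\<^bsub>BP\<^esub>) = snd p"
    proof (rule D_ext)
      show "snd (p \<otimes>\<^bsub>BP\<^esub> \<one>\<^bsub>BP\<^esub>) \<in> D \<rightarrow>\<^sub>E carrier K" "snd p \<in> D \<rightarrow>\<^sub>E carrier K"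
        using BP_snd r p by blast+
    qed (use a in \<open>simp add: e BP_one BP_apply D_app[OF a(2)]\<close>)
  qed
  fix q assume q: "q \<in> carrier BP"
  obtain n' F' where e': "q = (n', F')" by (cases q)
  have a': "n' \<in> carrier N" "F' \<in> D \<rightarrow>\<^sub>E carrier K" using q unfolding e' BP_carrier by blast+
  show "p \<otimes>\<^bsub>BP\<^esub> q \<in> carrier BP" by (rule BP_closed[OF p q])
  fix s assume s: "s \<in> carrier BP"
  obtain n'' F'' where e'': "s = (n'', F'')" by (cases s)
  have a'': "n'' \<in> carrier N" "F'' \<in> D \<rightarrow>\<^sub>E carrier K" using s unfolding e'' BP_carrier by blast+
  have c: "p \<otimes>\<^bsub>BP\<^esub> q \<otimes>\<^bsub>BP\<^esub> s \<in> carrier BP" "p \<otimes>\<^bsub>BP\<^esub> (q \<otimes>\<^bsub>BP\<^esub> s) \<in> carrier BP"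
    using BP_closed p q s by blast+
  show "p \<otimes>\<^bsub>BP\<^esub> q \<otimes>\<^bsub>BP\<^esub> s = p \<otimes>\<^bsub>BP\<^esub> (q \<otimes>\<^bsub>BP\<^esub> s)"
  proof (rule prod_eqI)
    show "fst (p \<otimes>\<^bsub>BP\<^esub> q \<otimes>\<^bsub>BP\<^esub> s) = fst (p \<otimes>\<^bsub>BP\<^esub> (q \<otimes>\<^bsub>BP\<^esub> s))"
      unfolding e e' e'' BP_mult using a a' a'' by (simp add: N.m_assoc)
    show "snd (p \<otimes>\<^bsub>BP\<^esub> q \<otimes>\<^bsub>BP\<^esub> s) = snd (p \<otimes>\<^bsub>BP\<^esub> (q \<otimes>\<^bsub>BP\<^esub> s))"
    proof (rule D_ext)
      show "snd (p \<otimes>\<^bsub>BP\<^esub> q \<otimes>\<^bsub>BP\<^esub> s) \<in> D \<rightarrow>\<^sub>E carrier K" "snd (p \<otimes>\<^bsub>BP\<^esub> (q \<otimes>\<^bsub>BP\<^esub> s)) \<in> D \<rightarrow>\<^sub>E carrier K"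
        using BP_snd c by blast+
      fix i x y assume "i \<in> I" "x \<in> carrier N" "y \<in> carrier N"
      then show "snd (p \<otimes>\<^bsub>BP\<^esub> q \<otimes>\<^bsub>BP\<^esub> s) (i, x, y) = snd (p \<otimes>\<^bsub>BP\<^esub> (q \<otimes>\<^bsub>BP\<^esub> s)) (i, x, y)"
        using a a' a'' D_app[OF a(2)] D_app[OF a'(2)] D_app[OF a''(2)]
        by (simp add: e e' e'' BP_mult N.m_assoc K.m_assoc)
    qed
  qed
qed

lemma finite_BP: "finite I \<Longrightarrow> finite (carrier N) \<Longrightarrow> finite (carrier K) \<Longrightarrow> finite (carrier BP)"
  unfolding block_product_def by (simp add: finite_PiE)

lemma fst_monoid_hom: "fst \<in> monoid_hom BP N"
  unfolding monoid_hom_def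
proof (intro CollectI conjI homI)
  fix p assume "p \<in> carrier BP"
  then show "fst p \<in> carrier N" by (cases p) (simp add: BP_carrier)
next
  fix p q
  show "fst (p \<otimes>\<^bsub>BP\<^esub> q) = fst p \<otimes>\<^bsub>N\<^esub> fst q" by (cases p, cases q) (simp add: BP_mult)
qed (simp add: BP_one)

text \<open>Let \<open>(e, G)\<close> be in the local group at the idempotent \<open>(e, F)\<close>. Then
  \<open>G (i, x, y) = F (i, x, ey) G (i, xe, y)\<close> and \<open>G (i, xe, y) = G (i, xe, ey) F (i, xe, y)\<close>,
  so \<open>G\<close> is determined by its values at the points \<open>(i, xe, ey)\<close>. On these the product is
  pointwise, because \<open>ee = e\<close>.\<close>

lemma LH_hom_fst:
  assumes H: "group_pseudovariety H" and K: "belongs_to K H" and fin: "finite I" "finite (carrier N)"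
  shows "LH_hom H BP fst"
  unfolding LH_hom_def
proof (intro ballI impI)
  interpret H: group_pv H by standard (rule H)
  fix f assume f: "f \<in> carrier BP" "f \<otimes>\<^bsub>BP\<^esub> f = f"
  obtain e F where fe: "f = (e, F)" by (cases f)
  have e: "e \<in> carrier N" and F: "F \<in> D \<rightarrow>\<^sub>E carrier K" using f(1) unfolding fe BP_carrier by blast+
  have ee: "e \<otimes>\<^bsub>N\<^esub> e = e" using f(2) unfolding fe BP_mult by simp
  note FK = D_app[OF F]
  have FF: "F (i, x, e \<otimes>\<^bsub>N\<^esub> y) \<otimes>\<^bsub>K\<^esub> F (i, x \<otimes>\<^bsub>N\<^esub> e, y) = F (i, x, y)"
    if "i \<in> I" "x \<in> carrier N" "y \<in> carrier N" for i x y
    using BP_apply[OF that, of e F e F] f(2) unfolding fe by simp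
  have xee: "x \<otimes>\<^bsub>N\<^esub> e \<otimes>\<^bsub>N\<^esub> e = x \<otimes>\<^bsub>N\<^esub> e" "e \<otimes>\<^bsub>N\<^esub> (e \<otimes>\<^bsub>N\<^esub> x) = e \<otimes>\<^bsub>N\<^esub> x" if "x \<in> carrier N" for x
    using that e ee N.m_assoc[of x e e] N.m_assoc[of e e x] by simp_all
  let ?P = "product_group D (\<lambda>_. K)"
  let ?h = "\<lambda>p. \<lambda>(i, x, y)\<in>D. snd p (i, x \<otimes>\<^bsub>N\<^esub> e, e \<otimes>\<^bsub>N\<^esub> y)"
  have ker: "\<exists>G. p = (e, G) \<and> G \<in> D \<rightarrow>\<^sub>E carrier K \<and> (\<forall>i\<in>I. \<forall>x\<in>carrier N. \<forall>y\<in>carrier N.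
      F (i, x, e \<otimes>\<^bsub>N\<^esub> y) \<otimes>\<^bsub>K\<^esub> G (i, x \<otimes>\<^bsub>N\<^esub> e, y) = G (i, x, y) \<and> G (i, x, e \<otimes>\<^bsub>N\<^esub> y) \<otimes>\<^bsub>K\<^esub> F (i, x \<otimes>\<^bsub>N\<^esub> e, y) = G (i, x, y))"
    if p: "p \<in> carrier (ker_monoid BP fst f)" for p
  proof -
    obtain n G where pG: "p = (n, G)" by (cases p)
    have "p \<in> carrier BP" and eq: "f \<otimes>\<^bsub>BP\<^esub> p = p" "p \<otimes>\<^bsub>BP\<^esub> f = p" and "fst p = fst f"
      using p unfolding ker_monoid_simps(1) by blast+
    then have n: "n = e" unfolding pG fe by simp
    have G: "G \<in> D \<rightarrow>\<^sub>E carrier K" using \<open>p \<in> carrier BP\<close> unfolding pG BP_carrier by blast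
    have "F (i, x, e \<otimes>\<^bsub>N\<^esub> y) \<otimes>\<^bsub>K\<^esub> G (i, x \<otimes>\<^bsub>N\<^esub> e, y) = G (i, x, y)" "G (i, x, e \<otimes>\<^bsub>N\<^esub> y) \<otimes>\<^bsub>K\<^esub> F (i, x \<otimes>\<^bsub>N\<^esub> e, y) = G (i, x, y)"
      if "i \<in> I" "x \<in> carrier N" "y \<in> carrier N" for i x y
      using BP_apply[OF that, of e F e G] BP_apply[OF that, of e G e F] eq unfolding pG fe n by simp_all
    then show ?thesis using pG n G by blast
  qed
  show "belongs_to (ker_monoid BP fst f) H"
  proof (rule H.belongs_embed[where h = ?h and P = ?P])
    show "belongs_to ?P H" using fin K by (intro H.belongs_product) simp_all
    show "monoid (ker_monoid BP fst f)"
      by (rule monoid_ker_monoid[OF monoid_BP monoid_homD(1)[OF fst_monoid_hom] f])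
    show "?h \<in> hom (ker_monoid BP fst f) ?P"
    proof (rule homI)
      fix p assume "p \<in> carrier (ker_monoid BP fst f)"
      from ker[OF this] obtain G where "p = (e, G)" and G: "G \<in> D \<rightarrow>\<^sub>E carrier K" by blast
      then show "?h p \<in> carrier ?P"
        unfolding carrier_product_group restrict_PiE_iff using D_app[OF G] e by (simp add: case_prod_beta mem_Times_iff)
    next
      fix p q assume "p \<in> carrier (ker_monoid BP fst f)" "q \<in> carrier (ker_monoid BP fst f)"
      from ker[OF this(1)] ker[OF this(2)] obtain G G' where p: "p = (e, G)" "q = (e, G')" by blast
      have "?h (p \<otimes>\<^bsub>BP\<^esub> q) d = (?h p \<otimes>\<^bsub>?P\<^esub> ?h q) d" for d
      proof (cases "d \<in> D")
        case True
        then obtain i x y where d: "d = (i, x, y)" "i \<in> I" "x \<in> carrier N" "y \<in> carrier N" by auto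
        then show ?thesis using e unfolding p by (simp add: BP_mult xee)
      qed simp
      then show "?h (p \<otimes>\<^bsub>ker_monoid BP fst f\<^esub> q) = ?h p \<otimes>\<^bsub>?P\<^esub> ?h q" by (simp only: ker_monoid_simps) blast
    qed
    show "inj_on ?h (carrier (ker_monoid BP fst f))"
    proof (rule inj_onI)
      fix p q assume "p \<in> carrier (ker_monoid BP fst f)" "q \<in> carrier (ker_monoid BP fst f)" and eq: "?h p = ?h q"
      from ker[OF this(1)] ker[OF this(2)] obtain G G' where p: "p = (e, G)" "q = (e, G')"
        and G: "G \<in> D \<rightarrow>\<^sub>E carrier K" "G' \<in> D \<rightarrow>\<^sub>E carrier K"
        and l: "\<And>i x y. i \<in> I \<Longrightarrow> x \<in> carrier N \<Longrightarrow> y \<in> carrier N \<Longrightarrow> F (i, x, e \<otimes>\<^bsub>N\<^esub> y) \<otimes>\<^bsub>K\<^esub> G (i, x \<otimes>\<^bsub>N\<^esub> e, y) = G (i, x, y)"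
          "\<And>i x y. i \<in> I \<Longrightarrow> x \<in> carrier N \<Longrightarrow> y \<in> carrier N \<Longrightarrow> F (i, x, e \<otimes>\<^bsub>N\<^esub> y) \<otimes>\<^bsub>K\<^esub> G' (i, x \<otimes>\<^bsub>N\<^esub> e, y) = G' (i, x, y)"
        and r: "\<And>i x y. i \<in> I \<Longrightarrow> x \<in> carrier N \<Longrightarrow> y \<in> carrier N \<Longrightarrow> G (i, x, e \<otimes>\<^bsub>N\<^esub> y) \<otimes>\<^bsub>K\<^esub> F (i, x \<otimes>\<^bsub>N\<^esub> e, y) = G (i, x, y)"
          "\<And>i x y. i \<in> I \<Longrightarrow> x \<in> carrier N \<Longrightarrow> y \<in> carrier N \<Longrightarrow> G' (i, x, e \<otimes>\<^bsub>N\<^esub> y) \<otimes>\<^bsub>K\<^esub> F (i, x \<otimes>\<^bsub>N\<^esub> e, y) = G' (i, x, y)"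
        by blast
      have "G = G'"
      proof (rule D_ext[OF G])
        fix i x y assume d: "i \<in> I" "x \<in> carrier N" "y \<in> carrier N"
        have "G (i, x \<otimes>\<^bsub>N\<^esub> e, e \<otimes>\<^bsub>N\<^esub> y) = G' (i, x \<otimes>\<^bsub>N\<^esub> e, e \<otimes>\<^bsub>N\<^esub> y)"
          using fun_cong[OF eq, of "(i, x, y)"] d unfolding p by simp
        then have "G (i, x \<otimes>\<^bsub>N\<^esub> e, y) = G' (i, x \<otimes>\<^bsub>N\<^esub> e, y)"
          using r(1)[of i "x \<otimes>\<^bsub>N\<^esub> e" y] r(2)[of i "x \<otimes>\<^bsub>N\<^esub> e" y] d e by simp
        then show "G (i, x, y) = G' (i, x, y)" using l(1)[OF d] l(2)[OF d] by simp
      qed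
      then show "p = q" unfolding p by simp
    qed
  qed
qed

end

section \<open>Resolving a congruence in minimal steps\<close>

lemma rel_morph_nat_copy:
  assumes "group_pseudovariety H" "monoid_pseudovariety V" and M: "LH_over H V M" and s: "rel_morph C M s R"
  shows "\<exists>(M' :: nat monoid) s'. LH_over H V M' \<and> rel_morph C M' s' R"
proof -
  interpret LH_Malcev H V by standard (rule assms)+
  obtain M' :: "nat monoid" and h where M': "LH_over H V M'" "h \<in> iso M M'" "h \<one>\<^bsub>M\<^esub> = \<one>\<^bsub>M'\<^esub>"
    using LH_over_nat_copy[OF M] .
  have h: "h \<in> hom M M'" "inj_on h (carrier M)" using M'(2) unfolding iso_iff by blast+
  show ?thesis using rel_morph_embed[OF s h(1) M'(3) h(2)] M'(1) by blast
qed

text \<open>The second component \<open>F\<close> of a value of \<open>s m\<close> maps \<open>x\<close> and \<open>y\<close> to a value in \<open>K\<close> of the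
  arrow \<open>(l, m, r)\<close> of the kernel category, where \<open>x\<close> and \<open>y\<close> are values in \<open>N\<close> of \<open>l\<close> and
  \<open>r\<close>. Values in \<open>N\<close> determine classes only of arrows with known end points, so the end
  points enter as the parameters of the block product. At identities \<open>l\<close> and \<open>r\<close> the same
  action means equality.\<close>

lemma (in min_LH_cong) lift_rel_morph:
  fixes N :: "nat monoid"
  assumes V: "monoid_pseudovariety V" and ext: "closed_under_extension H" and nontriv: "nontrivial H"
    and N: "LH_over H V N" and t: "rel_morph C N t R"
  shows "\<exists>(M :: nat monoid) s. LH_over H V M \<and> rel_morph C M s (=)"
proof -
  interpret LH_Malcev H V by standard (rule V)
  obtain N0 \<phi> where N0: "N0 \<in> V" "\<phi> \<in> monoid_hom N N0" "LH_hom H N \<phi>" and Nm: "monoid N" "finite (carrier N)"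
    using N unfolding LH_over_def by blast
  obtain K0 z where K0: "K0 \<in> H" and z: "z \<in> carrier K0" "z \<noteq> \<one>\<^bsub>K0\<^esub>"
  proof -
    obtain K0 where K0: "K0 \<in> H" "carrier K0 \<noteq> {\<one>\<^bsub>K0\<^esub>}" using nontriv unfolding nontrivial_def by blast
    interpret K0: group K0 by (rule gpv_group[OF K0(1)])
    show thesis using that[OF K0(1)] K0(2) K0.one_closed by blast
  qed
  have "\<forall>x\<in>obj KC. \<exists>N \<phi>. N \<in> H \<and> \<phi> \<in> hom (local_monoid KC x) N \<and>
    (\<forall>a\<in>carrier (local_monoid KC x). \<forall>b\<in>carrier (local_monoid KC x). \<phi> a = \<phi> b \<longrightarrow> same_action C R a b)"
    using local_group_KC[OF _ K0] by meson
  then obtain G \<gamma> where G: "\<And>x. x \<in> obj KC \<Longrightarrow> G x \<in> H" and \<gamma>: "\<And>x. x \<in> obj KC \<Longrightarrow> \<gamma> x \<in> hom (local_monoid KC x) (G x)"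
    and \<gamma>Q: "\<And>x a b. x \<in> obj KC \<Longrightarrow> a \<in> carrier (local_monoid KC x) \<Longrightarrow> b \<in> carrier (local_monoid KC x) \<Longrightarrow>
      \<gamma> x a = \<gamma> x b \<Longrightarrow> same_action C R a b"
    by metis
  interpret LG: locally_group H KC "same_action C R" G \<gamma> K0 z
    by standard (use finite_category_KC cat_congruence_same_action K0 z G \<gamma> \<gamma>Q in \<open>blast+\<close>)
  define K where "K = LG.KK"
  define \<tau> where "\<tau> m = Collect (LG.path_value m)" for m
  have \<tau>: "rel_morph KC K \<tau> (same_action C R)" using LG.rel_morph_KK unfolding K_def \<tau>_def .
  have KH: "belongs_to K H" using LG.KK unfolding K_def .
  interpret K: group K by (rule belongs_group(1)[OF KH])
  interpret B: block N K "obj C \<times> obj C"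
    by (intro block.intro Nm(1) K.group_axioms)
  let ?M = "block_product (obj C \<times> obj C) N K"
  have M: "monoid ?M" "finite (carrier ?M)"
    using B.monoid_BP B.finite_BP fin_obj Nm(2) belongs_group(2)[OF KH] by simp_all
  have overM: "LH_over H V ?M"
  proof (rule LH_overI[OF M])
    show "belongs_to N0 V" using N0(1) by (simp add: belongs_nat_monoid)
    show "\<phi> \<circ> fst \<in> monoid_hom ?M N0"
      using hom_compose[OF monoid_homD(1)[OF B.fst_monoid_hom] monoid_homD(1)[OF N0(2)]]
        monoid_homD(2)[OF B.fst_monoid_hom] monoid_homD(2)[OF N0(2)] by (simp add: monoid_hom_def)
    show "LH_hom H ?M (\<phi> \<circ> fst)"
      by (rule LH_hom_comp[OF ext M monoid_homD(1)[OF B.fst_monoid_hom] _ monoid_homD(1)[OF N0(2)] N0(3)])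
         (rule B.LH_hom_fst[OF H KH _ Nm(2)], simp add: fin_obj)
  qed
  define s where "s m = {(n, F). (n, F) \<in> carrier ?M \<and> n \<in> t m \<and> (\<forall>l r x y. l \<in> arr C \<longrightarrow> r \<in> arr C \<longrightarrow>
    tgt C l = src C m \<longrightarrow> src C r = tgt C m \<longrightarrow> x \<in> t l \<longrightarrow> y \<in> t r \<longrightarrow>
    F ((src C l, tgt C r), x, y) \<in> \<tau> (rep R l, m, rep R r))}" for m
  have sD: "(n, F) \<in> carrier ?M" "n \<in> t m"
    "\<And>l r x y. l \<in> arr C \<Longrightarrow> r \<in> arr C \<Longrightarrow> tgt C l = src C m \<Longrightarrow> src C r = tgt C m \<Longrightarrow> x \<in> t l \<Longrightarrow> y \<in> t r \<Longrightarrow>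
      F ((src C l, tgt C r), x, y) \<in> \<tau> (rep R l, m, rep R r)" if "(n, F) \<in> s m" for n F m
    using that unfolding s_def by blast+
  have sI: "(n, F) \<in> s m" if "(n, F) \<in> carrier ?M" "n \<in> t m"
    "\<And>l r x y. l \<in> arr C \<Longrightarrow> r \<in> arr C \<Longrightarrow> tgt C l = src C m \<Longrightarrow> src C r = tgt C m \<Longrightarrow> x \<in> t l \<Longrightarrow> y \<in> t r \<Longrightarrow>
      F ((src C l, tgt C r), x, y) \<in> \<tau> (rep R l, m, rep R r)" for n F m
    using that unfolding s_def by blast
  have KC_in: "(rep R l, m, rep R r) \<in> arr KC" if "l \<in> arr C" "r \<in> arr C" "m \<in> arr C" "tgt C l = src C m" "src C r = tgt C m" for l m r
    using that by (simp add: KC_arr)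
  have "rel_morph C ?M s (=)"
    unfolding rel_morph_def
  proof (intro conjI ballI impI)
    fix m assume m: "m \<in> arr C"
    show "s m \<subseteq> carrier ?M" unfolding s_def by blast
    obtain n where n: "n \<in> t m" using rel_morphD(1)[OF t m] by blast
    \<comment> \<open>A choice of \<open>F\<close> is possible since \<open>x\<close> and the end points determine the class of \<open>l\<close>, and likewise for \<open>r\<close>.\<close>
    define P where "P d k \<longleftrightarrow> (\<exists>l r. l \<in> arr C \<and> r \<in> arr C \<and> tgt C l = src C m \<and> src C r = tgt C m \<and> fst d = (src C l, tgt C r) \<and>
      fst (snd d) \<in> t l \<and> snd (snd d) \<in> t r \<and> k \<in> \<tau> (rep R l, m, rep R r))" for d k
    define F where "F = (\<lambda>d\<in>B.D. if \<exists>k. P d k then SOME k. P d k else \<one>\<^bsub>K\<^esub>)"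
    have F: "F d \<in> carrier K" if d: "d \<in> B.D" for d
    proof (cases "\<exists>k. P d k")
      case True
      then have "P d (F d)" unfolding F_def restrict_apply'[OF d] if_P[OF True] by (rule someI_ex)
      then obtain l r where "l \<in> arr C" "r \<in> arr C" "tgt C l = src C m" "src C r = tgt C m" "F d \<in> \<tau> (rep R l, m, rep R r)"
        unfolding P_def by blast
      then show ?thesis using rel_morphD(2)[OF \<tau> KC_in[OF _ _ m]] by blast
    next
      case False
      then have "F d = \<one>\<^bsub>K\<^esub>" unfolding F_def restrict_apply'[OF d] by (rule if_not_P)
      then show ?thesis by simp
    qed
    have "(n, F) \<in> s m"
    proof (rule sI[OF _ n])
      have "F \<in> B.D \<rightarrow>\<^sub>E carrier K" using F by (intro PiE_I) (simp_all add: F_def)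
      then show "(n, F) \<in> carrier ?M" using rel_morphD(2)[OF t m n] by (simp add: B.BP_carrier)
      fix l r x y assume lr: "l \<in> arr C" "r \<in> arr C" "tgt C l = src C m" "src C r = tgt C m" "x \<in> t l" "y \<in> t r"
      let ?d = "((src C l, tgt C r), x, y)"
      have d: "?d \<in> B.D" using lr rel_morphD(2)[OF t] by simp
      obtain k where "k \<in> \<tau> (rep R l, m, rep R r)" using rel_morphD(1)[OF \<tau> KC_in[OF lr(1,2) m lr(3,4)]] by blast
      then have "P ?d k" unfolding P_def using lr by (intro exI[of _ l] exI[of _ r]) simp
      then have ex: "\<exists>k. P ?d k" by blast
      have "P ?d (F ?d)" unfolding F_def restrict_apply'[OF d] if_P[OF ex] by (rule someI_ex[OF ex])
      then obtain l' r' where lr': "l' \<in> arr C" "r' \<in> arr C" "tgt C l' = src C m" "src C r' = tgt C m" "src C l' = src C l" "tgt C r' = tgt C r"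
        "x \<in> t l'" "y \<in> t r'" "F ?d \<in> \<tau> (rep R l', m, rep R r')" unfolding P_def by auto
      have "R l' l" by (rule rel_morphD(5)[OF t lr'(1) lr(1) lr'(5) _ lr'(7) lr(5)]) (use lr lr' in simp)
      moreover have "R r' r" by (rule rel_morphD(5)[OF t lr'(2) lr(2) _ lr'(6) lr'(8) lr(6)]) (use lr lr' in simp)
      ultimately show "F ?d \<in> \<tau> (rep R l, m, rep R r)" using lr'(9) rep_eq by metis
    qed
    then show "s m \<noteq> {}" by blast
  next
    fix c assume c: "c \<in> obj C"
    show "\<one>\<^bsub>?M\<^esub> \<in> s (ident C c)"
      unfolding B.BP_one
    proof (rule sI)
      show "(\<one>\<^bsub>N\<^esub>, \<lambda>_\<in>B.D. \<one>\<^bsub>K\<^esub>) \<in> carrier ?M" unfolding B.BP_carrier by simp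
      show "\<one>\<^bsub>N\<^esub> \<in> t (ident C c)" by (rule rel_morphD(3)[OF t c])
      fix l r x y assume lr: "l \<in> arr C" "r \<in> arr C" "tgt C l = src C (ident C c)" "src C r = tgt C (ident C c)" "x \<in> t l" "y \<in> t r"
      have "\<one>\<^bsub>K\<^esub> \<in> \<tau> (ident KC (rep R l, rep R r))"
        by (rule rel_morphD(3)[OF \<tau>]) (use lr c in \<open>simp add: KC_obj\<close>)
      then show "(\<lambda>_\<in>B.D. \<one>\<^bsub>K\<^esub>) ((src C l, tgt C r), x, y) \<in> \<tau> (rep R l, ident C c, rep R r)"
        using lr c rel_morphD(2)[OF t] by simp
    qed
  next
    fix m m' p q assume m: "m \<in> arr C" "m' \<in> arr C" "tgt C m = src C m'" and "p \<in> s m" "q \<in> s m'"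
    moreover obtain n F n' F' where e: "p = (n, F)" "q = (n', F')" by (cases p, cases q)
    ultimately have p: "(n, F) \<in> s m" and q: "(n', F') \<in> s m'" by simp_all
    note P = sD[OF p] and Q = sD[OF q]
    have nn: "n \<in> carrier N" "n' \<in> carrier N" using P(1) Q(1) unfolding B.BP_carrier by blast+
    have c: "(n, F) \<otimes>\<^bsub>?M\<^esub> (n', F') \<in> carrier ?M" by (rule B.BP_closed[OF P(1) Q(1)])
    show "p \<otimes>\<^bsub>?M\<^esub> q \<in> s (m \<cdot> m')"
      unfolding e B.BP_mult
    proof (rule sI[OF c[unfolded B.BP_mult]])
      show "n \<otimes>\<^bsub>N\<^esub> n' \<in> t (m \<cdot> m')" by (rule rel_morphD(4)[OF t m P(2) Q(2)])
      fix l r x y assume "l \<in> arr C" "r \<in> arr C" "tgt C l = src C (m \<cdot> m')" "src C r = tgt C (m \<cdot> m')" and xy: "x \<in> t l" "y \<in> t r"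
      then have lr: "l \<in> arr C" "r \<in> arr C" "tgt C l = src C m" "src C r = tgt C m'" using m by simp_all
      have xN: "x \<in> carrier N" "y \<in> carrier N" using rel_morphD(2)[OF t] lr xy by blast+
      have lm: "l \<cdot> m \<in> arr C" "m' \<cdot> r \<in> arr C" "src C (l \<cdot> m) = src C l" "tgt C (m' \<cdot> r) = tgt C r"
        "tgt C (l \<cdot> m) = src C m'" "src C (m' \<cdot> r) = tgt C m" using lr m by simp_all
      have ny: "n' \<otimes>\<^bsub>N\<^esub> y \<in> t (m' \<cdot> r)" by (rule rel_morphD(4)[OF t m(2) lr(2) lr(4)[symmetric] Q(2) xy(2)])
      have xn: "x \<otimes>\<^bsub>N\<^esub> n \<in> t (l \<cdot> m)" by (rule rel_morphD(4)[OF t lr(1) m(1) lr(3) xy(1) P(2)])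
      let ?a = "(rep R l, m, rep R (m' \<cdot> r))" and ?b = "(rep R (l \<cdot> m), m', rep R r)"
      have "F ((src C l, tgt C r), x, n' \<otimes>\<^bsub>N\<^esub> y) \<in> \<tau> ?a"
        using P(3)[OF lr(1) lm(2) lr(3) lm(6) xy(1) ny] lm(4) by simp
      moreover have "F' ((src C l, tgt C r), x \<otimes>\<^bsub>N\<^esub> n, y) \<in> \<tau> ?b"
        using Q(3)[OF lm(1) lr(2) lm(5) lr(4) xn xy(2)] lm(3) by simp
      moreover have "?a \<in> arr KC" "?b \<in> arr KC" using lr m lm by (simp_all add: KC_arr)
      moreover have "tgt KC ?a = src KC ?b" using lr m by (simp add: rep_comp)
      ultimately have "F ((src C l, tgt C r), x, n' \<otimes>\<^bsub>N\<^esub> y) \<otimes>\<^bsub>K\<^esub> F' ((src C l, tgt C r), x \<otimes>\<^bsub>N\<^esub> n, y) \<in> \<tau> (ccomp KC ?a ?b)"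
        using rel_morphD(4)[OF \<tau>] by blast
      then show "(\<lambda>(i, x, y)\<in>B.D. F (i, x, n' \<otimes>\<^bsub>N\<^esub> y) \<otimes>\<^bsub>K\<^esub> F' (i, x \<otimes>\<^bsub>N\<^esub> n, y)) ((src C l, tgt C r), x, y) \<in> \<tau> (rep R l, m \<cdot> m', rep R r)"
        using lr xN by simp
    qed
  next
    fix m m' assume m: "m \<in> arr C" "m' \<in> arr C" "src C m = src C m'" "tgt C m = tgt C m'" "s m \<inter> s m' \<noteq> {}"
    then obtain n F where "(n, F) \<in> s m" "(n, F) \<in> s m'" by auto
    note P = sD[OF this(1)] and Q = sD[OF this(2)]
    have Rm: "R m m'" by (rule rel_morphD(5)[OF t m(1-4) P(2) Q(2)])
    let ?l = "ident C (src C m)" and ?r = "ident C (tgt C m)"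
    let ?a = "(rep R ?l, m, rep R ?r)" and ?b = "(rep R ?l, m', rep R ?r)"
    have lr: "?l \<in> arr C" "?r \<in> arr C" "src C ?l = src C m" "tgt C ?l = src C m" "src C ?r = tgt C m" "tgt C ?r = tgt C m"
      using m by simp_all
    have 1: "\<one>\<^bsub>N\<^esub> \<in> t ?l" "\<one>\<^bsub>N\<^esub> \<in> t ?r" using rel_morphD(3)[OF t] m by simp_all
    have "F ((src C ?l, tgt C ?r), \<one>\<^bsub>N\<^esub>, \<one>\<^bsub>N\<^esub>) \<in> \<tau> ?a" by (rule P(3)[OF lr(1,2,4,5) 1])
    moreover have "F ((src C ?l, tgt C ?r), \<one>\<^bsub>N\<^esub>, \<one>\<^bsub>N\<^esub>) \<in> \<tau> ?b" by (rule Q(3)) (use lr 1 m in simp_all)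
    moreover have "?a \<in> arr KC" "?b \<in> arr KC" using lr m by (simp_all add: KC_arr)
    moreover have "rep R (m \<cdot> rep R ?r) = rep R (m' \<cdot> rep R ?r)"
      by (rule rep_eq[OF R_right[OF Rm]]) (use lr in simp_all)
    moreover have "rep R (rep R ?l \<cdot> m) = rep R (rep R ?l \<cdot> m')"
      by (rule rep_eq[OF R_left[OF Rm]]) (use lr in simp_all)
    ultimately have "same_action C R ?a ?b" by (intro rel_morphD(5)[OF \<tau>]) simp_all
    moreover have "R ?l (rep R ?l)" "R ?r (rep R ?r)" using rep_R lr by blast+
    ultimately have "?l \<cdot> m \<cdot> ?r = ?l \<cdot> m' \<cdot> ?r" using same_actionD(7) by blast
    then show "m = m'" using m by simp
  qed
  then show ?thesis using rel_morph_nat_copy[OF H V overM] by blast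
qed

lemma rel_morph_mono: "rel_morph C N t R \<Longrightarrow> (\<And>x y. R x y \<Longrightarrow> R' x y) \<Longrightarrow> rel_morph C N t R'"
  unfolding rel_morph_def by simp

context cat_cong
begin

lemma ex_min_cong:
  assumes "R x y" "x \<noteq> y"
  obtains R1 p q where "min_cong C R1" "\<And>a b. R1 a b \<Longrightarrow> R a b" "R1 p q" "p \<noteq> q"
proof -
  let ?P = "\<lambda>R'. cat_congruence C R' \<and> (\<forall>a b. R' a b \<longrightarrow> R a b) \<and> (\<exists>p q. R' p q \<and> p \<noteq> q)"
  let ?c = "\<lambda>R'. card {(a, b). R' a b}"
  have "?P R" using cong assms by blast
  then obtain R1 where R1: "?P R1" and least: "\<And>R'. ?P R' \<Longrightarrow> ?c R1 \<le> ?c R'"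
    using ex_has_least_nat[of ?P R ?c] by blast
  have "min_cong C R1"
  proof (intro min_cong.intro cat_cong.intro fin_cat_axioms cat_cong_axioms.intro min_cong_axioms.intro)
    show "cat_congruence C R1" using R1 by blast
    fix R' a b p q assume R': "cat_congruence C R'" "\<And>x y. R' x y \<Longrightarrow> R1 x y" "R' a b" "a \<noteq> b" and pq: "R1 p q"
    then have "?P R'" using R1 by blast
    then have "?c R1 \<le> ?c R'" by (rule least)
    moreover have "{(a, b). R' a b} \<subseteq> {(a, b). R1 a b}" using R'(2) by blast
    moreover have "{(a, b). R1 a b} \<subseteq> arr C \<times> arr C" using R1 R_arr by blast
    then have "finite {(a, b). R1 a b}" using fin_arr finite_subset by blast
    ultimately have "{(a, b). R' a b} = {(a, b). R1 a b}" by (intro card_seteq)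
    then show "R' p q" using pq by blast
  qed
  then show thesis using that R1 by blast
qed

end

text \<open>The intermediate congruence \<open>R1\<close> splits \<open>R\<close> into \<open>R1\<close> itself and the congruence \<open>Rq\<close> on
  the quotient by \<open>R1\<close>.\<close>

locale cong_pair = group_pv H + cat_cong C R for H :: "nat monoid set" and C :: "('o, 'm) cat" and R +
  fixes R1 :: "'m \<Rightarrow> 'm \<Rightarrow> bool"
  assumes LH: "LH_congruence H C R" and cong1: "cat_congruence C R1" and sub: "R1 x y \<Longrightarrow> R x y"
begin

interpretation S: cat_cong C R1 by standard (rule cong1)

lemma LH_congruence_sub: "LH_congruence H C R1"
  unfolding LH_congruence_def
proof (intro conjI ballI impI cong1)
  fix g assume g: "g \<in> arr C" "src C g = tgt C g \<and> g \<cdot> g = g"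
  then have "belongs_to (ker_cat C R g) H" using LH unfolding LH_congruence_def by blast
  moreover have "monoid (ker_cat C R1 g)" by (rule S.monoid_ker_cat) (use g in \<open>simp add: idem_arr_def\<close>)
  moreover have "id \<in> hom (ker_cat C R1 g) (ker_cat C R g)" using sub by (intro homI) (simp_all add: ker_cat_def)
  ultimately show "belongs_to (ker_cat C R1 g) H" using belongs_embed inj_on_id by blast
qed

definition Rq :: "'m \<Rightarrow> 'm \<Rightarrow> bool" where
  "Rq x y \<longleftrightarrow> x \<in> rep R1 ` arr C \<and> y \<in> rep R1 ` arr C \<and> R x y"

lemma RqD: "Rq x y \<Longrightarrow> R x y \<and> rep R1 x = x \<and> rep R1 y = y"
  unfolding Rq_def using S.rep_image_iff by blast

lemma R_rep1: "x \<in> arr C \<Longrightarrow> R x (rep R1 x)"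
  using sub S.rep_R by blast

lemma cat_congruence_Rq: "cat_congruence (quotient_cat C R1) Rq"
  unfolding cat_congruence_def quotient_cat_simps
proof (intro conjI allI impI ballI)
  fix x y u assume xy: "Rq x y" and "u \<in> rep R1 ` arr C"
  then have u: "u \<in> arr C" and R: "R x y" using S.rep_image_iff unfolding Rq_def by blast+
  note a = R_arr[OF R]
  have *: "Rq (rep R1 p) (rep R1 q)" if "R p q" for p q
    using that R_rep1[of p] R_rep1[of q] R_arr[OF that] R_sym R_trans unfolding Rq_def by blast
  { assume "tgt C u = src C x"
    then show "Rq (rep R1 (u \<cdot> x)) (rep R1 (u \<cdot> y))" using *[OF R_left[OF R u]] by blast }
  { assume "src C u = tgt C x"
    then show "Rq (rep R1 (x \<cdot> u)) (rep R1 (y \<cdot> u))" using *[OF R_right[OF R u]] by blast }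
next
  fix x assume "x \<in> rep R1 ` arr C"
  then show "Rq x x" unfolding Rq_def using R_refl S.rep_image_iff by blast
next
  fix x y assume xy: "Rq x y"
  then have R: "R x y" unfolding Rq_def by blast
  show "x \<in> rep R1 ` arr C" "y \<in> rep R1 ` arr C" using xy unfolding Rq_def by blast+
  show "src C x = src C y" "tgt C x = tgt C y" by (rule R_arr[OF R])+
  show "Rq y x" using xy R_sym[OF R] unfolding Rq_def by blast
next
  fix x y z assume xy: "Rq x y" and yz: "Rq y z"
  have "R x z" using xy yz R_trans unfolding Rq_def by blast
  then show "Rq x z" using xy yz unfolding Rq_def by blast
qed

text \<open>An idempotent of the quotient is represented by an idempotent \<open>f\<close>, and the local group at
  \<open>f\<close> maps onto the local group of the quotient.\<close>

lemma LH_congruence_Rq: "LH_congruence H (quotient_cat C R1) Rq"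
  unfolding LH_congruence_def
proof (intro conjI ballI impI cat_congruence_Rq)
  let ?D = "quotient_cat C R1"
  interpret D: cat_cong ?D Rq
    by (intro cat_cong.intro fin_cat.intro cat_cong_axioms.intro S.finite_category_quotient cat_congruence_Rq)
  fix g assume "g \<in> arr ?D" and "src ?D g = tgt ?D g \<and> ccomp ?D g g = g"
  then have g: "g \<in> arr C" "rep R1 g = g" "src C g = tgt C g" "rep R1 (g \<cdot> g) = g" and gD: "g \<in> rep R1 ` arr C"
    using S.rep_image_iff by simp_all
  have gg: "R1 (g \<cdot> g) g" using S.rep_R[of "g \<cdot> g"] g by simp
  interpret L: finite_semigroup_on "carrier (local_monoid C (tgt C g))" "ccomp C" by (rule semigroup_local)
  have gL: "g \<in> carrier (local_monoid C (tgt C g))" using g by simp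
  have "R1 (spower (ccomp C) g n) g" for n
  proof (induction n)
    case (Suc n)
    then have "R1 (g \<cdot> spower (ccomp C) g n) (g \<cdot> g)" using S.R_left[of _ g g] L.spower_in[OF gL, of n] g by simp
    then show ?case using gg S.R_trans by simp
  qed (use S.R_refl g in simp)
  moreover obtain n where "spower (ccomp C) g n \<cdot> spower (ccomp C) g n = spower (ccomp C) g n"
    by (rule L.idempotent_spower[OF gL])
  ultimately obtain f where f: "R1 f g" "f \<cdot> f = f" by blast
  note fa = S.R_arr[OF f(1)]
  have fi: "src C f = tgt C f" "f \<in> arr C" using fa g by simp_all
  have kf: "belongs_to (ker_cat C R f) H" using LH fi f(2) unfolding LH_congruence_def by blast
  have mg: "monoid (ker_cat ?D Rq g)"
    by (rule D.monoid_ker_cat) (use g gD in \<open>simp add: D.idem_arr_def\<close>)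
  have kD: "x \<in> carrier (ker_cat ?D Rq g) \<longleftrightarrow> Rq x g \<and> rep R1 (g \<cdot> x) = x \<and> rep R1 (x \<cdot> g) = x" for x
    by (simp add: ker_cat_def)
  have kC: "x \<in> carrier (ker_cat C R f) \<longleftrightarrow> R x f \<and> f \<cdot> x = x \<and> x \<cdot> f = x" for x
    by (simp add: ker_cat_def)
  have Rfg: "R f g" by (rule sub[OF f(1)])
  have "rep R1 \<in> epi (ker_cat C R f) (ker_cat ?D Rq g)"
  proof (intro epiI homI)
    fix x assume "x \<in> carrier (ker_cat C R f)"
    then have x: "R x f" "f \<cdot> x = x" "x \<cdot> f = x" unfolding kC by blast+
    note xa = R_arr[OF x(1)]
    have "rep R1 (g \<cdot> rep R1 x) = rep R1 (g \<cdot> x)" by (rule S.rep_comp(2)) (use xa fi g fa in simp_all)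
    also have "\<dots> = rep R1 (f \<cdot> x)" by (rule S.rep_eq[OF S.R_right[OF S.R_sym[OF f(1)]]]) (use xa fi g fa in simp_all)
    finally have 1: "rep R1 (g \<cdot> rep R1 x) = rep R1 x" using x(2) by simp
    have "rep R1 (rep R1 x \<cdot> g) = rep R1 (x \<cdot> g)" by (rule S.rep_comp(1)) (use xa fi g fa in simp_all)
    also have "\<dots> = rep R1 (x \<cdot> f)" by (rule S.rep_eq[OF S.R_left[OF S.R_sym[OF f(1)]]]) (use xa fi g fa in simp_all)
    finally have 2: "rep R1 (rep R1 x \<cdot> g) = rep R1 x" using x(3) by simp
    have "R (rep R1 x) g" using R_rep1[OF xa(1)] x(1) Rfg R_sym R_trans by blast
    then have "Rq (rep R1 x) g" unfolding Rq_def using xa(1) gD by blast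
    then show "rep R1 x \<in> carrier (ker_cat ?D Rq g)" unfolding kD using 1 2 by blast
  next
    fix x y assume "x \<in> carrier (ker_cat C R f)" "y \<in> carrier (ker_cat C R f)"
    then have "R x f" "R y f" unfolding kC by blast+
    note xa = R_arr[OF this(1)] R_arr[OF this(2)]
    have "rep R1 (rep R1 x \<cdot> rep R1 y) = rep R1 (x \<cdot> rep R1 y)" by (rule S.rep_comp(1)) (use xa fi in simp_all)
    also have "\<dots> = rep R1 (x \<cdot> y)" by (rule S.rep_comp(2)) (use xa fi in simp_all)
    finally show "rep R1 (x \<otimes>\<^bsub>ker_cat C R f\<^esub> y) = rep R1 x \<otimes>\<^bsub>ker_cat ?D Rq g\<^esub> rep R1 y"
      by (simp add: ker_cat_def)
  next
    fix y assume "y \<in> carrier (ker_cat ?D Rq g)"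
    then have y: "Rq y g" "rep R1 (g \<cdot> y) = y" "rep R1 (y \<cdot> g) = y" unfolding kD by blast+
    have Ry: "R y g" using RqD[OF y(1)] by blast
    note ya = R_arr[OF Ry]
    let ?x = "f \<cdot> y \<cdot> f"
    have "R y f" using Ry R_sym[OF Rfg] R_trans by blast
    then have "R (f \<cdot> y) (f \<cdot> f)" by (rule R_left) (use ya fi fa g in simp_all)
    then have "R (f \<cdot> y \<cdot> f) (f \<cdot> f \<cdot> f)" by (rule R_right) (use ya fi fa g in simp_all)
    then have "R ?x f" using f(2) by simp
    moreover have "f \<cdot> ?x = ?x" using f(2) ya fi fa g comp_assoc[of f f "y \<cdot> f"] comp_assoc[of f y f] by simp
    moreover have "?x \<cdot> f = ?x" using f(2) ya fi fa g comp_assoc[of "f \<cdot> y" f f] by simp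
    ultimately have "?x \<in> carrier (ker_cat C R f)" unfolding kC by blast
    moreover have "rep R1 ?x = y"
    proof -
      have "R1 (f \<cdot> y) (g \<cdot> y)" by (rule S.R_right[OF f(1)]) (use ya fi fa g in simp_all)
      moreover have "R1 (g \<cdot> y) y" using S.rep_R[of "g \<cdot> y"] y(2) ya g by simp
      ultimately have "R1 (f \<cdot> y) y" using S.R_trans by blast
      then have "R1 (f \<cdot> y \<cdot> f) (y \<cdot> g)" by (rule S.R_comp[OF _ f(1)]) (use ya fi fa g in simp)
      then show ?thesis using S.rep_eq y(3) by metis
    qed
    ultimately show "\<exists>x\<in>carrier (ker_cat C R f). rep R1 x = y" by blast
  qed
  then show "belongs_to (ker_cat ?D Rq g) H" by (rule belongs_image[OF kf mg])
qed

lemma rel_morph_Rq: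
  assumes t: "rel_morph C N t R"
  shows "rel_morph (quotient_cat C R1) N (\<lambda>m. \<Union>x\<in>{x. R1 x m}. t x) Rq"
  unfolding rel_morph_def quotient_cat_simps
proof (intro conjI ballI impI)
  fix m assume "m \<in> rep R1 ` arr C"
  then have m: "m \<in> arr C" using S.rep_image_iff by blast
  show "(\<Union>x\<in>{x. R1 x m}. t x) \<noteq> {}" using S.R_refl[OF m] rel_morphD(1)[OF t m] by blast
  show "(\<Union>x\<in>{x. R1 x m}. t x) \<subseteq> carrier N" using S.R_arr(1) rel_morphD(2)[OF t] by blast
next
  fix c assume c: "c \<in> obj C"
  have "R1 (ident C c) (rep R1 (ident C c))" using S.rep_R c by simp
  then show "\<one>\<^bsub>N\<^esub> \<in> (\<Union>x\<in>{x. R1 x (rep R1 (ident C c))}. t x)" using rel_morphD(3)[OF t c] by blast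
next
  fix m n x y assume mn: "tgt C m = src C n" and "x \<in> (\<Union>x\<in>{x. R1 x m}. t x)" "y \<in> (\<Union>x\<in>{x. R1 x n}. t x)"
  then obtain a b where ab: "R1 a m" "x \<in> t a" "R1 b n" "y \<in> t b" by blast
  note a = S.R_arr[OF ab(1)] S.R_arr[OF ab(3)]
  have st: "tgt C a = src C b" using a mn by simp
  have "x \<otimes>\<^bsub>N\<^esub> y \<in> t (a \<cdot> b)" by (rule rel_morphD(4)[OF t a(1,5) st ab(2,4)])
  moreover have "R1 (a \<cdot> b) (rep R1 (m \<cdot> n))"
    using S.R_trans[OF S.R_comp[OF ab(1,3) st] S.rep_R] a mn by simp
  ultimately show "x \<otimes>\<^bsub>N\<^esub> y \<in> (\<Union>x\<in>{x. R1 x (rep R1 (m \<cdot> n))}. t x)" by blast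
next
  fix m n assume mn: "m \<in> rep R1 ` arr C" "n \<in> rep R1 ` arr C" "src C m = src C n" "tgt C m = tgt C n"
    "(\<Union>x\<in>{x. R1 x m}. t x) \<inter> (\<Union>x\<in>{x. R1 x n}. t x) \<noteq> {}"
  then obtain a b x where ab: "R1 a m" "x \<in> t a" "R1 b n" "x \<in> t b" by blast
  note a = S.R_arr[OF ab(1)] S.R_arr[OF ab(3)]
  have "R a b" by (rule rel_morphD(5)[OF t a(1,5) _ _ ab(2,4)]) (use a mn in simp_all)
  then have "R m n" using sub[OF ab(1)] sub[OF ab(3)] R_sym R_trans by blast
  then show "Rq m n" unfolding Rq_def using mn by blast
qed

end

text \<open>The quotient by a minimal congruence below \<open>R\<close> has fewer arrows, so by induction it
  divides a monoid with an LH-homomorphism into a member of \<open>V\<close>; what is left to resolve is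
  the minimal congruence.\<close>

lemma (in LH_Malcev) LH_over_divisor_extension:
  fixes C :: "('o, 'm) cat" and N :: "nat monoid"
  assumes ext: "closed_under_extension H" and nontriv: "nontrivial H"
    and "finite_category C" "LH_congruence H C R" "rel_morph C N t R" "LH_over H V N"
  shows "\<exists>(M :: nat monoid) s. LH_over H V M \<and> rel_morph C M s (=)"
  using assms(3-)
proof (induction "card (arr C)" arbitrary: C R N t rule: less_induct)
  case less
  interpret cat_cong C R
    by standard (use less.prems in \<open>simp_all add: LH_congruence_def\<close>)
  show ?case
  proof (cases "\<exists>x y. R x y \<and> x \<noteq> y")
    case False
    then have "rel_morph C N t (=)" by (intro rel_morph_mono[OF less.prems(3)]) blast
    then show ?thesis using less.prems(4) by blast
  next
    case True
    then obtain x y where "R x y" "x \<noteq> y" by blast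
    then obtain R1 p q where R1: "min_cong C R1" "\<And>a b. R1 a b \<Longrightarrow> R a b" "R1 p q" "p \<noteq> q"
      by (rule ex_min_cong) blast
    interpret M: min_cong C R1 by (rule R1(1))
    interpret P: cong_pair H C R R1
      by standard (use less.prems(2) M.cong R1(2) in blast)+
    interpret L: min_LH_cong H C R1 by standard (rule P.LH_congruence_sub)
    obtain M1 :: "nat monoid" and s1 where "LH_over H V M1" "rel_morph (quotient_cat C R1) M1 s1 (=)"
      using less.hyps[OF M.card_quotient_less[OF R1(3,4)] M.finite_category_quotient P.LH_congruence_Rq
          P.rel_morph_Rq[OF less.prems(3)] less.prems(4)] by blast
    then show ?thesis using L.lift_rel_morph[OF V ext nontriv] M.rel_morph_of_quotient by blast
  qed
qed

section \<open>Locality of the Mal'cev product\<close>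

theorem theorem1p1:
  fixes H V :: "nat monoid set"
  assumes "group_pseudovariety H"
    and "monoid_pseudovariety V"
    and "is_local V"
    and "(Fitting H \<and> belongs_to Brandt_monoid V) \<or> (nontrivial H \<and> closed_under_extension H)"
  shows "is_local (Malcev (LH H) V)"
proof -
  interpret LH_Malcev H V by standard (rule assms)+
  interpret W: monoid_pv "Malcev (LH H) V" by standard (rule monoid_pseudovariety_Malcev)
  have fit: "Fitting H" using assms(4) extension_imp_Fitting by blast
  have "lV (Malcev (LH H) V) \<subseteq> gV (Malcev (LH H) V)"
  proof
    fix C assume C: "C \<in> lV (Malcev (LH H) V)"
    then have fc: "finite_category C" unfolding lV_def by blast
    obtain R N t where R: "LH_congruence H C R" and N: "N \<in> V" and t: "rel_morph C N t R"
      using ex_LH_congruence[OF assms(3) fit C] by blast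
    have "\<exists>(M :: nat monoid) s. LH_over H V M \<and> rel_morph C M s (=)"
      using assms(4)
    proof
      assume "Fitting H \<and> belongs_to Brandt_monoid V"
      then show ?thesis using LH_over_divisor_Brandt[OF _ fc R N t] by blast
    next
      assume "nontrivial H \<and> closed_under_extension H"
      then show ?thesis using LH_over_divisor_extension[OF _ _ fc R t LH_over_member[OF N]] by blast
    qed
    then obtain M :: "nat monoid" and s where M: "LH_over H V M" and s: "rel_morph C M s (=)" by blast
    have "M \<in> Malcev (LH H) V"
      using M hull_subset[of "Malcev_generators (LH H) V" monoid_pseudovariety] unfolding LH_over_nat Malcev_def by blast
    moreover have "cat_divides C (one_object_cat M)" using s cat_divides_one_object_iff by blast
    ultimately show "C \<in> gV (Malcev (LH H) V)" unfolding gV_def using fc by blast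
  qed
  then show ?thesis unfolding is_local_def using W.gV_subset_lV by blast
qed

end
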